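(* For every $\lambda\in\Lambda$, $$\overline R_\lambda(1,\dots,1)=\begin{cases}B_\lambda&\text{if }n\text{ is odd or }[\lambda]_1=0;\\0&\text{otherwise.}\end{cases}$$
   Context: Let $k$ be a field of characteristic zero, $n\ge 1$, $\mathcal P=k[z_1,\dots,z_n]$, and let $W\subseteq S_n$ be the group of permutations $\pi$ with $\pi(i)\equiv i \bmod 2$ for all $i$, acting by permuting variables. $\Lambda$ is the set of integer tuples $\lambda=(\lambda_1\ge\dots\ge\lambda_n\ge 0)$ and $|\lambda|_{\rm odd}=\sum_{i\text{ odd}}\lambda_i$. Fix $r\in k$ which is not a negative rational number and put $\rho=((n-1)r,(n-2)r,\dots,r,0)$. For $\lambda\in\Lambda$ let $[\lambda]_m=\lambda_m-\lambda_{m+1}+\dots+(-1)^{n-m}\lambda_n$; in particular $[\lambda]_1=\lambda_1-\lambda_2+\lambda_3-\cdots$. $R_\lambda(z;r)\in\mathcal P^W$ is the unique $W$-invariant polynomial of degree $|\lambda|_{\rm odd}$ which satisfies $R_\lambda(\rho+\mu)=0$ for all $\mu\in\Lambda$ with $|\mu|_{\rm odd}\le|\lambda|_{\rm odd}$, $\mu\ne\lambda$, and in which the monomial $z^{[\lambda]}$ has coefficient $1$ (it is known that this exists and is unique). $\overline R_\lambda$ is its homogeneous component of highest degree $|\lambda|_{\rm odd}$. With $[x\uparrow m]=x(x+1)\cdots(x+m-1)$, $$B_\lambda=\frac{\prod_{1\le i<j\le n,\ j-i\text{ odd}}[(j-i+1)r\uparrow\lambda_i-\lambda_j]}{\prod_{1\le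 i<j\le n,\ j-i\text{ even}}[(j-i)r\uparrow\lambda_i-\lambda_j]} .$$ For $r=0$, $B_\lambda$ is understood as the limit $r\to0$, i.e. as the value at $0$ of this expression viewed as a rational function of $r$ (after cancellation). *)

theory Defs
  imports
    "HOL-Library.Poly_Mapping"
    "HOL-Combinatorics.Permutations"
    "HOL-Computational_Algebra.Polynomial"
    "HOL-Computational_Algebra.Fraction_Field"
begin

section \<open>Multivariate polynomials\<close>

text \<open>
  A polynomial in variables indexed by natural numbers is a finitely supported function from
  exponent vectors to coefficients; the convolution product of \<^theory>\<open>HOL-Library.Poly_Mapping\<close>
  is the usual multiplication.
\<close>

type_synonym 'a mpoly = "(nat \<Rightarrow>\<^sub>0 nat) \<Rightarrow>\<^sub>0 'a"

definition mono_deg :: "(nat \<Rightarrow>\<^sub>0 nat) \<Rightarrow> nat" where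
  "mono_deg m = (\<Sum>i\<in>Poly_Mapping.keys m. Poly_Mapping.lookup m i)"

text \<open>The polynomial ring in the variables with indices \<open>1, \<dots>, n\<close>.\<close>

definition poly_ring :: "nat \<Rightarrow> 'a::zero mpoly set" where
  "poly_ring n = {p. \<forall>m\<in>Poly_Mapping.keys p. Poly_Mapping.keys m \<subseteq> {1..n}}"

text \<open>Total degree, with the convention that the zero polynomial has degree 0.\<close>

definition total_deg :: "'a::zero mpoly \<Rightarrow> nat" where
  "total_deg p = Max (insert 0 (mono_deg ` Poly_Mapping.keys p))"

definition eval_mpoly :: "(nat \<Rightarrow> 'a) \<Rightarrow> 'a::comm_semiring_1 mpoly \<Rightarrow> 'a" where
  "eval_mpoly x p = (\<Sum>m\<in>Poly_Mapping.keys p.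
     Poly_Mapping.lookup p m * (\<Prod>i\<in>Poly_Mapping.keys m. x i ^ Poly_Mapping.lookup m i))"

definition hom_comp :: "nat \<Rightarrow> 'a::comm_monoid_add mpoly \<Rightarrow> 'a mpoly" where
  "hom_comp d p = (\<Sum>m\<in>{m \<in> Poly_Mapping.keys p. mono_deg m = d}.
     Poly_Mapping.single m (Poly_Mapping.lookup p m))"

section \<open>The parity-preserving permutation group and its invariants\<close>

definition W_group :: "nat \<Rightarrow> (nat \<Rightarrow> nat) set" where
  "W_group n = {\<pi>. \<pi> permutes {1..n} \<and> (\<forall>i\<in>{1..n}. \<pi> i mod 2 = i mod 2)}"

text \<open>
  For a bijection \<open>\<pi>\<close>, the coefficient of \<open>m\<close> in \<open>permute_vars \<pi> p\<close> is the coefficient of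
  \<open>m \<circ> \<pi>\<close> in \<open>p\<close>, i.e. each variable \<open>z\<^sub>i\<close> of \<open>p\<close> is replaced by \<open>z\<^bsub>\<pi> i\<^esub>\<close>.
\<close>

definition permute_vars :: "(nat \<Rightarrow> nat) \<Rightarrow> 'a::zero mpoly \<Rightarrow> 'a mpoly" where
  "permute_vars \<pi> p = Poly_Mapping.map_key (Poly_Mapping.map_key \<pi>) p"

definition W_invariants :: "nat \<Rightarrow> 'a::zero mpoly set" where
  "W_invariants n = {p \<in> poly_ring n. \<forall>\<pi>\<in>W_group n. permute_vars \<pi> p = p}"

section \<open>Partitions\<close>

text \<open>
  An \<open>n\<close>-tuple is a function vanishing outside \<open>{1..n}\<close>, so that equality of tuples is equality
  of functions.
\<close>

definition Lam :: "nat \<Rightarrow> (nat \<Rightarrow> nat) set" where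
  "Lam n = {lam. (\<forall>i. i \<notin> {1..n} \<longrightarrow> lam i = 0) \<and>
                 (\<forall>i\<in>{1..n}. \<forall>j\<in>{1..n}. i \<le> j \<longrightarrow> lam j \<le> lam i)}"

definition odd_size :: "nat \<Rightarrow> (nat \<Rightarrow> nat) \<Rightarrow> nat" where
  "odd_size n lam = (\<Sum>i\<in>{i\<in>{1..n}. odd i}. lam i)"

text \<open>The integer \<open>[\<lambda>]\<^sub>m\<close>, which is nonnegative for \<open>\<lambda>\<close> in \<^term>\<open>Lam n\<close>.\<close>

definition bracket :: "nat \<Rightarrow> (nat \<Rightarrow> nat) \<Rightarrow> nat \<Rightarrow> int" where
  "bracket n lam m = (\<Sum>j=m..n. (-1) ^ (j - m) * int (lam j))"

definition bracket_mono :: "nat \<Rightarrow> (nat \<Rightarrow> nat) \<Rightarrow> (nat \<Rightarrow>\<^sub>0 nat)" where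
  "bracket_mono n lam = (\<Sum>m=1..n. Poly_Mapping.single m (nat (bracket n lam m)))"

section \<open>The semisymmetric polynomials\<close>

definition rho :: "nat \<Rightarrow> 'a::field_char_0 \<Rightarrow> nat \<Rightarrow> 'a" where
  "rho n r i = of_nat (n - i) * r"

definition is_R_poly :: "nat \<Rightarrow> 'a::field_char_0 \<Rightarrow> (nat \<Rightarrow> nat) \<Rightarrow> 'a mpoly \<Rightarrow> bool" where
  "is_R_poly n r lam R \<longleftrightarrow>
     R \<in> W_invariants n \<and>
     total_deg R = odd_size n lam \<and>
     (\<forall>mu\<in>Lam n. odd_size n mu \<le> odd_size n lam \<and> mu \<noteq> lam \<longrightarrow>
        eval_mpoly (\<lambda>i. rho n r i + of_nat (mu i)) R = 0) \<and>
     Poly_Mapping.lookup R (bracket_mono n lam) = 1"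

definition R_poly :: "nat \<Rightarrow> 'a::field_char_0 \<Rightarrow> (nat \<Rightarrow> nat) \<Rightarrow> 'a mpoly" where
  "R_poly n r lam = (THE R. is_R_poly n r lam R)"

definition R_top :: "nat \<Rightarrow> 'a::field_char_0 \<Rightarrow> (nat \<Rightarrow> nat) \<Rightarrow> 'a mpoly" where
  "R_top n r lam = hom_comp (odd_size n lam) (R_poly n r lam)"

section \<open>The product formula\<close>

text \<open>
  The product is polymorphic in the field, so that \<open>x\<close> can be a scalar as well as the
  indeterminate of the field of rational functions. The rising factorial is \<^const>\<open>pochhammer\<close>.
\<close>

definition B_expr :: "nat \<Rightarrow> (nat \<Rightarrow> nat) \<Rightarrow> 'b::field \<Rightarrow> 'b" where
  "B_expr n lam x =
     (\<Prod>(i, j)\<in>{(i, j)\<in>{1..n} \<times> {1..n}. i < j \<and> odd (j - i)}.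
        pochhammer (of_nat (j - i + 1) * x) (lam i - lam j)) /
     (\<Prod>(i, j)\<in>{(i, j)\<in>{1..n} \<times> {1..n}. i < j \<and> even (j - i)}.
        pochhammer (of_nat (j - i) * x) (lam i - lam j))"

text \<open>
  The value of a rational function at a point where it has no pole: cancel to a representation
  whose denominator does not vanish there.
\<close>

definition ratfun_value :: "'a::field poly fract \<Rightarrow> 'a \<Rightarrow> 'a" where
  "ratfun_value f a =
     (THE v. \<exists>P Q. poly Q a \<noteq> 0 \<and> f = Fract P Q \<and> v = poly P a / poly Q a)"

lemma ratfun_value_Fract:
  fixes P Q :: "'a::field poly"
  assumes "poly Q a \<noteq> 0"
  shows "ratfun_value (Fract P Q) a = poly P a / poly Q a"
  unfolding ratfun_value_def
proof (rule the_equality)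
  show "\<exists>P' Q'. poly Q' a \<noteq> 0 \<and> Fract P Q = Fract P' Q' \<and>
          poly P a / poly Q a = poly P' a / poly Q' a"
    using assms by blast
next
  fix v
  assume "\<exists>P' Q'. poly Q' a \<noteq> 0 \<and> Fract P Q = Fract P' Q' \<and> v = poly P' a / poly Q' a"
  then obtain P' Q' where *: "poly Q' a \<noteq> 0" "Fract P Q = Fract P' Q'"
    "v = poly P' a / poly Q' a" by blast
  have "Q \<noteq> 0" "Q' \<noteq> 0" using assms *(1) by auto
  with *(2) have "P * Q' = P' * Q" by (simp add: eq_fract)
  hence "poly P a * poly Q' a = poly P' a * poly Q a" by (metis poly_mult)
  thus "v = poly P a / poly Q a" using assms *(1,3) by (simp add: frac_eq_eq)
qed

text \<open>At \<open>r = 0\<close> numerator and denominator may both vanish; the limit is meant there.\<close>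

definition B_coeff :: "nat \<Rightarrow> (nat \<Rightarrow> nat) \<Rightarrow> 'a::field_char_0 \<Rightarrow> 'a" where
  "B_coeff n lam r =
     (if r = 0 then ratfun_value (B_expr n lam (Fract [:0, 1:] 1)) 0 else B_expr n lam r)"

end

theory Submission
  imports Defs
begin

text \<open>
  Let \<open>f\<^sub>\<lambda>\<close> be the semisymmetric polynomial of degree \<open>|\<lambda>|\<close> that is 1 at \<open>\<rho> + \<lambda>\<close> and 0 at \<open>\<rho> + \<mu>\<close> for all
  other \<open>\<mu>\<close> with \<open>|\<mu>| \<le> |\<lambda>|\<close>. Setting \<open>z\<^sub>n = 0\<close> or dividing by the product of the \<open>z\<^sub>j\<close> with \<open>j \<equiv> n\<close>
  mod 2 shows by induction that such polynomials exist and are unique, and that \<open>R\<^sub>\<lambda> = R\<^sub>\<lambda>(\<rho> + \<lambda>) f\<^sub>\<lambda>\<close>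
  with an explicit product for \<open>R\<^sub>\<lambda>(\<rho> + \<lambda>)\<close>.

  Two difference operators with coefficients of Lagrange type act on these polynomials. One shifts
  an odd variable by \<open>-1\<close>, preserves the degree and has \<open>f\<^sub>\<lambda>\<close> as eigenfunction with eigenvalue \<open>[\<lambda>]\<^sub>1\<close>.
  The other shifts by \<open>+1\<close>, lowers the degree by 1 and sends \<open>f\<^sub>\<lambda>\<close> to an explicit combination of the
  \<open>f\<^sub>\<nu>\<close> with \<open>\<nu> = \<lambda> - \<epsilon>\<^sub>i\<close>. For even \<open>n\<close> the top component of the first operator vanishes at
  \<open>(1, \<dots>, 1)\<close>, so the value there is 0 unless \<open>[\<lambda>]\<^sub>1 = 0\<close>. For odd \<open>n\<close> both top components have the same
  value at \<open>(1, \<dots>, 1)\<close>, which gives a recursion in \<open>|\<lambda>|\<close>; the product formula solves it because each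
  of its terms becomes a coefficient of the first operator. If \<open>[\<lambda>]\<^sub>1 = 0\<close>, then \<open>f\<^sub>\<lambda>\<close> is a symmetric
  polynomial in the even variables alone, a shifted Jack polynomial with parameter \<open>2r\<close>, to which
  the same argument applies with degree in place of \<open>[\<lambda>]\<^sub>1\<close>.
\<close>

section \<open>Polynomial functions and multivariate polynomials\<close>

text \<open>The nodes have a recursive structure: \<open>rho\<close> ends in 0, its other entries
  are the smaller \<open>rho\<close> plus \<open>r\<close>, and a partition either ends in 0 or is
  another one plus (1, ..., 1). The product divided out is nonzero at the nodes of the second kind
  because k r + m with m > 0 never vanishes for an admissible \<open>r\<close>. The denominators of
  the operators vanish at (1, ..., 1), so their effect on top components cannot be found by
  substitution. Each Lagrange sum is therefore written with one polynomial in t whose coefficients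
  are semisymmetric; when all M nodes become 1, the sum becomes the coefficient of (t - 1)^(M-1),
  and there the two operators can be compared. The eigenvalue needs no expansion either: the sum of
  the operator coefficients is semisymmetric of degree at most 1, so its values at partitions of
  size at most 1 determine it. Where the eigenvalue is 0 the recursion carries no information; this
  is the obstacle that forces the detour through symmetric functions. There rows come in equal
  pairs, and merging each pair doubles the parameter.\<close>

inductive poly_fun :: "nat \<Rightarrow> nat \<Rightarrow> ((nat \<Rightarrow> 'a::field_char_0) \<Rightarrow> 'a) \<Rightarrow> bool" for n where
  poly_fun_const0: "poly_fun n 0 (\<lambda>x. a)"
| poly_fun_var: "poly_fun n d f \<Longrightarrow> i \<in> {1..n} \<Longrightarrow> poly_fun n (Suc d) (\<lambda>x. x i * f x)"
| poly_fun_add: "poly_fun n d f \<Longrightarrow> poly_fun n d g \<Longrightarrow> poly_fun n d (\<lambda>x. f x + g x)"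
| poly_fun_Suc: "poly_fun n d f \<Longrightarrow> poly_fun n (Suc d) f"

lemma poly_fun_mono:
  assumes "poly_fun n d f" "d \<le> e"
  shows "poly_fun n e f"
  using assms(2,1) by (induction e rule: dec_induct) (auto intro: poly_fun_Suc)

lemma poly_fun_const: "poly_fun n d (\<lambda>x. a)"
  by (rule poly_fun_mono[OF poly_fun_const0]) simp

lemma poly_fun_scale: "poly_fun n d f \<Longrightarrow> poly_fun n d (\<lambda>x. a * f x)"
proof (induction rule: poly_fun.induct)
  case (poly_fun_var d f i)
  then have "poly_fun n (Suc d) (\<lambda>x. x i * (a * f x))" by (intro poly_fun.poly_fun_var) auto
  then show ?case by (simp add: mult.left_commute)
next
  case (poly_fun_add d f g)
  then show ?case by (simp add: distrib_left poly_fun.poly_fun_add)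
qed (auto intro: poly_fun.intros)

lemma poly_fun_mult:
  assumes "poly_fun n d f" "poly_fun n e g"
  shows "poly_fun n (d + e) (\<lambda>x. f x * g x)"
  using assms
proof (induction rule: poly_fun.induct)
  case (poly_fun_const0 a)
  then show ?case by (simp add: poly_fun_scale)
next
  case (poly_fun_var d f i)
  then have "poly_fun n (Suc (d + e)) (\<lambda>x. x i * (f x * g x))" by (intro poly_fun.poly_fun_var) auto
  then show ?case by (simp add: mult.assoc)
next
  case (poly_fun_add d f g)
  then show ?case by (simp add: distrib_right poly_fun.poly_fun_add)
qed (auto intro: poly_fun.intros)

lemma poly_fun_diff:
  assumes "poly_fun n d f" "poly_fun n d g"
  shows "poly_fun n d (\<lambda>x. f x - g x)"
  using poly_fun_add[OF assms(1) poly_fun_scale[OF assms(2), of "-1"]] by simp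

lemma poly_fun_sum:
  assumes "\<And>i. i \<in> I \<Longrightarrow> poly_fun n d (f i)"
  shows "poly_fun n d (\<lambda>x. \<Sum>i\<in>I. f i x)"
  using assms
  by (induction I rule: infinite_finite_induct) (auto intro: poly_fun_const poly_fun_add)

lemma poly_fun_cong:
  assumes "poly_fun n d f" "\<And>i. i \<in> {1..n} \<Longrightarrow> x i = y i"
  shows "f x = f y"
  using assms by (induction rule: poly_fun.induct) auto

lemma poly_fun_univariate:
  assumes "poly_fun n d f"
  shows "\<exists>P. \<forall>t. poly P t = f (x(j := t))"
  using assms
proof (induction rule: poly_fun.induct)
  case (poly_fun_const0 a)
  have "\<forall>t. poly [:a:] t = a" by simp
  then show ?case by blast
next
  case (poly_fun_var d f i)
  then obtain P where P: "\<forall>t. poly P t = f (x(j := t))" by blast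
  have "\<forall>t. poly ((if i = j then [:0, 1:] else [:x i:]) * P) t = (x(j := t)) i * f (x(j := t))"
    using P by simp
  then show ?case by blast
next
  case (poly_fun_add d f g)
  then obtain P Q where "\<forall>t. poly P t = f (x(j := t))" "\<forall>t. poly Q t = g (x(j := t))" by blast
  then have "\<forall>t. poly (P + Q) t = f (x(j := t)) + g (x(j := t))" by simp
  then show ?case by blast
qed

lemma poly_infinite_zeros:
  fixes P :: "'a::field_char_0 poly"
  assumes "\<And>t. t \<noteq> 0 \<Longrightarrow> poly P t = 0"
  shows "P = 0"
proof (rule ccontr)
  assume "P \<noteq> 0"
  then have "finite {t. poly P t = 0}" by (rule poly_roots_finite)
  moreover have "UNIV - {0} \<subseteq> {t. poly P t = 0}" using assms by auto
  ultimately have "finite (UNIV - {0::'a})" by (rule finite_subset[rotated])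
  then show False using infinite_UNIV_char_0 by auto
qed

text \<open>A univariate polynomial that is 0 at all nonzero points is 0, so the restrictions on the
  coordinates in \<open>J\<close> can be lifted one at a time. This permits cancelling a product of
  variables in an identity between functions.\<close>

lemma poly_fun_dense:
  assumes "poly_fun n d f" "finite J" "\<And>x. (\<forall>j\<in>J. x j \<noteq> 0) \<Longrightarrow> f x = 0"
  shows "f x = 0"
  using assms(2,3)
proof (induction J arbitrary: x rule: finite_induct)
  case empty
  then show ?case by simp
next
  case (insert j J)
  have *: "f x = 0" if x: "\<forall>i\<in>J. x i \<noteq> 0" for x
  proof -
    obtain P where P: "\<forall>t. poly P t = f (x(j := t))" using poly_fun_univariate[OF assms(1)] by blast
    have "poly P t = 0" if "t \<noteq> 0" for t
      using x that insert.hyps by (subst P[rule_format]) (rule insert.prems, auto)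
    then have "P = 0" by (rule poly_infinite_zeros)
    then show ?thesis using P[rule_format, of "x j"] by simp
  qed
  show ?case by (rule insert.IH) (rule *)
qed

text \<open>Division with remainder by the variable \<open>x N\<close>. The clause for
  \<open>d = 0\<close> makes up for the truncated subtraction in \<open>d - 1\<close>.\<close>

lemma poly_fun_split:
  assumes "poly_fun n d f" "N \<in> {1..n}"
  shows "\<exists>h. poly_fun n (d - 1) h \<and> (d = 0 \<longrightarrow> h = (\<lambda>x. 0)) \<and> (\<forall>x. f x = f (x(N := 0)) + x N * h x)"
  using assms(1)
proof (induction rule: poly_fun.induct)
  case (poly_fun_const0 a)
  then show ?case by (intro exI[of _ "\<lambda>x. 0"]) (auto intro: poly_fun_const)
next
  case (poly_fun_var d f i)
  then obtain h where h: "poly_fun n (d - 1) h" "d = 0 \<longrightarrow> h = (\<lambda>x. 0)"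
    "\<forall>x. f x = f (x(N := 0)) + x N * h x" by blast
  show ?case
  proof (cases "i = N")
    case True
    then show ?thesis using poly_fun_var.hyps by (intro exI[of _ f]) auto
  next
    case False
    have "poly_fun n d (\<lambda>x. x i * h x)"
    proof (cases d)
      case 0
      then show ?thesis using h(1,2) by (simp add: poly_fun_const)
    next
      case (Suc e)
      then show ?thesis using h(1,2) poly_fun.poly_fun_var[of n e h i] poly_fun_var(1,2) by simp
    qed
    then show ?thesis
    proof (intro exI[of _ "\<lambda>x. x i * h x"] conjI allI)
      show "x i * f x = (x(N := 0)) i * f (x(N := 0)) + x N * (x i * h x)" for x
        using False by (subst h(3)[rule_format, of x]) (simp add: algebra_simps)
    qed simp_all
  qed
next
  case (poly_fun_add d f g)
  then obtain h k where hk: "poly_fun n (d - 1) h" "d = 0 \<longrightarrow> h = (\<lambda>x. 0)"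
    "poly_fun n (d - 1) k" "d = 0 \<longrightarrow> k = (\<lambda>x. 0)" and
    h: "\<forall>x. f x = f (x(N := 0)) + x N * h x" and
    k: "\<forall>x. g x = g (x(N := 0)) + x N * k x" by blast
  have "f x + g x = f (x(N := 0)) + g (x(N := 0)) + x N * (h x + k x)" for x
    by (subst h[rule_format, of x], subst k[rule_format, of x]) (simp add: algebra_simps)
  moreover have "poly_fun n (d - 1) (\<lambda>x. h x + k x)" using hk(1,3) by (rule poly_fun.poly_fun_add)
  moreover have "d = 0 \<longrightarrow> (\<lambda>x. h x + k x) = (\<lambda>x. 0)" using hk(2,4) by simp
  ultimately show ?case
    by (intro exI[of _ "\<lambda>x. h x + k x"] conjI allI)
next
  case (poly_fun_Suc d f)
  then obtain h where h: "poly_fun n (d - 1) h" and *: "\<forall>x. f x = f (x(N := 0)) + x N * h x" by blast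
  from h have "poly_fun n (Suc d - 1) h" by (rule poly_fun_mono) simp
  then show ?case using * by (intro exI[of _ h] conjI impI) (assumption | simp only: nat.distinct)+
qed

lemma poly_fun_restrict:
  assumes "poly_fun n d f"
  shows "poly_fun n d (\<lambda>x. f (x(N := 0)))"
  using assms
proof (induction rule: poly_fun.induct)
  case (poly_fun_var d f i)
  then show ?case
    by (cases "i = N") (auto intro: poly_fun_const poly_fun.poly_fun_var)
qed (auto intro: poly_fun.intros)

lemma poly_fun_restrict_Suc:
  assumes "poly_fun (Suc n) d f"
  shows "poly_fun n d (\<lambda>x. f (x(Suc n := 0)))"
  using assms
proof (induction rule: poly_fun.induct)
  case (poly_fun_var d f i)
  then show ?case
    by (cases "i = Suc n") (auto intro: poly_fun_const poly_fun.poly_fun_var)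
qed (auto intro: poly_fun.intros)

text \<open>A translation of all variables affects only lower degrees. This later keeps the
  coefficients of top degree fixed when the nodes are moved.\<close>

lemma poly_fun_shift_diff:
  assumes "poly_fun n d f"
  shows "\<exists>h. poly_fun n (d - 1) h \<and> (d = 0 \<longrightarrow> h = (\<lambda>x. 0)) \<and> (\<forall>x. f (\<lambda>i. x i + c) = f x + h x)"
  using assms
proof (induction rule: poly_fun.induct)
  case (poly_fun_const0 a)
  then show ?case by (intro exI[of _ "\<lambda>x. 0"]) (auto intro: poly_fun_const)
next
  case (poly_fun_var d f i)
  then obtain h where h: "poly_fun n (d - 1) h" "d = 0 \<longrightarrow> h = (\<lambda>x. 0)"
    "\<forall>x. f (\<lambda>i. x i + c) = f x + h x" by blast
  have 1: "poly_fun n d (\<lambda>x. x i * h x)"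
  proof (cases d)
    case 0
    then show ?thesis using h(1,2) by (simp add: poly_fun_const)
  next
    case (Suc e)
    then show ?thesis using h(1,2) poly_fun.poly_fun_var[of n e h i] poly_fun_var(1,2) by simp
  qed
  have 2: "poly_fun n d (\<lambda>x. c * (f x + h x))"
    using poly_fun_var h(1) by (intro poly_fun_scale poly_fun_add) (auto intro: poly_fun_mono)
  show ?case using h(3) poly_fun_add[OF 1 2]
    by (intro exI[of _ "\<lambda>x. x i * h x + c * (f x + h x)"]) (auto simp: algebra_simps)
next
  case (poly_fun_add d f g)
  then obtain h k where "poly_fun n (d - 1) h" "d = 0 \<longrightarrow> h = (\<lambda>x. 0)"
    "\<forall>x. f (\<lambda>i. x i + c) = f x + h x"
    "poly_fun n (d - 1) k" "d = 0 \<longrightarrow> k = (\<lambda>x. 0)"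
    "\<forall>x. g (\<lambda>i. x i + c) = g x + k x" by blast
  then show ?case
    by (intro exI[of _ "\<lambda>x. h x + k x"]) (auto intro: poly_fun.poly_fun_add simp: algebra_simps)
next
  case (poly_fun_Suc d f)
  then obtain h where h: "poly_fun n (d - 1) h" "\<forall>x. f (\<lambda>i. x i + c) = f x + h x" by blast
  then show ?case by (intro exI[of _ h]) (auto intro: poly_fun_mono)
qed

lemma poly_fun_shift:
  assumes "poly_fun n d f"
  shows "poly_fun n d (\<lambda>x. f (\<lambda>i. x i + c))"
proof -
  obtain h where h: "poly_fun n (d - 1) h" "\<forall>x. f (\<lambda>i. x i + c) = f x + h x"
    using poly_fun_shift_diff[OF assms] by blast
  then show ?thesis using poly_fun_add[OF assms poly_fun_mono[OF h(1), of d]] by (simp only: h(2) diff_le_self)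
qed

lemma poly_fun_divide:
  assumes "poly_fun n d f" "finite J" "J \<subseteq> {1..n}" "\<And>j x. j \<in> J \<Longrightarrow> x j = 0 \<Longrightarrow> f x = 0"
  shows "\<exists>h. poly_fun n (d - card J) h \<and> (d < card J \<longrightarrow> h = (\<lambda>x. 0)) \<and> (\<forall>x. f x = (\<Prod>j\<in>J. x j) * h x)"
  using assms(2-)
proof (induction J rule: finite_induct)
  case empty
  show ?case using assms(1) by (intro exI[of _ f]) simp
next
  case (insert j J)
  have "\<exists>h. poly_fun n (d - card J) h \<and> (d < card J \<longrightarrow> h = (\<lambda>x. 0)) \<and>
    (\<forall>x. f x = (\<Prod>j\<in>J. x j) * h x)"
    by (rule insert.IH[OF subset_trans[OF subset_insertI insert.prems(1)] insert.prems(2)]) simp_all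
  then obtain h where h: "poly_fun n (d - card J) h" "d < card J \<longrightarrow> h = (\<lambda>x. 0)"
    and fh: "\<forall>x. f x = (\<Prod>j\<in>J. x j) * h x" by blast
  \<comment> \<open>\<open>f\<close> vanishes where \<open>x j = 0\<close>, but the product already
    extracted can be cancelled only where its factors are nonzero; density covers the remaining
    points.\<close>
  have *: "h (x(j := 0)) = 0" for x
  proof (rule poly_fun_dense[OF poly_fun_restrict[OF h(1), of j] insert.hyps(1)])
    fix x :: "nat \<Rightarrow> 'a" assume x: "\<forall>i\<in>J. x i \<noteq> 0"
    have "f (x(j := 0)) = 0" by (rule insert.prems(2)[of j]) simp_all
    then have "(\<Prod>i\<in>J. (x(j := 0)) i) * h (x(j := 0)) = 0" by (simp only: fh)
    moreover have "(\<Prod>i\<in>J. (x(j := 0)) i) \<noteq> 0" using x insert.hyps by auto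
    ultimately show "h (x(j := 0)) = 0" by (simp only: mult_eq_0_iff) blast
  qed
  have "j \<in> {1..n}" using insert.prems(1) by blast
  from poly_fun_split[OF h(1) this] obtain k where k: "poly_fun n (d - card J - 1) k" "d - card J = 0 \<longrightarrow> k = (\<lambda>x. 0)"
    and hk: "\<forall>x. h x = h (x(j := 0)) + x j * k x"
    by (elim exE conjE) (rule that)
  have hk': "h x = x j * k x" for x
    by (subst hk[rule_format, of x]) (simp only: * add_0)
  have "f x = (\<Prod>i\<in>insert j J. x i) * k x" for x
    unfolding fh[rule_format, of x] hk'[of x] using insert.hyps by (simp add: mult.assoc mult.left_commute)
  moreover have "poly_fun n (d - card (insert j J)) k" using k(1) insert.hyps by simp
  moreover have "d < card (insert j J) \<longrightarrow> k = (\<lambda>x. 0)"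
  proof
    assume "d < card (insert j J)"
    then have "d - card J = 0" using insert.hyps by simp
    with k(2) show "k = (\<lambda>x. 0)" by blast
  qed
  ultimately show ?case by (intro exI[of _ k] conjI allI)
qed

section \<open>Monomials, evaluation and degree of formal polynomials\<close>

definition mono_val :: "(nat \<Rightarrow> 'a::comm_semiring_1) \<Rightarrow> (nat \<Rightarrow>\<^sub>0 nat) \<Rightarrow> 'a" where
  "mono_val x m = (\<Prod>i\<in>Poly_Mapping.keys m. x i ^ Poly_Mapping.lookup m i)"

lemma mono_val_superset:
  assumes "finite S" "Poly_Mapping.keys m \<subseteq> S"
  shows "mono_val x m = (\<Prod>i\<in>S. x i ^ Poly_Mapping.lookup m i)"
  unfolding mono_val_def using assms
  by (intro prod.mono_neutral_left) (auto simp: in_keys_iff)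

lemma mono_deg_superset:
  assumes "finite S" "Poly_Mapping.keys m \<subseteq> S"
  shows "mono_deg m = (\<Sum>i\<in>S. Poly_Mapping.lookup m i)"
  unfolding mono_deg_def using assms
  by (intro sum.mono_neutral_left) (auto simp: in_keys_iff)

lemma mono_val_add: "mono_val x (m + l) = mono_val x m * mono_val x l"
proof -
  let ?S = "Poly_Mapping.keys m \<union> Poly_Mapping.keys l"
  have "Poly_Mapping.keys (m + l) \<subseteq> ?S" by (rule keys_add)
  then show ?thesis
    by (simp add: mono_val_superset[of ?S] lookup_add power_add prod.distrib)
qed

lemma mono_deg_add: "mono_deg (m + l) = mono_deg m + mono_deg l"
proof -
  let ?S = "Poly_Mapping.keys m \<union> Poly_Mapping.keys l"
  have "Poly_Mapping.keys (m + l) \<subseteq> ?S" by (rule keys_add)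
  then show ?thesis
    by (simp add: mono_deg_superset[of ?S] lookup_add sum.distrib)
qed

lemma mono_val_single: "mono_val x (Poly_Mapping.single i k) = x i ^ k"
  by (simp add: mono_val_def)

lemma mono_deg_single: "mono_deg (Poly_Mapping.single i k) = k"
  by (simp add: mono_deg_def)

lemma mono_val_0 [simp]: "mono_val x 0 = 1"
  by (simp add: mono_val_def)

lemma mono_deg_0 [simp]: "mono_deg 0 = 0"
  by (simp add: mono_deg_def)

lemma eval_mpoly_superset:
  assumes "finite S" "Poly_Mapping.keys p \<subseteq> S"
  shows "eval_mpoly x p = (\<Sum>m\<in>S. Poly_Mapping.lookup p m * mono_val x m)"
  unfolding eval_mpoly_def mono_val_def[symmetric] using assms
  by (intro sum.mono_neutral_left) (auto simp: in_keys_iff)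

lemma eval_mpoly_0 [simp]: "eval_mpoly x 0 = 0"
  by (simp add: eval_mpoly_def)

lemma eval_mpoly_add: "eval_mpoly x (p + q) = eval_mpoly x p + eval_mpoly x q"
proof -
  let ?S = "Poly_Mapping.keys p \<union> Poly_Mapping.keys q"
  have "Poly_Mapping.keys (p + q) \<subseteq> ?S" by (rule keys_add)
  then show ?thesis
    by (simp add: eval_mpoly_superset[of ?S] lookup_add distrib_right sum.distrib)
qed

lemma eval_mpoly_uminus:
  fixes p :: "'a::comm_ring_1 mpoly"
  shows "eval_mpoly x (- p) = - eval_mpoly x p"
  by (simp add: eval_mpoly_def sum_negf)

lemma eval_mpoly_sum: "eval_mpoly x (sum p I) = (\<Sum>i\<in>I. eval_mpoly x (p i))"
  by (induction I rule: infinite_finite_induct) (auto simp: eval_mpoly_add)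

lemma eval_mpoly_single: "eval_mpoly x (Poly_Mapping.single m a) = a * mono_val x m"
  by (subst eval_mpoly_superset[of "{m}"]) (auto simp: lookup_single)

lemma mpoly_sum_single: "p = (\<Sum>m\<in>Poly_Mapping.keys p. Poly_Mapping.single m (Poly_Mapping.lookup p m))"
proof (rule poly_mapping_eqI)
  fix k
  have "Poly_Mapping.lookup (\<Sum>m\<in>Poly_Mapping.keys p. Poly_Mapping.single m (Poly_Mapping.lookup p m)) k
      = (\<Sum>m\<in>Poly_Mapping.keys p. if m = k then Poly_Mapping.lookup p k else 0)"
    unfolding lookup_sum by (intro sum.cong) (auto simp: lookup_single when_def)
  then show "Poly_Mapping.lookup p k = Poly_Mapping.lookup (\<Sum>m\<in>Poly_Mapping.keys p. Poly_Mapping.single m (Poly_Mapping.lookup p m)) k"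
    by (auto simp: in_keys_iff)
qed

lemma single_mult_mpoly:
  fixes p :: "'a::comm_semiring_1 mpoly"
  shows "Poly_Mapping.single a b * p =
    (\<Sum>m\<in>Poly_Mapping.keys p. Poly_Mapping.single (a + m) (b * Poly_Mapping.lookup p m))"
  by (subst (1) mpoly_sum_single[of p]) (simp add: sum_distrib_left mult_single)

lemma eval_mpoly_single_mult:
  "eval_mpoly x (Poly_Mapping.single a b * p) = b * mono_val x a * eval_mpoly x p"
  unfolding single_mult_mpoly eval_mpoly_superset[OF finite_keys order.refl, of x p]
  by (simp add: eval_mpoly_sum eval_mpoly_single mono_val_add sum_distrib_left mult_ac)

lemma lookup_single_mult:
  fixes p :: "'a::comm_semiring_1 mpoly"
  shows "Poly_Mapping.lookup (Poly_Mapping.single a 1 * p) (a + m) = Poly_Mapping.lookup p m"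
proof -
  have "Poly_Mapping.lookup (Poly_Mapping.single a 1 * p) (a + m)
     = (\<Sum>k\<in>Poly_Mapping.keys p. if k = m then Poly_Mapping.lookup p m else 0)"
    unfolding single_mult_mpoly lookup_sum by (intro sum.cong) (auto simp: lookup_single when_def)
  then show ?thesis by (auto simp: in_keys_iff)
qed

definition deg_le :: "nat \<Rightarrow> 'a::zero mpoly \<Rightarrow> bool" where
  "deg_le d p \<longleftrightarrow> (\<forall>m\<in>Poly_Mapping.keys p. mono_deg m \<le> d)"

lemma deg_le_iff: "deg_le d p \<longleftrightarrow> total_deg p \<le> d"
  unfolding deg_le_def total_deg_def by (subst Max_le_iff) auto

lemma poly_ring_add: "p \<in> poly_ring n \<Longrightarrow> q \<in> poly_ring n \<Longrightarrow> p + q \<in> poly_ring n"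
  using keys_add[of p q] unfolding poly_ring_def by blast

lemma poly_ring_uminus: "p \<in> poly_ring n \<Longrightarrow> - p \<in> poly_ring n" for p :: "'a::ab_group_add mpoly"
  by (simp add: poly_ring_def in_keys_iff)

lemma deg_le_add: "deg_le d p \<Longrightarrow> deg_le d q \<Longrightarrow> deg_le d (p + q)"
  using keys_add[of p q] unfolding deg_le_def by blast

lemma keys_single_mult:
  fixes p :: "'a::comm_semiring_1 mpoly"
  assumes "k \<in> Poly_Mapping.keys (Poly_Mapping.single a b * p)"
  obtains m where "m \<in> Poly_Mapping.keys p" "k = a + m"
  using keys_mult[of "Poly_Mapping.single a b" p] assms by (auto split: if_splits)

lemma poly_ring_single_mult:
  fixes p :: "'a::comm_semiring_1 mpoly"
  assumes "p \<in> poly_ring n" "Poly_Mapping.keys a \<subseteq> {1..n}"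
  shows "Poly_Mapping.single a b * p \<in> poly_ring n"
  unfolding poly_ring_def mem_Collect_eq
proof
  fix k assume "k \<in> Poly_Mapping.keys (Poly_Mapping.single a b * p)"
  then obtain m where m: "m \<in> Poly_Mapping.keys p" "k = a + m" by (rule keys_single_mult)
  then have "Poly_Mapping.keys m \<subseteq> {1..n}" using assms(1) by (auto simp: poly_ring_def)
  then show "Poly_Mapping.keys k \<subseteq> {1..n}" using m(2) assms(2) keys_add[of a m] by blast
qed

lemma deg_le_single_mult:
  fixes p :: "'a::comm_semiring_1 mpoly"
  assumes "deg_le d p"
  shows "deg_le (mono_deg a + d) (Poly_Mapping.single a b * p)"
  unfolding deg_le_def
proof
  fix k assume "k \<in> Poly_Mapping.keys (Poly_Mapping.single a b * p)"
  then obtain m where m: "m \<in> Poly_Mapping.keys p" "k = a + m" by (rule keys_single_mult)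
  then show "mono_deg k \<le> mono_deg a + d" using assms by (simp add: mono_deg_add deg_le_def)
qed

text \<open>Constructions are done with functions, where shifts, restrictions and permutations are
  compositions. Formal polynomials come back only where coefficients or exact degrees
  matter.\<close>

lemma poly_fun_imp_mpoly:
  fixes f :: "(nat \<Rightarrow> 'a::field_char_0) \<Rightarrow> 'a"
  assumes "poly_fun n d f"
  shows "\<exists>p. p \<in> poly_ring n \<and> deg_le d p \<and> (\<forall>x. eval_mpoly x p = f x)"
  using assms
proof (induction rule: poly_fun.induct)
  case (poly_fun_const0 a)
  show ?case
    by (intro exI[of _ "Poly_Mapping.single 0 a"])
      (auto simp: poly_ring_def deg_le_def eval_mpoly_single)
next
  case (poly_fun_var d f i)
  then obtain p where p: "p \<in> poly_ring n" "deg_le d p" "\<forall>x. eval_mpoly x p = f x" by blast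
  let ?a = "Poly_Mapping.single i (1::nat)"
  have "Poly_Mapping.single ?a 1 * p \<in> poly_ring n"
    using p poly_fun_var.hyps by (intro poly_ring_single_mult) auto
  moreover have "deg_le (Suc d) (Poly_Mapping.single ?a 1 * p)"
    using deg_le_single_mult[OF p(2), of ?a 1] by (simp add: mono_deg_single)
  ultimately show ?case using p
    by (intro exI[of _ "Poly_Mapping.single ?a 1 * p"])
      (auto simp: eval_mpoly_single_mult mono_val_single)
next
  case (poly_fun_add d f g)
  then obtain p q where "p \<in> poly_ring n \<and> deg_le d p \<and> (\<forall>x. eval_mpoly x p = f x)"
     "q \<in> poly_ring n \<and> deg_le d q \<and> (\<forall>x. eval_mpoly x q = g x)" by blast
  then show ?case
    by (intro exI[of _ "p + q"]) (auto simp: eval_mpoly_add intro: poly_ring_add deg_le_add)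
next
  case (poly_fun_Suc d f)
  then show ?case unfolding deg_le_def by (meson le_SucI)
qed

lemma poly_fun_prod:
  assumes "finite J" "J \<subseteq> {1..n}"
  shows "poly_fun n (\<Sum>j\<in>J. k j) (\<lambda>x. \<Prod>j\<in>J. x j ^ k j)"
  using assms
proof (induction J rule: finite_induct)
  case empty
  then show ?case by (simp add: poly_fun_const)
next
  case (insert j J)
  have "poly_fun n l (\<lambda>x. x j ^ l)" for l
  proof (induction l)
    case (Suc l)
    then show ?case using poly_fun_var[OF Suc, of j] insert.prems by simp
  qed (simp add: poly_fun_const)
  then show ?case using insert poly_fun_mult by fastforce
qed

lemma mpoly_imp_poly_fun:
  fixes p :: "'a::field_char_0 mpoly"
  assumes "p \<in> poly_ring n" "deg_le d p"
  shows "poly_fun n d (\<lambda>x. eval_mpoly x p)"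
  unfolding eval_mpoly_def
proof (intro poly_fun_sum poly_fun_scale)
  fix m assume m: "m \<in> Poly_Mapping.keys p"
  have "poly_fun n (mono_deg m) (\<lambda>x::nat\<Rightarrow>'a. \<Prod>i\<in>Poly_Mapping.keys m. x i ^ Poly_Mapping.lookup m i)"
    unfolding mono_deg_def using assms m by (intro poly_fun_prod) (auto simp: poly_ring_def)
  then show "poly_fun n d (\<lambda>x::nat\<Rightarrow>'a. \<Prod>i\<in>Poly_Mapping.keys m. x i ^ Poly_Mapping.lookup m i)"
    using assms m by (auto simp: deg_le_def intro: poly_fun_mono)
qed

lemma keys_update_0: "Poly_Mapping.keys (Poly_Mapping.update i 0 m) = Poly_Mapping.keys m - {i}"
  by (simp add: keys_update)

lemma mono_val_fun_upd:
  "mono_val (x(i := t)) m = mono_val x (Poly_Mapping.update i 0 m) * t ^ Poly_Mapping.lookup m i"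
proof -
  let ?S = "insert i (Poly_Mapping.keys m)"
  have "mono_val (x(i := t)) m = (\<Prod>j\<in>?S. (x(i := t)) j ^ Poly_Mapping.lookup m j)"
    by (rule mono_val_superset) auto
  also have "\<dots> = t ^ Poly_Mapping.lookup m i * (\<Prod>j\<in>Poly_Mapping.keys m - {i}. (x(i := t)) j ^ Poly_Mapping.lookup m j)"
    by (subst prod.insert_remove) auto
  also have "(\<Prod>j\<in>Poly_Mapping.keys m - {i}. (x(i := t)) j ^ Poly_Mapping.lookup m j) =
     (\<Prod>j\<in>Poly_Mapping.keys m - {i}. x j ^ Poly_Mapping.lookup (Poly_Mapping.update i 0 m) j)"
    by (intro prod.cong) (auto simp: lookup_update)
  finally show ?thesis unfolding mono_val_def keys_update_0 by (simp only: mult.commute)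
qed

text \<open>Induction on the number of variables: with the other coordinates fixed, the polynomial
  is univariate in the last one, so each coefficient \<open>q k\<close>, a polynomial in one
  variable fewer, vanishes as a function.\<close>

lemma eval_mpoly_inj:
  fixes p :: "'a::field_char_0 mpoly"
  assumes "p \<in> poly_ring n" "\<And>x. eval_mpoly x p = 0"
  shows "p = 0"
  using assms
proof (induction n arbitrary: p)
  case 0
  then have *: "Poly_Mapping.keys p \<subseteq> {0}" by (auto simp: poly_ring_def)
  have "Poly_Mapping.lookup p 0 = 0"
    using 0(2)[of "\<lambda>_. 0"] by (simp add: eval_mpoly_superset[OF _ *])
  then show ?case using * by (intro poly_mapping_eqI) (auto simp: in_keys_iff)
next
  case (Suc n)
  define N where "N = Suc n"
  define K where "K k = {m \<in> Poly_Mapping.keys p. Poly_Mapping.lookup m N = k}" for k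
  define q where "q k = (\<Sum>m\<in>K k. Poly_Mapping.single (Poly_Mapping.update N 0 m) (Poly_Mapping.lookup p m))" for k
  have inj: "m = m'" if "m \<in> K k" "m' \<in> K k" "Poly_Mapping.update N 0 m = Poly_Mapping.update N 0 m'" for m m' k
  proof (rule poly_mapping_eqI)
    fix i
    have "Poly_Mapping.lookup (Poly_Mapping.update N 0 m) i = Poly_Mapping.lookup (Poly_Mapping.update N 0 m') i"
      by (simp only: that(3))
    then show "Poly_Mapping.lookup m i = Poly_Mapping.lookup m' i"
      using that(1,2) by (cases "i = N") (auto simp: K_def lookup_update)
  qed
  have "q k = 0" for k
  proof (rule Suc.IH)
    have "Poly_Mapping.keys (q k) \<subseteq> (\<Union>m\<in>K k. {Poly_Mapping.update N 0 m})"
      unfolding q_def by (rule order.trans[OF keys_sum]) auto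
    moreover have "Poly_Mapping.keys (Poly_Mapping.update N 0 m) \<subseteq> {1..n}" if "m \<in> K k" for m
    proof -
      have "Poly_Mapping.keys m \<subseteq> {1..Suc n}" using that Suc.prems(1) by (simp add: K_def poly_ring_def)
      moreover have "{1..Suc n} - {N} \<subseteq> {1..n}" by (auto simp: N_def)
      ultimately show ?thesis unfolding keys_update_0 by blast
    qed
    ultimately show "q k \<in> poly_ring n" unfolding poly_ring_def by fast
  next
    fix x :: "nat \<Rightarrow> 'a"
    define P where "P = (\<Sum>m\<in>Poly_Mapping.keys p. monom (Poly_Mapping.lookup p m * mono_val x (Poly_Mapping.update N 0 m)) (Poly_Mapping.lookup m N))"
    have "poly P t = eval_mpoly (x(N := t)) p" for t
      unfolding P_def poly_sum poly_monom eval_mpoly_superset[OF finite_keys order.refl] mono_val_fun_upd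
      by (simp only: mult.assoc)
    then have "P = 0" using Suc.prems(2) by (intro poly_infinite_zeros) simp
    then have "coeff P k = 0" by simp
    moreover have "coeff P k = (\<Sum>m\<in>K k. Poly_Mapping.lookup p m * mono_val x (Poly_Mapping.update N 0 m))"
      unfolding P_def coeff_sum K_def by (subst sum.inter_filter) auto
    ultimately show "eval_mpoly x (q k) = 0"
      by (simp add: q_def eval_mpoly_sum eval_mpoly_single)
  qed
  have "Poly_Mapping.lookup p m = 0" if m: "m \<in> Poly_Mapping.keys p" for m
  proof -
    define k where "k = Poly_Mapping.lookup m N"
    have mk: "m \<in> K k" using m by (simp add: K_def k_def)
    have "Poly_Mapping.lookup (q k) (Poly_Mapping.update N 0 m) =
       (\<Sum>l\<in>K k. if l = m then Poly_Mapping.lookup p m else 0)"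
      unfolding q_def lookup_sum using mk inj by (intro sum.cong) (auto simp: lookup_single when_def)
    also have "\<dots> = Poly_Mapping.lookup p m" using mk by (simp add: K_def)
    finally show ?thesis using \<open>q k = 0\<close> by simp
  qed
  then show ?case by (intro poly_mapping_eqI) (auto simp: in_keys_iff)
qed

lemma eval_mpoly_eqI:
  fixes p q :: "'a::field_char_0 mpoly"
  assumes "p \<in> poly_ring n" "q \<in> poly_ring n" "\<And>x. eval_mpoly x p = eval_mpoly x q"
  shows "p = q"
proof -
  have "p + - q = 0"
  proof (rule eval_mpoly_inj[of _ n])
    show "p + - q \<in> poly_ring n" using assms by (intro poly_ring_add poly_ring_uminus)
    show "eval_mpoly x (p + - q) = 0" for x
      unfolding eval_mpoly_add eval_mpoly_uminus using assms(3) by simp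
  qed
  then show ?thesis by simp
qed

text \<open>On the diagonal every monomial of degree d becomes t^d. Hence the value at (1, ..., 1)
  of a homogeneous component is one coefficient of a univariate polynomial.\<close>

lemma mpoly_diag:
  fixes p :: "'a::field_char_0 mpoly"
  assumes "\<And>t. poly P t = eval_mpoly (\<lambda>_. t) p"
  shows "eval_mpoly (\<lambda>_. 1) (hom_comp d p) = coeff P d"
proof -
  define Q where "Q = (\<Sum>m\<in>Poly_Mapping.keys p. monom (Poly_Mapping.lookup p m) (mono_deg m))"
  have "poly Q t = eval_mpoly (\<lambda>_. t) p" for t
    by (simp add: Q_def poly_sum poly_monom eval_mpoly_def mono_deg_def power_sum)
  then have "poly (P - Q) t = 0" for t using assms by simp
  then have "P - Q = 0" by (intro poly_infinite_zeros)
  then have "P = Q" by simp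
  have "coeff P d = (\<Sum>m\<in>{m \<in> Poly_Mapping.keys p. mono_deg m = d}. Poly_Mapping.lookup p m)"
    unfolding \<open>P = Q\<close> Q_def coeff_sum by (subst sum.inter_filter) auto
  then show ?thesis by (simp add: hom_comp_def eval_mpoly_sum eval_mpoly_single mono_val_def)
qed

section \<open>Uniqueness of interpolation\<close>

text \<open>
  Everything is done for a stride \<open>c\<close> that is 1 or 2. Stride 2 is the semisymmetric setting; stride 1
  gives the symmetric (shifted Jack) polynomials, which take over when \<open>[\<lambda>]\<^sub>1 = 0\<close>.
\<close>

definition cls :: "nat \<Rightarrow> nat \<Rightarrow> nat \<Rightarrow> nat set" where
  "cls c n q = {i \<in> {1..n}. i mod c = q mod c}"

definition csize :: "nat \<Rightarrow> nat \<Rightarrow> (nat \<Rightarrow> nat) \<Rightarrow> nat" where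
  "csize c n mu = (\<Sum>i\<in>cls c n 1. mu i)"

definition node :: "nat \<Rightarrow> 'a::field_char_0 \<Rightarrow> (nat \<Rightarrow> nat) \<Rightarrow> nat \<Rightarrow> 'a" where
  "node n r mu = (\<lambda>i. rho n r i + of_nat (mu i))"

definition allowed :: "'a::field_char_0 \<Rightarrow> bool" where
  "allowed r \<longleftrightarrow> \<not> (\<exists>q::rat. q < 0 \<and> r = of_rat q)"

definition csym :: "nat \<Rightarrow> nat \<Rightarrow> ((nat \<Rightarrow> 'a) \<Rightarrow> 'a) \<Rightarrow> bool" where
  "csym c n f \<longleftrightarrow> (\<forall>i\<in>{1..n}. \<forall>j\<in>{1..n}. i mod c = j mod c \<longrightarrow>
     (\<forall>x. f (x \<circ> Transposition.transpose i j) = f x))"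

definition add_ones :: "nat \<Rightarrow> (nat \<Rightarrow> nat) \<Rightarrow> nat \<Rightarrow> nat" where
  "add_ones n mu = (\<lambda>i. if i \<in> {1..n} then mu i + 1 else 0)"

section \<open>Residue classes, admissible parameters and the recursive structure of
  partitions\<close>

lemma finite_cls [simp]: "finite (cls c n q)"
  by (simp add: cls_def)

lemma cls_subset: "cls c n q \<subseteq> {1..n}"
  by (auto simp: cls_def)

lemma cls_0 [simp]: "cls c 0 q = {}"
  by (simp add: cls_def)

lemma cls_Suc: "cls c (Suc n) q = (if Suc n mod c = q mod c then insert (Suc n) (cls c n q) else cls c n q)"
  by (auto simp: cls_def le_Suc_eq)

text \<open>A zero would force k > 0 and r = - m / k, a negative rational. This is the form in which
  the hypothesis on \<open>r\<close> is used.\<close>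

lemma allowed_nonzero:
  assumes "allowed r" "m > 0"
  shows "of_nat k * r + of_nat m \<noteq> 0"
proof
  assume *: "of_nat k * r + of_nat m = 0"
  show False
  proof (cases "k = 0")
    case True
    then show ?thesis using * assms(2) by simp
  next
    case False
    have "r = - (of_nat m / of_nat k)"
      using * False by (simp add: field_simps eq_neg_iff_add_eq_0)
    also have "\<dots> = of_rat (- (of_nat m / of_nat k))"
      by (simp add: of_rat_minus of_rat_divide)
    finally have "r = of_rat (- (of_nat m / of_nat k))" .
    moreover have "- (of_nat m / of_nat k) < (0::rat)" using assms(2) False by simp
    ultimately show False using assms(1) unfolding allowed_def by blast
  qed
qed

text \<open>The reflection of \<open>i\<close> to \<open>n + 1 - i\<close> exchanges the two
  classes. It reconciles \<open>csize\<close>, which counts the class of 1, with the degree of the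
  product over the class of \<open>n\<close> that is divided out.\<close>

lemma card_cls_1:
  assumes "c = 1 \<or> c = 2"
  shows "card (cls c n 1) = card (cls c n n)"
proof (rule bij_betw_same_card)
  have par: "(i mod 2 = 1 \<longrightarrow> Suc m mod 2 = (i + m) mod 2) \<and> (i mod 2 = (i + m) mod 2 \<longrightarrow> Suc m mod 2 = 1)"
    for i m :: nat by (auto simp: mod2_eq_if)
  have 1: "(n + 1 - i) mod c = n mod c" if "i \<in> {1..n}" "i mod c = 1 mod c" for i
  proof -
    have "i \<le> n" using that(1) by simp
    then obtain m where "n = i + m" using le_Suc_ex by blast
    then show ?thesis using assms that(2) par[of i m] by (elim disjE) simp_all
  qed
  have 2: "(n + 1 - i) mod c = 1 mod c" if "i \<in> {1..n}" "i mod c = n mod c" for i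
  proof -
    have "i \<le> n" using that(1) by simp
    then obtain m where "n = i + m" using le_Suc_ex by blast
    then show ?thesis using assms that(2) par[of i m] by (elim disjE) simp_all
  qed
  show "bij_betw (\<lambda>i. n + 1 - i) (cls c n 1) (cls c n n)"
  proof (rule bij_betw_byWitness[where f' = "\<lambda>i. n + 1 - i"])
    show "(\<lambda>i. n + 1 - i) ` cls c n 1 \<subseteq> cls c n n"
      using 1 by (auto simp: cls_def)
    show "(\<lambda>i. n + 1 - i) ` cls c n n \<subseteq> cls c n 1"
      using 2 by (auto simp: cls_def)
  qed (auto simp: cls_def)
qed

lemma Lam_Suc: "mu \<in> Lam n \<Longrightarrow> mu \<in> Lam (Suc n)"
  unfolding Lam_def by (auto simp: le_Suc_eq)

lemma Lam_SucD: "mu \<in> Lam (Suc n) \<Longrightarrow> mu (Suc n) = 0 \<Longrightarrow> mu \<in> Lam n"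
  unfolding Lam_def by (auto simp: le_Suc_eq)

lemma Lam_out: "mu \<in> Lam n \<Longrightarrow> i > n \<Longrightarrow> mu i = 0"
  unfolding Lam_def by auto

lemma Lam_add_ones: "mu \<in> Lam n \<Longrightarrow> add_ones n mu \<in> Lam n"
  unfolding Lam_def add_ones_def by auto

lemma Lam_cases:
  assumes "mu \<in> Lam (Suc n)"
  obtains "mu \<in> Lam n" | nu where "nu \<in> Lam (Suc n)" "mu = add_ones (Suc n) nu"
proof (cases "mu (Suc n) = 0")
  case True
  then show ?thesis using that(1) Lam_SucD[OF assms] by blast
next
  case False
  have pos: "mu i \<ge> 1" if "i \<in> {1..Suc n}" for i
  proof -
    have "mu (Suc n) \<le> mu i" using assms that unfolding Lam_def by simp
    then show ?thesis using False by simp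
  qed
  define nu where "nu = (\<lambda>i. mu i - 1)"
  have "nu \<in> Lam (Suc n)" using assms unfolding Lam_def nu_def by (auto intro: diff_le_mono)
  moreover have "mu = add_ones (Suc n) nu"
  proof
    fix i show "mu i = add_ones (Suc n) nu i"
    proof (cases "i \<in> {1..Suc n}")
      case True
      then show ?thesis using pos[OF True] by (simp add: add_ones_def nu_def)
    next
      case False
      then show ?thesis using assms by (auto simp: add_ones_def Lam_def)
    qed
  qed
  ultimately show ?thesis using that(2) by blast
qed

lemma csize_add_ones:
  assumes "c = 1 \<or> c = 2"
  shows "csize c n (add_ones n mu) = csize c n mu + card (cls c n n)"
proof -
  have "csize c n (add_ones n mu) = (\<Sum>i\<in>cls c n 1. mu i + 1)"
    unfolding csize_def add_ones_def by (intro sum.cong) (auto simp: cls_def)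
  then show ?thesis using card_cls_1[OF assms, of n] by (simp only: csize_def sum.distrib card_eq_sum[symmetric])
qed

lemma Lam_0: "Lam 0 = {\<lambda>i. 0}"
  unfolding Lam_def by auto

lemma Suc_in_cls: "Suc n \<in> cls c (Suc n) (Suc n)"
  by (simp add: cls_def)

lemma csize_Suc:
  assumes "mu \<in> Lam n"
  shows "csize c (Suc n) mu = csize c n mu"
proof -
  have "Suc n \<notin> cls c n 1" by (simp add: cls_def)
  then show ?thesis
    unfolding csize_def cls_Suc using Lam_out[OF assms, of "Suc n"] by simp
qed

lemma card_cls_pos: "card (cls c (Suc n) (Suc n)) > 0"
  using Suc_in_cls[of n c] by (auto simp: card_gt_0_iff)

text \<open>The two ways to build a partition, appending a zero part or adding a full column,
  correspond to the two reductions of the interpolation problem: setting the last variable to 0 and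
  dividing by a product of variables.\<close>

lemma Lam_induct [consumes 2, case_names zero Suc add_ones]:
  assumes "mu \<in> Lam n" "c = 1 \<or> c = 2"
    and "P 0 (\<lambda>i. 0)"
    and "\<And>n mu. mu \<in> Lam n \<Longrightarrow> P n mu \<Longrightarrow> P (Suc n) mu"
    and "\<And>n mu. mu \<in> Lam (Suc n) \<Longrightarrow> P (Suc n) mu \<Longrightarrow> P (Suc n) (add_ones (Suc n) mu)"
  shows "P n mu"
  using assms(1)
proof (induction n arbitrary: mu)
  case 0
  then show ?case using assms(3) by (simp add: Lam_0)
next
  case (Suc n)
  from Suc.prems show ?case
  proof (induction "mu (Suc n)" arbitrary: mu rule: less_induct)
    case less
    from less.prems show ?case
    proof (cases rule: Lam_cases)
      case 1
      then show ?thesis using Suc.IH assms(4) by blast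
    next
      case (2 nu)
      then show ?thesis using less.hyps[of nu] assms(5) by (simp add: add_ones_def)
    qed
  qed
qed

text \<open>The first entries of \<open>rho\<close> for \<open>Suc n\<close> are those for
  \<open>n\<close> raised by \<open>r\<close>, and the last one is 0. Every restriction to fewer
  variables therefore comes with a shift by \<open>r\<close>.\<close>

lemma node_Suc:
  assumes "mu \<in> Lam n" "i \<in> {1..Suc n}"
  shows "((\<lambda>i. node n r mu i + r)(Suc n := 0)) i = node (Suc n) r mu i"
  using assms Lam_out[OF assms(1), of "Suc n"]
  by (auto simp: node_def rho_def Suc_diff_le algebra_simps)

lemma node_add_ones: "i \<in> {1..n} \<Longrightarrow> node n r (add_ones n mu) i = node n r mu i + 1"
  by (simp add: node_def add_ones_def)

section \<open>Symmetry within residue classes and vanishing at the nodes\<close>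

lemma poly_fun_permute:
  assumes "poly_fun n d f" "\<And>i. i \<in> {1..n} \<Longrightarrow> p i \<in> {1..n}"
  shows "poly_fun n d (\<lambda>x. f (x \<circ> p))"
  using assms
proof (induction rule: poly_fun.induct)
  case (poly_fun_var d f i)
  then show ?case using poly_fun.poly_fun_var[of n d "\<lambda>x. f (x \<circ> p)" "p i"] by (simp add: comp_def)
qed (auto intro: poly_fun.intros)

lemma csymD:
  assumes "csym c n f" "i \<in> {1..n}" "j \<in> {1..n}" "i mod c = j mod c"
  shows "f (x \<circ> Transposition.transpose i j) = f x"
  using assms unfolding csym_def by blast

lemma csym_shift:
  assumes "csym c n f"
  shows "csym c n (\<lambda>x. f (\<lambda>i. x i + a))"
  unfolding csym_def
proof (intro ballI impI allI)
  fix i j and x :: "nat \<Rightarrow> 'a"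
  assume ij: "i \<in> {1..n}" "j \<in> {1..n}" "i mod c = j mod c"
  have "(\<lambda>k. (x \<circ> Transposition.transpose i j) k + a) = (\<lambda>k. x k + a) \<circ> Transposition.transpose i j"
    by (simp add: comp_def)
  then show "f (\<lambda>k. (x \<circ> Transposition.transpose i j) k + a) = f (\<lambda>k. x k + a)"
    using csymD[OF assms ij] by (simp only:)
qed

lemma csym_restrict:
  assumes "csym c (Suc n) f"
  shows "csym c n (\<lambda>x. f (x(Suc n := a)))"
  unfolding csym_def
proof (intro ballI impI allI)
  fix i j and x :: "nat \<Rightarrow> 'a"
  assume ij: "i \<in> {1..n}" "j \<in> {1..n}" "i mod c = j mod c"
  have *: "(x \<circ> Transposition.transpose i j)(Suc n := a) = x(Suc n := a) \<circ> Transposition.transpose i j"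
  proof
    fix k
    have "i \<noteq> Suc n" "j \<noteq> Suc n" using ij by auto
    then show "((x \<circ> Transposition.transpose i j)(Suc n := a)) k = (x(Suc n := a) \<circ> Transposition.transpose i j) k"
      by (simp add: Transposition.transpose_def)
  qed
  show "f ((x \<circ> Transposition.transpose i j)(Suc n := a)) = f (x(Suc n := a))"
    unfolding * using ij by (intro csymD[OF assms]) auto
qed

lemma transpose_cls:
  assumes "i \<in> {1..n}" "j \<in> {1..n}" "i mod c = j mod c"
  shows "bij_betw (Transposition.transpose i j) (cls c n q) (cls c n q)"
proof -
  have "Transposition.transpose i j ` cls c n q \<subseteq> cls c n q"
  proof
    fix k assume "k \<in> Transposition.transpose i j ` cls c n q"
    then obtain l where l: "l \<in> cls c n q" "k = Transposition.transpose i j l" by blast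
    show "k \<in> cls c n q"
    proof (cases "l = i \<or> l = j")
      case True
      then show ?thesis using l assms by (elim disjE) (simp_all add: cls_def)
    next
      case False
      then show ?thesis using l by simp
    qed
  qed
  then show ?thesis
    by (intro bij_betw_byWitness[where f' = "Transposition.transpose i j"]) simp_all
qed

text \<open>By symmetry, vanishing on one hyperplane of the class means vanishing on all of them, so
  the whole product divides. The quotient is symmetric where the product can be cancelled, hence
  everywhere.\<close>

lemma csym_factor:
  fixes f :: "(nat \<Rightarrow> 'a::field_char_0) \<Rightarrow> 'a"
  assumes f: "poly_fun (Suc n) d f" "csym c (Suc n) f" and zero: "\<And>x. f (x(Suc n := 0)) = 0"
  defines "J \<equiv> cls c (Suc n) (Suc n)"
  shows "\<exists>h. poly_fun (Suc n) (d - card J) h \<and> (d < card J \<longrightarrow> h = (\<lambda>x. 0)) \<and>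
    csym c (Suc n) h \<and> (\<forall>x. f x = (\<Prod>j\<in>J. x j) * h x)"
proof -
  have "\<exists>h. poly_fun (Suc n) (d - card J) h \<and> (d < card J \<longrightarrow> h = (\<lambda>x. 0)) \<and> (\<forall>x. f x = (\<Prod>j\<in>J. x j) * h x)"
  proof (rule poly_fun_divide[OF f(1)])
    fix j and x :: "nat \<Rightarrow> 'a" assume j: "j \<in> J" "x j = 0"
    let ?y = "x \<circ> Transposition.transpose j (Suc n)"
    have "?y = ?y(Suc n := 0)" using j(2) by (auto simp: fun_eq_iff)
    then have "f ?y = 0" using zero by metis
    moreover have "f ?y = f x" using j by (intro csymD[OF f(2)]) (auto simp: J_def cls_def)
    ultimately show "f x = 0" by (simp only:)
  qed (auto simp: J_def cls_def)
  then obtain h where h: "poly_fun (Suc n) (d - card J) h" "d < card J \<longrightarrow> h = (\<lambda>x. 0)"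
    and fh: "\<And>x. f x = (\<Prod>j\<in>J. x j) * h x" by blast
  have "csym c (Suc n) h"
    unfolding csym_def
  proof (intro ballI impI allI)
    fix i j and x :: "nat \<Rightarrow> 'a"
    assume ij: "i \<in> {1..Suc n}" "j \<in> {1..Suc n}" "i mod c = j mod c"
    let ?t = "Transposition.transpose i j"
    have pf: "poly_fun (Suc n) (d - card J) (\<lambda>x. h (x \<circ> ?t) - h x)"
      using ij h(1) by (intro poly_fun_diff poly_fun_permute) (auto simp: Transposition.transpose_def)
    have "h (x \<circ> ?t) - h x = 0"
    proof (rule poly_fun_dense[OF pf, of J])
      fix x :: "nat \<Rightarrow> 'a" assume x: "\<forall>j\<in>J. x j \<noteq> 0"
      have "(\<Prod>j\<in>J. (x \<circ> ?t) j) = (\<Prod>j\<in>J. x j)"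
        using prod.reindex_bij_betw[OF transpose_cls[OF ij], of x "Suc n"] by (simp add: J_def)
      moreover have "f (x \<circ> ?t) = f x" by (rule csymD[OF f(2) ij])
      ultimately have "(\<Prod>j\<in>J. x j) * h (x \<circ> ?t) = (\<Prod>j\<in>J. x j) * h x"
        using fh[of x] fh[of "x \<circ> ?t"] by (simp only:)
      then show "h (x \<circ> ?t) - h x = 0" using x by (simp add: J_def)
    qed (simp add: J_def)
    then show "h (x \<circ> ?t) = h x" by simp
  qed
  then show ?thesis using h fh by blast
qed

lemma node_cls_nonzero:
  assumes "allowed r" "j \<in> {1..n}"
  shows "node n r (add_ones n mu) j \<noteq> 0"
  using allowed_nonzero[OF assms(1), of "mu j + 1" "n - j"] assms(2)
  by (simp add: node_def rho_def add_ones_def)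

text \<open>Double induction on the number of variables and the degree. The zeros at partitions
  ending in 0 make the restriction to the last hyperplane vanish; then the product over the class
  factors out, and the zeros at the remaining partitions pass to the quotient, shifted by 1 and with
  a smaller degree.\<close>

lemma csym_vanish_imp_zero:
  fixes f :: "(nat \<Rightarrow> 'a::field_char_0) \<Rightarrow> 'a"
  assumes c: "c = 1 \<or> c = 2" and r: "allowed r"
    and "poly_fun n d f" "csym c n f"
    and "\<And>mu. mu \<in> Lam n \<Longrightarrow> csize c n mu \<le> d \<Longrightarrow> f (node n r mu) = 0"
  shows "f x = 0"
  using assms(3-)
proof (induction n arbitrary: d f x)
  case 0
  have "f x = f (node 0 r (\<lambda>i. 0))" by (rule poly_fun_cong[OF 0(1)]) simp
  also have "\<dots> = 0" by (rule 0(3)) (auto simp: Lam_0 csize_def)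
  finally show ?case .
next
  case (Suc n)
  note IH_n = Suc.IH
  show ?case using Suc.prems
  proof (induction d arbitrary: f x rule: less_induct)
    case (less d)
    let ?g = "\<lambda>x. f ((\<lambda>i. x i + r)(Suc n := 0))"
    have g: "?g x = 0" for x
    proof (rule IH_n[where f = ?g and d = d])
      show "poly_fun n d ?g"
        using poly_fun_shift[OF poly_fun_restrict_Suc[OF less.prems(1)]] .
      show "csym c n ?g"
        using csym_shift[OF csym_restrict[OF less.prems(2)]] .
      fix mu assume mu: "mu \<in> Lam n" "csize c n mu \<le> d"
      have "?g (node n r mu) = f (node (Suc n) r mu)"
        by (rule poly_fun_cong[OF less.prems(1)]) (rule node_Suc[OF mu(1)])
      also have "\<dots> = 0"
        using mu by (intro less.prems(3) Lam_Suc) (auto simp: csize_Suc)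
      finally show "?g (node n r mu) = 0" .
    qed
    have zero: "f (x(Suc n := 0)) = 0" for x
      using g[of "\<lambda>i. x i - r"] by simp
    define J where "J = cls c (Suc n) (Suc n)"
    obtain h where h: "poly_fun (Suc n) (d - card J) h" "d < card J \<longrightarrow> h = (\<lambda>x. 0)"
      "csym c (Suc n) h" and fh: "\<And>x. f x = (\<Prod>j\<in>J. x j) * h x"
      using csym_factor[OF less.prems(1,2) zero] unfolding J_def by blast
    show "f x = 0"
    proof (cases "d < card J")
      case True
      then show ?thesis using h(2) fh[of x] by simp
    next
      case False
      have k: "h (\<lambda>i. x i + 1) = 0" for x
      proof (rule less.IH[where y = "d - card J" and f = "\<lambda>x. h (\<lambda>i. x i + 1)"])
        show "d - card J < d" using False card_cls_pos[of c n] by (simp add: J_def)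
        show "poly_fun (Suc n) (d - card J) (\<lambda>x. h (\<lambda>i. x i + 1))" using h(1) by (rule poly_fun_shift)
        show "csym c (Suc n) (\<lambda>x. h (\<lambda>i. x i + 1))" using h(3) by (rule csym_shift)
        fix mu assume mu: "mu \<in> Lam (Suc n)" "csize c (Suc n) mu \<le> d - card J"
        let ?p = "node (Suc n) r (add_ones (Suc n) mu)"
        have "f ?p = 0"
          using mu False by (intro less.prems(3) Lam_add_ones) (auto simp: csize_add_ones[OF c] J_def)
        moreover have "(\<Prod>j\<in>J. ?p j) \<noteq> 0"
          using node_cls_nonzero[OF r] cls_subset[of c "Suc n" "Suc n"] by (auto simp: J_def prod_zero_iff)
        ultimately have "h ?p = 0" using fh[of ?p] by simp
        moreover have "h (\<lambda>i. node (Suc n) r mu i + 1) = h ?p"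
          by (rule poly_fun_cong[OF h(1)]) (simp add: node_add_ones)
        ultimately show "h (\<lambda>i. node (Suc n) r mu i + 1) = 0" by simp
      qed
      show ?thesis using k[of "\<lambda>i. x i - 1"] fh[of x] by simp
    qed
  qed
qed

section \<open>The coefficient of the leading monomial\<close>

text \<open>Contribution of two rows at distance \<open>e\<close> whose parts differ by
  \<open>D\<close>. The factors are arranged so that \<open>norm_const\<close> obeys the two
  recursions along \<open>Lam_induct\<close> that the value at the node of \<open>lam\<close>
  obeys.\<close>

definition norm_factor :: "nat \<Rightarrow> 'a::field_char_0 \<Rightarrow> nat \<Rightarrow> nat \<Rightarrow> 'a" where
  "norm_factor c r e D = (if e mod c = 1 mod c then pochhammer (of_nat (e - 1) * r + 1) D else 1) /
                (if e mod c = 0 then pochhammer (of_nat e * r + 1) D else 1)"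

text \<open>For stride 2 this is \<open>R\<^sub>\<lambda>(\<rho> + \<lambda>)\<close>.\<close>

definition norm_const :: "nat \<Rightarrow> nat \<Rightarrow> (nat \<Rightarrow> nat) \<Rightarrow> 'a::field_char_0 \<Rightarrow> 'a" where
  "norm_const c n lam r = (\<Prod>l=1..n. \<Prod>j=1..<l. norm_factor c r (l - j) (lam j - lam l)) *
     (\<Prod>j\<in>cls c n n. pochhammer (of_nat (n - j) * r + 1) (lam j))"

lemma pochhammer_allowed_nonzero:
  assumes "allowed r"
  shows "pochhammer (of_nat k * r + 1) D \<noteq> 0"
proof
  assume "pochhammer (of_nat k * r + 1) D = 0"
  then obtain i where "of_nat k * r + 1 = - of_nat i" by (auto simp: pochhammer_eq_0_iff)
  then have "of_nat k * r + of_nat (i + 1) = 0" by (simp add: algebra_simps eq_neg_iff_add_eq_0)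
  then show False using allowed_nonzero[OF assms, of "i + 1" k] by simp
qed

lemma stride_dist:
  fixes c :: nat
  assumes "c = 1 \<or> c = 2" "j \<le> l"
  shows "(l - j) mod c = 0 \<longleftrightarrow> j mod c = l mod c"
    and "(l - j) mod c = 1 mod c \<longleftrightarrow> l mod c = (j + 1) mod c"
proof -
  obtain e where e: "l = j + e" using assms(2) le_Suc_ex by blast
  show "(l - j) mod c = 0 \<longleftrightarrow> j mod c = l mod c"
    using assms(1) by (elim disjE) (auto simp: e mod2_eq_if)
  show "(l - j) mod c = 1 mod c \<longleftrightarrow> l mod c = (j + 1) mod c"
    using assms(1) by (elim disjE) (auto simp: e mod2_eq_if)
qed

lemma stride_Suc: "c = 1 \<or> c = 2 \<Longrightarrow> Suc n mod c = (j + 1) mod c \<longleftrightarrow> j mod c = n mod c"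
  by (elim disjE) (auto simp: mod2_eq_if)

lemma prod_cls: "(\<Prod>j\<in>cls c n q. f j) = (\<Prod>j=1..n. if j mod c = q mod c then f j else 1)"
  unfolding cls_def by (rule prod.inter_filter) simp

text \<open>The new row is 0. Of its pair factors, the denominators cancel the new boundary product
  over the class of \<open>Suc n\<close>, and the numerators rebuild the old boundary product over
  the class of \<open>n\<close>.\<close>

lemma norm_const_Suc:
  assumes c: "c = 1 \<or> c = 2" and r: "allowed r" and lam: "lam \<in> Lam n"
  shows "norm_const c (Suc n) lam r = norm_const c n lam r"
proof -
  have l0: "lam (Suc n) = 0" using Lam_out[OF lam] by simp
  define P where "P j = pochhammer (of_nat (Suc n - j) * r + 1) (lam j)" for j
  define Q where "Q j = pochhammer (of_nat (n - j) * r + 1) (lam j)" for j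
  have P_last: "P (Suc n) = 1" by (simp add: P_def l0)
  have "norm_factor c r (Suc n - j) (lam j) * (if j mod c = Suc n mod c then P j else 1) =
      (if j mod c = n mod c then Q j else 1)" if "j \<in> {1..n}" for j
  proof -
    have "P j \<noteq> 0" unfolding P_def by (rule pochhammer_allowed_nonzero[OF r])
    moreover have "(Suc n - j) mod c = 1 mod c \<longleftrightarrow> j mod c = n mod c"
      using stride_dist(2)[OF c, of j "Suc n"] stride_Suc[OF c] that by simp
    moreover have "(Suc n - j) mod c = 0 \<longleftrightarrow> j mod c = Suc n mod c"
      using stride_dist(1)[OF c, of j "Suc n"] that by simp
    moreover have "Suc n - j - 1 = n - j" by simp
    ultimately show ?thesis unfolding norm_factor_def P_def Q_def by simp
  qed
  then have "(\<Prod>j=1..n. norm_factor c r (Suc n - j) (lam j) * (if j mod c = Suc n mod c then P j else 1)) =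
    (\<Prod>j=1..n. if j mod c = n mod c then Q j else 1)"
    by (intro prod.cong) auto
  then have "(\<Prod>j=1..n. norm_factor c r (Suc n - j) (lam j)) * (\<Prod>j\<in>cls c (Suc n) (Suc n). P j) = (\<Prod>j\<in>cls c n n. Q j)"
    using P_last by (simp add: prod_cls prod.distrib)
  moreover have "{1..<Suc n} = {1..n}" by auto
  ultimately show ?thesis
    unfolding norm_const_def P_def Q_def by (simp add: l0 mult.assoc)
qed

text \<open>Differences of parts do not change, so only the boundary product grows, by one factor
  for each index. The new factors form exactly the divided product, taken at the shifted
  node.\<close>

lemma norm_const_add_ones:
  assumes lam: "lam \<in> Lam n"
  shows "norm_const c n (add_ones n lam) r = (\<Prod>j\<in>cls c n n. node n r lam j + 1) * norm_const c n lam r"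
proof -
  have "(\<Prod>l=1..n. \<Prod>j=1..<l. norm_factor c r (l - j) (add_ones n lam j - add_ones n lam l)) =
     (\<Prod>l=1..n. \<Prod>j=1..<l. norm_factor c r (l - j) (lam j - lam l))"
    by (intro prod.cong) (auto simp: add_ones_def)
  moreover have "(\<Prod>j\<in>cls c n n. pochhammer (of_nat (n - j) * r + 1) (add_ones n lam j)) =
     (\<Prod>j\<in>cls c n n. pochhammer (of_nat (n - j) * r + 1) (lam j)) * (\<Prod>j\<in>cls c n n. node n r lam j + 1)"
    unfolding prod.distrib[symmetric]
    by (intro prod.cong) (auto simp: add_ones_def cls_def pochhammer_Suc node_def rho_def algebra_simps)
  ultimately show ?thesis unfolding norm_const_def by (simp add: mult_ac)
qed

lemma norm_const_nonzero:
  assumes c: "c = 1 \<or> c = 2" and r: "allowed r" and lam: "lam \<in> Lam n"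
  shows "norm_const c n lam r \<noteq> 0"
  using lam c
proof (induction rule: Lam_induct)
  case zero
  show ?case by (simp add: norm_const_def)
next
  case (Suc n mu)
  then show ?case by (simp add: norm_const_Suc[OF c r])
next
  case (add_ones n mu)
  have "node (Suc n) r mu j + 1 \<noteq> 0" if "j \<in> cls c (Suc n) (Suc n)" for j
    using node_cls_nonzero[OF r, of j "Suc n" mu] node_add_ones[of j "Suc n" r mu] that cls_subset[of c "Suc n" "Suc n"] by auto
  then show ?case using add_ones by (simp add: norm_const_add_ones)
qed

section \<open>Brackets and the normalising monomial\<close>

lemma bracket_rec:
  assumes "m \<le> n"
  shows "bracket n lam m = int (lam m) - bracket n lam (Suc m)"
proof -
  have "bracket n lam m = int (lam m) + (\<Sum>j=Suc m..n. (-1) ^ (j - m) * int (lam j))"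
    unfolding bracket_def using assms by (subst sum.atLeast_Suc_atMost) auto
  also have "(\<Sum>j=Suc m..n. (-1) ^ (j - m) * int (lam j)) = (\<Sum>j=Suc m..n. - ((-1) ^ (j - Suc m) * int (lam j)))"
    by (intro sum.cong refl) (simp add: Suc_diff_Suc[symmetric] Suc_le_lessD del: Suc_diff_Suc)
  finally show ?thesis by (simp add: bracket_def sum_negf)
qed

lemma bracket_end [simp]: "bracket n lam (Suc n) = 0"
  by (simp add: bracket_def)

text \<open>Downward induction: the next bracket lies between 0 and the next part, hence is at most
  the current part. Thus \<open>nat\<close> in \<open>bracket_mono\<close> loses nothing.\<close>

lemma bracket_bounds:
  assumes lam: "lam \<in> Lam n" and "1 \<le> m" "m \<le> Suc n"
  shows "0 \<le> bracket n lam m \<and> bracket n lam m \<le> int (lam m)"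
  using assms(3,2)
proof (induction m rule: inc_induct)
  case base
  then show ?case by simp
next
  case (step m)
  have "lam (Suc m) \<le> lam m"
    using lam step by (cases "Suc m \<le> n") (auto simp: Lam_def)
  then show ?case using step bracket_rec[of m n lam] by simp
qed

lemma bracket_Suc:
  assumes "lam \<in> Lam n" "m \<le> Suc n"
  shows "bracket (Suc n) lam m = bracket n lam m"
  using assms Lam_out[OF assms(1), of "Suc n"] by (simp add: bracket_def)

text \<open>An alternating sum of ones is 1 or 0 according to the parity of its length. So a full
  column multiplies the normalising monomial by exactly the product over the class of
  \<open>n\<close> that is divided out.\<close>

lemma bracket_add_ones:
  assumes "1 \<le> m" "m \<le> Suc n"
  shows "bracket n (add_ones n lam) m = bracket n lam m + (if m \<le> n \<and> m mod 2 = n mod 2 then 1 else 0)"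
  using assms(2,1)
proof (induction m rule: inc_induct)
  case base
  then show ?case by simp
next
  case (step m)
  have "m = n \<or> Suc m \<le> n" using step by auto
  moreover have "int (add_ones n lam m) = int (lam m) + 1" using step by (simp add: add_ones_def)
  ultimately show ?case using step bracket_rec[of m n lam] bracket_rec[of m n "add_ones n lam"]
    by (auto simp: mod2_eq_if)
qed

definition unit_mono :: "nat set \<Rightarrow> nat \<Rightarrow>\<^sub>0 nat" where
  "unit_mono J = (\<Sum>j\<in>J. Poly_Mapping.single j 1)"

lemma unit_mono_props:
  assumes "finite J"
  shows "mono_deg (unit_mono J) = card J" "mono_val x (unit_mono J) = (\<Prod>j\<in>J. x j)"
    "Poly_Mapping.keys (unit_mono J) \<subseteq> J"
proof -
  show "mono_deg (unit_mono J) = card J" "mono_val x (unit_mono J) = (\<Prod>j\<in>J. x j)"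
    using assms unfolding unit_mono_def
    by (induction J rule: finite_induct) (auto simp: mono_deg_add mono_deg_single mono_val_add mono_val_single)
  show "Poly_Mapping.keys (unit_mono J) \<subseteq> J"
    using assms unfolding unit_mono_def
  proof (induction J rule: finite_induct)
    case (insert j J)
    then show ?case using keys_add[of "Poly_Mapping.single j (1::nat)" "\<Sum>j\<in>J. Poly_Mapping.single j 1"] by auto
  qed simp
qed

lemma bracket_mono_Suc:
  assumes "lam \<in> Lam n"
  shows "bracket_mono (Suc n) lam = bracket_mono n lam"
proof -
  have "bracket_mono (Suc n) lam = (\<Sum>m=1..Suc n. Poly_Mapping.single m (nat (bracket n lam m)))"
    unfolding bracket_mono_def by (intro sum.cong refl) (simp add: bracket_Suc[OF assms])
  then show ?thesis by (simp add: bracket_mono_def)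
qed

lemma bracket_mono_add_ones:
  assumes "lam \<in> Lam n"
  shows "bracket_mono n (add_ones n lam) = unit_mono (cls 2 n n) + bracket_mono n lam"
proof -
  have "bracket_mono n (add_ones n lam) = (\<Sum>m=1..n. (if m mod 2 = n mod 2 then Poly_Mapping.single m 1 else 0) +
      Poly_Mapping.single m (nat (bracket n lam m)))"
    unfolding bracket_mono_def
  proof (intro sum.cong refl)
    fix m assume "m \<in> {1..n}"
    then show "Poly_Mapping.single m (nat (bracket n (add_ones n lam) m)) =
       (if m mod 2 = n mod 2 then Poly_Mapping.single m 1 else 0) + Poly_Mapping.single m (nat (bracket n lam m))"
      using bracket_add_ones[of m n lam] bracket_bounds[OF assms, of m]
      by (simp add: single_add[symmetric] nat_add_distrib)
  qed
  moreover have "unit_mono (cls 2 n n) = (\<Sum>m=1..n. if m mod 2 = n mod 2 then Poly_Mapping.single m 1 else 0)"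
    unfolding unit_mono_def cls_def by (rule sum.inter_filter) simp
  ultimately show ?thesis by (simp add: bracket_mono_def sum.distrib)
qed

lemma odd_size_eq: "odd_size n = csize 2 n"
  unfolding odd_size_def csize_def cls_def by (intro ext sum.cong) (auto simp: odd_iff_mod_2_eq_one)

lemma bracket_mono_props:
  assumes "lam \<in> Lam n"
  shows "mono_deg (bracket_mono n lam) = odd_size n lam \<and> Poly_Mapping.keys (bracket_mono n lam) \<subseteq> {1..n}"
proof -
  have "(2::nat) = 1 \<or> (2::nat) = 2" by simp
  from assms this show ?thesis
  proof (induction rule: Lam_induct)
    case zero
    show ?case by (simp add: bracket_mono_def odd_size_def)
  next
    case (Suc n mu)
    then show ?case by (auto simp: bracket_mono_Suc odd_size_eq csize_Suc)
  next
    case (add_ones n mu)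
    have "Poly_Mapping.keys (unit_mono (cls 2 (Suc n) (Suc n))) \<subseteq> {1..Suc n}"
      by (rule order.trans[OF unit_mono_props(3) cls_subset]) simp
    then show ?case using add_ones keys_add[of "unit_mono (cls 2 (Suc n) (Suc n))" "bracket_mono (Suc n) mu"]
      by (auto simp: bracket_mono_add_ones odd_size_eq csize_add_ones mono_deg_add unit_mono_props(1))
  qed
qed

lemma mpoly_shift:
  fixes p :: "'a::field_char_0 mpoly"
  assumes "p \<in> poly_ring n" "deg_le d p"
  shows "\<exists>q. q \<in> poly_ring n \<and> deg_le d q \<and> (\<forall>x. eval_mpoly x q = eval_mpoly (\<lambda>i. x i + a) p) \<and>
    (\<forall>m. mono_deg m = d \<longrightarrow> Poly_Mapping.lookup q m = Poly_Mapping.lookup p m)"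
proof -
  obtain h where h: "poly_fun n (d - 1) h" "d = 0 \<longrightarrow> h = (\<lambda>x. 0)"
    "\<And>x. eval_mpoly (\<lambda>i. x i + a) p = eval_mpoly x p + h x"
    using poly_fun_shift_diff[OF mpoly_imp_poly_fun[OF assms], of a] by blast
  show ?thesis
  proof (cases "d = 0")
    case True
    then show ?thesis using assms h by (intro exI[of _ p]) simp
  next
    case False
    obtain k where k: "k \<in> poly_ring n" "deg_le (d - 1) k" "\<And>x. eval_mpoly x k = h x"
      using poly_fun_imp_mpoly[OF h(1)] by blast
    have "Poly_Mapping.lookup k m = 0" if "mono_deg m = d" for m
      using k(2) that False unfolding deg_le_def by (force simp: in_keys_iff)
    moreover have "deg_le d k" using k(2) unfolding deg_le_def by fastforce
    ultimately show ?thesis using assms k h(3)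
      by (intro exI[of _ "p + k"]) (auto simp: eval_mpoly_add lookup_add intro: poly_ring_add deg_le_add)
  qed
qed

lemma mpoly_restrict:
  fixes p :: "'a::field_char_0 mpoly"
  assumes "p \<in> poly_ring (Suc n)" "deg_le d p"
  shows "\<exists>q. q \<in> poly_ring n \<and> deg_le d q \<and> (\<forall>x. eval_mpoly x q = eval_mpoly (x(Suc n := 0)) p) \<and>
    (\<forall>m. Poly_Mapping.keys m \<subseteq> {1..n} \<longrightarrow> Poly_Mapping.lookup q m = Poly_Mapping.lookup p m)"
proof -
  define K where "K = {m \<in> Poly_Mapping.keys p. Poly_Mapping.lookup m (Suc n) = 0}"
  define q where "q = (\<Sum>m\<in>K. Poly_Mapping.single m (Poly_Mapping.lookup p m))"
  have fin: "finite K" by (simp add: K_def)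
  have lookup_q: "Poly_Mapping.lookup q m = (if m \<in> K then Poly_Mapping.lookup p m else 0)" for m
  proof -
    have "Poly_Mapping.lookup q m = (\<Sum>k\<in>K. if k = m then Poly_Mapping.lookup p m else 0)"
      unfolding q_def lookup_sum by (intro sum.cong) (auto simp: lookup_single when_def)
    then show ?thesis using fin by simp
  qed
  have keys_q: "Poly_Mapping.keys q = K" by (auto simp: in_keys_iff lookup_q K_def split: if_splits)
  have "q \<in> poly_ring n"
    unfolding poly_ring_def mem_Collect_eq keys_q
  proof
    fix m assume m: "m \<in> K"
    then have "Poly_Mapping.keys m \<subseteq> {1..Suc n}" "Suc n \<notin> Poly_Mapping.keys m"
      using assms(1) by (auto simp: K_def poly_ring_def in_keys_iff)
    then show "Poly_Mapping.keys m \<subseteq> {1..n}" by (auto simp: le_Suc_eq)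
  qed
  moreover have "deg_le d q" using assms(2) unfolding deg_le_def keys_q by (auto simp: K_def)
  moreover have "eval_mpoly x q = eval_mpoly (x(Suc n := 0)) p" for x
  proof -
    have up0: "Poly_Mapping.update (Suc n) 0 m = m" if "Poly_Mapping.lookup m (Suc n) = 0" for m :: "nat \<Rightarrow>\<^sub>0 nat"
      using that by (intro poly_mapping_eqI) (auto simp: lookup_update)
    have "eval_mpoly (x(Suc n := 0)) p = (\<Sum>m\<in>Poly_Mapping.keys p. if Poly_Mapping.lookup m (Suc n) = 0 then Poly_Mapping.lookup p m * mono_val x m else 0)"
      unfolding eval_mpoly_superset[OF finite_keys order.refl, of _ p] mono_val_fun_upd
      by (intro sum.cong refl) (auto simp: up0)
    also have "\<dots> = (\<Sum>m\<in>K. Poly_Mapping.lookup p m * mono_val x m)"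
      unfolding K_def by (rule sum.inter_filter[symmetric]) simp
    finally show ?thesis by (simp add: q_def eval_mpoly_sum eval_mpoly_single)
  qed
  moreover have "Poly_Mapping.lookup q m = Poly_Mapping.lookup p m" if "Poly_Mapping.keys m \<subseteq> {1..n}" for m
  proof -
    have "Suc n \<notin> Poly_Mapping.keys m" using that by auto
    then show ?thesis unfolding lookup_q by (auto simp: K_def in_keys_iff)
  qed
  ultimately show ?thesis by blast
qed

text \<open>The two moves of \<open>Lam_induct\<close> transport the coefficient and the value
  together. Restriction and shifts leave the coefficient alone, and division strips the matching
  factor from the monomial; the value at the node changes only by the factor of
  \<open>norm_const_add_ones\<close>.\<close>

lemma bracket_coeff:
  fixes p :: "'a::field_char_0 mpoly"
  assumes r: "allowed r" and lam: "lam \<in> Lam n"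
    and "p \<in> poly_ring n" "deg_le (odd_size n lam) p" "csym 2 n (\<lambda>x. eval_mpoly x p)"
    and "\<And>mu. mu \<in> Lam n \<Longrightarrow> odd_size n mu \<le> odd_size n lam \<Longrightarrow> mu \<noteq> lam \<Longrightarrow> eval_mpoly (node n r mu) p = 0"
  shows "eval_mpoly (node n r lam) p = norm_const 2 n lam r * Poly_Mapping.lookup p (bracket_mono n lam)"
proof -
  have c: "(2::nat) = 1 \<or> (2::nat) = 2" by simp
  from lam c assms(3-) show ?thesis
    unfolding odd_size_eq
  proof (induction arbitrary: p rule: Lam_induct)
    case zero
    then have "Poly_Mapping.keys p \<subseteq> {0}" by (auto simp: poly_ring_def)
    then have "eval_mpoly x p = Poly_Mapping.lookup p 0" for x
      by (subst eval_mpoly_superset[of "{0}"]) auto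
    then show ?case by (simp add: norm_const_def bracket_mono_def)
  next
    case (Suc n lam)
    obtain p0 where p0: "p0 \<in> poly_ring n" "deg_le (csize 2 n lam) p0"
      "\<And>x. eval_mpoly x p0 = eval_mpoly (x(Suc n := 0)) p"
      "\<And>m. Poly_Mapping.keys m \<subseteq> {1..n} \<Longrightarrow> Poly_Mapping.lookup p0 m = Poly_Mapping.lookup p m"
      using mpoly_restrict[OF Suc.prems(1,2)] by (auto simp: csize_Suc[OF Suc.hyps])
    obtain q where q: "q \<in> poly_ring n" "deg_le (csize 2 n lam) q"
      "\<And>x. eval_mpoly x q = eval_mpoly (\<lambda>i. x i + r) p0"
      "\<And>m. mono_deg m = csize 2 n lam \<Longrightarrow> Poly_Mapping.lookup q m = Poly_Mapping.lookup p0 m"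
      using mpoly_shift[OF p0(1,2), of r] by blast
    have eq: "eval_mpoly (node n r mu) q = eval_mpoly (node (Suc n) r mu) p" if "mu \<in> Lam n" for mu
      unfolding q(3) p0(3)
      by (rule poly_fun_cong[OF mpoly_imp_poly_fun[OF Suc.prems(1,2)]]) (rule node_Suc[OF that])
    have "eval_mpoly (node n r lam) q = norm_const 2 n lam r * Poly_Mapping.lookup q (bracket_mono n lam)"
    proof (rule Suc.IH[OF q(1,2)])
      show "csym 2 n (\<lambda>x. eval_mpoly x q)"
        unfolding q(3) p0(3) using csym_shift[OF csym_restrict[OF Suc.prems(3)]] .
      fix mu assume "mu \<in> Lam n" "csize 2 n mu \<le> csize 2 n lam" "mu \<noteq> lam"
      then show "eval_mpoly (node n r mu) q = 0"
        unfolding eq[OF \<open>mu \<in> Lam n\<close>] using Suc.hyps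
        by (intro Suc.prems(4)) (auto intro: Lam_Suc simp: csize_Suc)
    qed
    then show ?case
      using bracket_mono_props[OF Suc.hyps] p0(4) q(4) eq[OF Suc.hyps]
      by (simp add: norm_const_Suc[OF c r] Suc.hyps bracket_mono_Suc odd_size_eq)
  next
    case (add_ones n lam)
    define d where "d = csize 2 (Suc n) (add_ones (Suc n) lam)"
    define J where "J = cls 2 (Suc n) (Suc n)"
    have d: "d - card J = csize 2 (Suc n) lam" by (simp add: d_def J_def csize_add_ones)
    have pf: "poly_fun (Suc n) d (\<lambda>x. eval_mpoly x p)"
      using mpoly_imp_poly_fun[OF add_ones.prems(1,2)] by (simp add: d_def)
    let ?g = "\<lambda>x. eval_mpoly ((\<lambda>i. x i + r)(Suc n := 0)) p"
    \<comment> \<open>The partition at hand has a positive last part, so it differs from every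
      \<open>mu\<close> in \<open>Lam n\<close>, and no node in \<open>n\<close> variables is exempt
      from the vanishing hypothesis.\<close>
    have g: "?g x = 0" for x
    proof (rule csym_vanish_imp_zero[OF c r, where f = ?g])
      show "poly_fun n d ?g" using poly_fun_shift[OF poly_fun_restrict_Suc[OF pf]] .
      show "csym 2 n ?g" using csym_shift[OF csym_restrict[OF add_ones.prems(3)]] .
      fix mu assume mu: "mu \<in> Lam n" "csize 2 n mu \<le> d"
      have "?g (node n r mu) = eval_mpoly (node (Suc n) r mu) p"
        by (rule poly_fun_cong[OF pf]) (rule node_Suc[OF mu(1)])
      also have "\<dots> = 0"
      proof (intro add_ones.prems(4))
        have "mu (Suc n) \<noteq> add_ones (Suc n) lam (Suc n)" using Lam_out[OF mu(1)] by (simp add: add_ones_def)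
        then show "mu \<noteq> add_ones (Suc n) lam" by auto
      qed (use mu in \<open>auto intro: Lam_Suc simp: csize_Suc d_def\<close>)
      finally show "?g (node n r mu) = 0" .
    qed
    have zero: "eval_mpoly (x(Suc n := 0)) p = 0" for x
      using g[of "\<lambda>i. x i - r"] by simp
    obtain h where h: "poly_fun (Suc n) (d - card J) h" "csym 2 (Suc n) h"
      and fh: "\<And>x. eval_mpoly x p = (\<Prod>j\<in>J. x j) * h x"
      using csym_factor[OF pf add_ones.prems(3) zero] unfolding J_def by blast
    obtain k where k: "k \<in> poly_ring (Suc n)" "deg_le (csize 2 (Suc n) lam) k" "\<And>x. eval_mpoly x k = h x"
      using poly_fun_imp_mpoly[OF h(1)] unfolding d by blast
    obtain q where q: "q \<in> poly_ring (Suc n)" "deg_le (csize 2 (Suc n) lam) q"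
      "\<And>x. eval_mpoly x q = eval_mpoly (\<lambda>i. x i + 1) k"
      "\<And>m. mono_deg m = csize 2 (Suc n) lam \<Longrightarrow> Poly_Mapping.lookup q m = Poly_Mapping.lookup k m"
      using mpoly_shift[OF k(1,2), of 1] by blast
    have qh: "eval_mpoly (node (Suc n) r mu) q = h (node (Suc n) r (add_ones (Suc n) mu))" for mu
      unfolding q(3) k(3) by (rule poly_fun_cong[OF h(1)]) (simp add: node_add_ones)
    have "eval_mpoly (node (Suc n) r lam) q = norm_const 2 (Suc n) lam r * Poly_Mapping.lookup q (bracket_mono (Suc n) lam)"
    proof (rule add_ones.IH[OF q(1,2)])
      show "csym 2 (Suc n) (\<lambda>x. eval_mpoly x q)"
        unfolding q(3) k(3) using csym_shift[OF h(2)] .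
      fix mu assume mu: "mu \<in> Lam (Suc n)" "csize 2 (Suc n) mu \<le> csize 2 (Suc n) lam" "mu \<noteq> lam"
      let ?p = "node (Suc n) r (add_ones (Suc n) mu)"
      have ne: "add_ones (Suc n) mu \<noteq> add_ones (Suc n) lam"
      proof
        assume *: "add_ones (Suc n) mu = add_ones (Suc n) lam"
        have "mu i = lam i" for i
          using fun_cong[OF *, of i] mu(1) add_ones.hyps by (cases "i \<in> {1..Suc n}") (auto simp: add_ones_def Lam_def)
        then show False using mu(3) by auto
      qed
      have "eval_mpoly ?p p = 0"
        using mu ne by (intro add_ones.prems(4) Lam_add_ones) (auto simp: csize_add_ones)
      moreover have "(\<Prod>j\<in>J. ?p j) \<noteq> 0"
        using node_cls_nonzero[OF r] cls_subset[of 2 "Suc n" "Suc n"] by (auto simp: J_def prod_zero_iff)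
      ultimately show "eval_mpoly (node (Suc n) r mu) q = 0" using fh[of ?p] unfolding qh by simp
    qed
    moreover have "p = Poly_Mapping.single (unit_mono J) 1 * k"
    proof (rule eval_mpoly_eqI[OF add_ones.prems(1)])
      show "Poly_Mapping.single (unit_mono J) 1 * k \<in> poly_ring (Suc n)"
        using unit_mono_props(3)[of J] cls_subset[of 2 "Suc n" "Suc n"]
        by (intro poly_ring_single_mult k) (auto simp: J_def)
      show "eval_mpoly x p = eval_mpoly x (Poly_Mapping.single (unit_mono J) 1 * k)" for x
        by (simp add: eval_mpoly_single_mult unit_mono_props fh k(3) J_def)
    qed
    then have "Poly_Mapping.lookup p (bracket_mono (Suc n) (add_ones (Suc n) lam)) = Poly_Mapping.lookup k (bracket_mono (Suc n) lam)"
      unfolding bracket_mono_add_ones[OF add_ones.hyps] J_def[symmetric] by (simp add: lookup_single_mult)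
    moreover have "Poly_Mapping.lookup q (bracket_mono (Suc n) lam) = Poly_Mapping.lookup k (bracket_mono (Suc n) lam)"
      using bracket_mono_props[OF add_ones.hyps] by (intro q(4)) (simp add: odd_size_eq)
    moreover have "(\<Prod>j\<in>J. node (Suc n) r (add_ones (Suc n) lam) j) = (\<Prod>j\<in>J. node (Suc n) r lam j + 1)"
      using cls_subset[of 2 "Suc n" "Suc n"] by (intro prod.cong refl node_add_ones) (auto simp: J_def)
    ultimately show ?case
      unfolding fh qh norm_const_add_ones[OF add_ones.hyps] J_def by (simp add: mult.assoc)
  qed
qed

section \<open>Existence of interpolation\<close>

text \<open>
  Rational functions of the parameter without poles at admissible parameters. Existence is proved
  for families depending on \<open>r\<close> in this way, because the difference operators below have poles at
  \<open>r = 0\<close>, where the result follows by continuity.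
\<close>

definition regular :: "('a::field_char_0 \<Rightarrow> 'a) \<Rightarrow> bool" where
  "regular g \<longleftrightarrow> (\<exists>P Q. \<forall>r. allowed r \<longrightarrow> poly Q r \<noteq> 0 \<and> g r = poly P r / poly Q r)"

lemma regular_const: "regular (\<lambda>r. a)"
  unfolding regular_def by (intro exI[of _ "[:a:]"] exI[of _ 1]) simp

lemma regular_id: "regular (\<lambda>r. r)"
  unfolding regular_def by (intro exI[of _ "[:0, 1:]"] exI[of _ 1]) simp

lemma regular_add:
  assumes "regular f" "regular g"
  shows "regular (\<lambda>r. f r + g r)"
proof -
  obtain P Q P' Q' where *: "\<And>r. allowed r \<Longrightarrow> poly Q r \<noteq> 0 \<and> f r = poly P r / poly Q r"
    "\<And>r. allowed r \<Longrightarrow> poly Q' r \<noteq> 0 \<and> g r = poly P' r / poly Q' r"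
    using assms unfolding regular_def by blast
  show ?thesis unfolding regular_def
    by (rule exI[of _ "P * Q' + P' * Q"], rule exI[of _ "Q * Q'"]) (use * in \<open>auto simp: field_simps\<close>)
qed

lemma regular_mult:
  assumes "regular f" "regular g"
  shows "regular (\<lambda>r. f r * g r)"
proof -
  obtain P Q P' Q' where *: "\<And>r. allowed r \<Longrightarrow> poly Q r \<noteq> 0 \<and> f r = poly P r / poly Q r"
    "\<And>r. allowed r \<Longrightarrow> poly Q' r \<noteq> 0 \<and> g r = poly P' r / poly Q' r"
    using assms unfolding regular_def by blast
  show ?thesis unfolding regular_def
    by (rule exI[of _ "P * P'"], rule exI[of _ "Q * Q'"]) (use * in auto)
qed

lemma regular_divide:
  assumes "regular f" "regular g" "\<And>r. allowed r \<Longrightarrow> g r \<noteq> 0"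
  shows "regular (\<lambda>r. f r / g r)"
proof -
  obtain P Q P' Q' where *: "\<And>r. allowed r \<Longrightarrow> poly Q r \<noteq> 0 \<and> f r = poly P r / poly Q r"
    "\<And>r. allowed r \<Longrightarrow> poly Q' r \<noteq> 0 \<and> g r = poly P' r / poly Q' r"
    using assms unfolding regular_def by blast
  then have "poly P' r \<noteq> 0" if "allowed r" for r using assms(3)[OF that] that by fastforce
  then show ?thesis unfolding regular_def
    by (intro exI[of _ "P * Q'"] exI[of _ "Q * P'"]) (use * in auto)
qed

lemma regular_diff: "regular f \<Longrightarrow> regular g \<Longrightarrow> regular (\<lambda>r. f r - g r)"
  using regular_add[OF _ regular_mult[OF regular_const[of "-1"]], of f g] by simp

lemma regular_prod: "(\<And>i. i \<in> I \<Longrightarrow> regular (f i)) \<Longrightarrow> regular (\<lambda>r. \<Prod>i\<in>I. f i r)"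
  by (induction I rule: infinite_finite_induct) (auto intro: regular_const regular_mult)

lemma regular_power: "regular f \<Longrightarrow> regular (\<lambda>r. f r ^ k)"
  by (induction k) (auto intro: regular_const regular_mult)

lemma regular_node: "regular (\<lambda>r. node n r mu i)"
  unfolding node_def rho_def by (intro regular_add regular_mult regular_const regular_id)

section \<open>Elementary symmetric polynomials as coefficients of a product of linear
  factors\<close>

definition esym :: "nat set \<Rightarrow> nat \<Rightarrow> (nat \<Rightarrow> 'a::comm_ring_1) \<Rightarrow> 'a" where
  "esym I k x = coeff (\<Prod>i\<in>I. [:1, x i:]) k"

lemma esym_empty: "esym {} k x = (if k = 0 then 1 else 0)"
  by (simp add: esym_def)

lemma esym_insert:
  assumes "finite I" "i \<notin> I"
  shows "esym (insert i I) k x = esym I k x + x i * (if k = 0 then 0 else esym I (k - 1) x)"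
  using assms unfolding esym_def by (cases k) (auto simp: mult_pCons_left)

lemma esym_0: "finite I \<Longrightarrow> esym I 0 x = 1"
  by (induction I rule: finite_induct) (auto simp: esym_empty esym_insert)

lemma esym_gt_card: "finite I \<Longrightarrow> k > card I \<Longrightarrow> esym I k x = 0"
  by (induction I arbitrary: k rule: finite_induct) (auto simp: esym_empty esym_insert)

lemma esym_card: "finite I \<Longrightarrow> esym I (card I) x = (\<Prod>i\<in>I. x i)"
  by (induction I rule: finite_induct) (auto simp: esym_empty esym_insert esym_gt_card)

lemma esym_cong: "(\<And>i. i \<in> I \<Longrightarrow> x i = y i) \<Longrightarrow> esym I k x = esym I k y"
  by (simp add: esym_def)

lemma esym_permute: "bij_betw p I I \<Longrightarrow> esym I k (x \<circ> p) = esym I k x"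
  unfolding esym_def using prod.reindex_bij_betw[of p I I "\<lambda>i. [:1, x i:]"] by simp

lemma esym_diag: "finite I \<Longrightarrow> esym I k (\<lambda>i. t) = of_nat (card I choose k) * t ^ k"
proof (induction I arbitrary: k rule: finite_induct)
  case empty
  then show ?case by (cases k) (auto simp: esym_empty)
next
  case (insert i I)
  then show ?case by (cases k) (auto simp: esym_insert algebra_simps)
qed

text \<open>The homomorphism \<open>h\<close> allows two uses: embedding scalars as constant
  polynomials, for translations, and the identity, for products of differences.\<close>

lemma prod_linear_esym:
  fixes h :: "'a::comm_ring_1 \<Rightarrow> 'b::comm_ring_1"
  assumes h: "\<And>u v. h (u + v) = h u + h v" "\<And>u v. h (u * v) = h u * h v" "h 1 = 1"
    and "finite I"
  shows "(\<Prod>i\<in>I. a + b * h (x i)) = (\<Sum>k\<le>card I. h (esym I k x) * b ^ k * a ^ (card I - k))"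
proof -
  have h0: "h 0 = 0" using h(1)[of 0 0] by simp
  show ?thesis
    using assms(4)
  proof (induction I rule: finite_induct)
    case empty
    then show ?case by (simp add: esym_empty h)
  next
    case (insert i I)
    let ?N = "card I"
    have 1: "(\<Sum>k\<le>Suc ?N. h (esym I k x) * b ^ k * a ^ (Suc ?N - k)) =
      a * (\<Sum>k\<le>?N. h (esym I k x) * b ^ k * a ^ (?N - k))"
      using insert.hyps by (simp add: esym_gt_card h0 sum_distrib_left Suc_diff_le mult_ac)
    have 2: "(\<Sum>k\<le>Suc ?N. h (x i * (if k = 0 then 0 else esym I (k - 1) x)) * b ^ k * a ^ (Suc ?N - k)) =
      b * h (x i) * (\<Sum>k\<le>?N. h (esym I k x) * b ^ k * a ^ (?N - k))"
      by (subst sum.atMost_Suc_shift) (simp add: h0 h(2) sum_distrib_left mult_ac)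
    have "(\<Sum>k\<le>card (insert i I). h (esym (insert i I) k x) * b ^ k * a ^ (card (insert i I) - k)) =
      (\<Sum>k\<le>Suc ?N. h (esym I k x) * b ^ k * a ^ (Suc ?N - k)) +
      (\<Sum>k\<le>Suc ?N. h (x i * (if k = 0 then 0 else esym I (k - 1) x)) * b ^ k * a ^ (Suc ?N - k))"
      unfolding sum.distrib[symmetric] using insert.hyps
      by (intro sum.cong) (auto simp: esym_insert h(1) algebra_simps)
    then show ?case unfolding 1 2 using insert by (simp add: algebra_simps)
  qed
qed

definition shift_coeff :: "nat \<Rightarrow> 'a::comm_ring_1 \<Rightarrow> nat \<Rightarrow> nat \<Rightarrow> 'a" where
  "shift_coeff N a k l = of_nat ((N - l) choose (k - l)) * a ^ (k - l)"

lemma coeff_linear_power_1: "coeff ([:1, a:] ^ m) k = of_nat (m choose k) * a ^ k" for a :: "'a::comm_ring_1"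
  using esym_diag[of "{..<m}" k a] by (simp add: esym_def)

text \<open>Each factor 1 + (x_i + a) T is regrouped as (1 + a T) + T x_i before the product is
  expanded; \<open>shift_coeff\<close> is the coefficient of T^(k-l) in (1 + a T)^(N-l).\<close>

lemma esym_shift:
  fixes x :: "nat \<Rightarrow> 'a::comm_ring_1"
  assumes "finite I"
  shows "esym I k (\<lambda>i. x i + a) = (\<Sum>l\<le>min k (card I). shift_coeff (card I) a k l * esym I l x)"
proof -
  have "esym I k (\<lambda>i. x i + a) = coeff (\<Prod>i\<in>I. [:1, a:] + [:0, 1:] * [:x i:]) k"
    by (simp add: esym_def add.commute)
  also have "(\<Prod>i\<in>I. [:1, a:] + [:0, 1:] * [:x i:]) =
      (\<Sum>l\<le>card I. [:esym I l x:] * [:0, 1:] ^ l * [:1, a:] ^ (card I - l))"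
    by (rule prod_linear_esym[where h = "\<lambda>c. [:c:]"]) (use assms in \<open>auto simp: one_pCons\<close>)
  also have "coeff \<dots> k = (\<Sum>l\<le>card I. if l \<le> k then shift_coeff (card I) a k l * esym I l x else 0)"
    unfolding coeff_sum
  proof (intro sum.cong refl)
    fix l
    have "[:esym I l x:] * [:0, 1:] ^ l * [:1, a:] ^ (card I - l) = smult (esym I l x) (monom 1 l * [:1, a:] ^ (card I - l))"
      by (simp add: monom_altdef mult.assoc)
    then show "coeff ([:esym I l x:] * [:0, 1:] ^ l * [:1, a:] ^ (card I - l)) k =
      (if l \<le> k then shift_coeff (card I) a k l * esym I l x else 0)"
      by (simp add: coeff_monom_mult coeff_linear_power_1 shift_coeff_def)
  qed
  also have "\<dots> = (\<Sum>l\<in>{l \<in> {..card I}. l \<le> k}. shift_coeff (card I) a k l * esym I l x)"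
    by (rule sum.inter_filter[symmetric]) simp
  also have "{l \<in> {..card I}. l \<le> k} = {..min k (card I)}" by auto
  finally show ?thesis .
qed

text \<open>
  The last argument is the value at \<open>(1, \<dots>, 1)\<close> of the homogeneous component of degree \<open>d\<close>.
\<close>

inductive semisym_fam :: "nat \<Rightarrow> nat \<Rightarrow> nat \<Rightarrow> ('a::field_char_0 \<Rightarrow> (nat \<Rightarrow> 'a) \<Rightarrow> 'a) \<Rightarrow> ('a \<Rightarrow> 'a) \<Rightarrow> bool" for c n where
  semisym_fam_const: "regular g \<Longrightarrow> semisym_fam c n 0 (\<lambda>r x. g r) g"
| semisym_fam_esym: "semisym_fam c n k (\<lambda>r x. esym (cls c n q) k x) (\<lambda>r. of_nat (card (cls c n q) choose k))"
| semisym_fam_add: "semisym_fam c n d F V \<Longrightarrow> semisym_fam c n d G W \<Longrightarrow> semisym_fam c n d (\<lambda>r x. F r x + G r x) (\<lambda>r. V r + W r)"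
| semisym_fam_mult: "semisym_fam c n d F V \<Longrightarrow> semisym_fam c n e G W \<Longrightarrow> semisym_fam c n (d + e) (\<lambda>r x. F r x * G r x) (\<lambda>r. V r * W r)"
| semisym_fam_Suc: "semisym_fam c n d F V \<Longrightarrow> semisym_fam c n (Suc d) F (\<lambda>r. 0)"

text \<open>The degree bound need not be attained: raising it resets the tracked value to 0. In this
  way top values are computed along a derivation and no homogeneous component is ever
  extracted.\<close>

inductive semisym :: "nat \<Rightarrow> nat \<Rightarrow> nat \<Rightarrow> ((nat \<Rightarrow> 'a::field_char_0) \<Rightarrow> 'a) \<Rightarrow> 'a \<Rightarrow> bool" for c n where
  semisym_const: "semisym c n 0 (\<lambda>x. a) a"
| semisym_esym: "semisym c n k (esym (cls c n q) k) (of_nat (card (cls c n q) choose k))"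
| semisym_add: "semisym c n d f v \<Longrightarrow> semisym c n d g w \<Longrightarrow> semisym c n d (\<lambda>x. f x + g x) (v + w)"
| semisym_mult: "semisym c n d f v \<Longrightarrow> semisym c n e g w \<Longrightarrow> semisym c n (d + e) (\<lambda>x. f x * g x) (v * w)"
| semisym_Suc: "semisym c n d f v \<Longrightarrow> semisym c n (Suc d) f 0"

section \<open>Families of semisymmetric functions with regular dependence on the parameter\<close>

lemma semisym_fam_imp_semisym: "semisym_fam c n d F V \<Longrightarrow> semisym c n d (F r) (V r)"
  by (induction rule: semisym_fam.induct) (auto intro: semisym.intros)

lemma semisym_fam_mono:
  assumes "semisym_fam c n d F V" "d \<le> e"
  shows "\<exists>W. semisym_fam c n e F W"
  using assms(2,1) by (induction e rule: dec_induct) (auto intro: semisym_fam_Suc)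

lemma semisym_fam_const_le: "regular g \<Longrightarrow> \<exists>V. semisym_fam c n d (\<lambda>r x. g r) V"
  by (rule semisym_fam_mono[OF semisym_fam_const]) auto

lemma semisym_fam_sum:
  assumes "\<And>i. i \<in> I \<Longrightarrow> \<exists>V. semisym_fam c n d (F i) V"
  shows "\<exists>V. semisym_fam c n d (\<lambda>r x. \<Sum>i\<in>I. F i r x) V"
  using assms
proof (induction I rule: infinite_finite_induct)
  case (insert i I)
  obtain V where V: "semisym_fam c n d (F i) V" using insert.prems by blast
  obtain W where W: "semisym_fam c n d (\<lambda>r x. \<Sum>i\<in>I. F i r x) W" using insert.IH insert.prems by blast
  from semisym_fam_add[OF V W] show ?case using insert.hyps by auto
qed (simp_all add: semisym_fam_const_le regular_const)

lemma semisym_fam_shift: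
  assumes "semisym_fam c n d F V" "regular a"
  shows "\<exists>W. semisym_fam c n d (\<lambda>r x. F r (\<lambda>i. x i + a r)) W"
  using assms(1)
proof (induction rule: semisym_fam.induct)
  case (semisym_fam_const g)
  then show ?case using semisym_fam.semisym_fam_const by blast
next
  case (semisym_fam_esym k q)
  let ?I = "cls c n q"
  have "\<exists>V. semisym_fam c n k (\<lambda>r x. shift_coeff (card ?I) (a r) k l * esym ?I l x) V" if "l \<le> min k (card ?I)" for l
  proof -
    have "regular (\<lambda>r. shift_coeff (card ?I) (a r) k l)"
      unfolding shift_coeff_def using assms(2) by (intro regular_mult regular_const regular_power)
    then obtain W where "semisym_fam c n (k - l) (\<lambda>r x. shift_coeff (card ?I) (a r) k l) W" using semisym_fam_const_le by blast
    from semisym_fam_mult[OF this semisym_fam.semisym_fam_esym[of c n l q]] that show ?thesis by auto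
  qed
  then have "\<exists>W. semisym_fam c n k (\<lambda>r x. \<Sum>l\<le>min k (card ?I). shift_coeff (card ?I) (a r) k l * esym ?I l x) W"
    by (intro semisym_fam_sum) simp
  then show ?case by (simp add: esym_shift)
next
  case (semisym_fam_add d F V G W)
  then show ?case using semisym_fam.semisym_fam_add by blast
next
  case (semisym_fam_mult d F V e G W)
  then show ?case using semisym_fam.semisym_fam_mult by blast
next
  case (semisym_fam_Suc d F V)
  then show ?case using semisym_fam.semisym_fam_Suc by blast
qed

text \<open>An elementary symmetric polynomial of the larger class becomes that of the smaller class
  when the additional variable is 0, so restriction to the hyperplane is surjective on such
  families.\<close>

lemma semisym_fam_lift:
  assumes "semisym_fam c n d F V"
  shows "\<exists>G W. semisym_fam c (Suc n) d G W \<and> (\<forall>r x. x (Suc n) = 0 \<longrightarrow> G r x = F r x)"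
  using assms
proof (induction rule: semisym_fam.induct)
  case (semisym_fam_const g)
  then show ?case using semisym_fam.semisym_fam_const by blast
next
  case (semisym_fam_esym k q)
  have "Suc n \<notin> cls c n q" by (simp add: cls_def)
  then have "\<forall>(r::'a) x. x (Suc n) = 0 \<longrightarrow> esym (cls c (Suc n) q) k x = esym (cls c n q) k x"
    by (simp add: cls_Suc esym_insert)
  then show ?case using semisym_fam.semisym_fam_esym by blast
next
  case (semisym_fam_add d F V G W)
  then obtain F' V' G' W' where "semisym_fam c (Suc n) d F' V'" "semisym_fam c (Suc n) d G' W'"
    "\<forall>r x. x (Suc n) = 0 \<longrightarrow> F' r x = F r x" "\<forall>r x. x (Suc n) = 0 \<longrightarrow> G' r x = G r x" by blast
  then show ?case
    by (intro exI[of _ "\<lambda>r x. F' r x + G' r x"] exI[of _ "\<lambda>r. V' r + W' r"]) (auto intro: semisym_fam.semisym_fam_add)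
next
  case (semisym_fam_mult d F V e G W)
  then obtain F' V' G' W' where "semisym_fam c (Suc n) d F' V'" "semisym_fam c (Suc n) e G' W'"
    "\<forall>r x. x (Suc n) = 0 \<longrightarrow> F' r x = F r x" "\<forall>r x. x (Suc n) = 0 \<longrightarrow> G' r x = G r x" by blast
  then show ?case
    by (intro exI[of _ "\<lambda>r x. F' r x * G' r x"] exI[of _ "\<lambda>r. V' r * W' r"]) (auto intro: semisym_fam.semisym_fam_mult)
next
  case (semisym_fam_Suc d F V)
  then show ?case using semisym_fam.semisym_fam_Suc by blast
qed

lemma semisym_fam_regular_symbol: "semisym_fam c n d F V \<Longrightarrow> regular V"
  by (induction rule: semisym_fam.induct) (auto intro: regular_const regular_add regular_mult)

lemma regular_esym:
  assumes "finite I" "\<And>i. i \<in> I \<Longrightarrow> regular (\<lambda>r. x r i)"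
  shows "regular (\<lambda>r. esym I k (x r))"
  using assms
proof (induction I arbitrary: k rule: finite_induct)
  case empty
  then show ?case by (simp add: esym_empty regular_const)
next
  case (insert i I)
  then show ?case
    by (cases "k = 0") (auto simp: esym_insert intro!: regular_add regular_mult regular_const)
qed

lemma semisym_fam_regular_value:
  assumes "semisym_fam c n d F V" "\<And>i. i \<in> {1..n} \<Longrightarrow> regular (\<lambda>r. x r i)"
  shows "regular (\<lambda>r. F r (x r))"
  using assms
proof (induction rule: semisym_fam.induct)
  case (semisym_fam_esym k q)
  then show ?case using cls_subset[of c n q] by (intro regular_esym) auto
qed (auto intro: regular_add regular_mult)

lemma semisym_fam_cong:
  assumes "semisym_fam c n d F V" "\<And>i. i \<in> {1..n} \<Longrightarrow> x i = y i"
  shows "F r x = F r y"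
  using assms
proof (induction rule: semisym_fam.induct)
  case (semisym_fam_esym k q)
  then show ?case using cls_subset[of c n q] by (intro esym_cong) auto
qed auto

text \<open>Newton interpolation. \<open>G\<close> matches the data at the partitions that end in 0;
  a multiple of the product over the class of the last index is then added. That product is 0 at
  those nodes and nonzero at all others.\<close>

lemma interpolation:
  fixes data :: "'a::field_char_0 \<Rightarrow> (nat \<Rightarrow> nat) \<Rightarrow> 'a"
  assumes c: "c = 1 \<or> c = 2"
    and "\<And>mu. mu \<in> Lam n \<Longrightarrow> regular (\<lambda>r. data r mu)"
  shows "\<exists>F V. semisym_fam c n d F V \<and>
    (\<forall>r mu. allowed r \<longrightarrow> mu \<in> Lam n \<longrightarrow> csize c n mu \<le> d \<longrightarrow> F r (node n r mu) = data r mu)"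
  using assms(2)
proof (induction n arbitrary: d data)
  case 0
  then obtain V where "semisym_fam c 0 d (\<lambda>r x. data r (\<lambda>i. 0)) V"
    using semisym_fam_const_le[of "\<lambda>r. data r (\<lambda>i. 0)" c 0 d] by (auto simp: Lam_0)
  then show ?case by (intro exI[of _ "\<lambda>r x. data r (\<lambda>i. 0)"] exI[of _ V]) (auto simp: Lam_0)
next
  case (Suc n)
  note IH_n = Suc.IH
  show ?case using Suc.prems
  proof (induction d arbitrary: data rule: less_induct)
    case (less d)
    let ?N = "Suc n"
    define J where "J = cls c ?N ?N"
    obtain F V where F: "semisym_fam c n d F V"
      "\<And>r mu. allowed r \<Longrightarrow> mu \<in> Lam n \<Longrightarrow> csize c n mu \<le> d \<Longrightarrow> F r (node n r mu) = data r mu"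
      using IH_n[of data d] less.prems Lam_Suc by blast
    obtain V1 where F1: "semisym_fam c n d (\<lambda>r x. F r (\<lambda>i. x i + - r)) V1"
      using semisym_fam_shift[OF F(1) regular_diff[OF regular_const[of 0] regular_id]] by auto
    obtain G W where G: "semisym_fam c ?N d G W" "\<And>r x. x ?N = 0 \<Longrightarrow> G r x = F r (\<lambda>i. x i + - r)"
      using semisym_fam_lift[OF F1] by blast
    have G_val: "G r (node ?N r mu) = data r mu"
      if "allowed r" "mu \<in> Lam n" "csize c n mu \<le> d" for r mu
    proof -
      have "G r (node ?N r mu) = F r (\<lambda>i. node ?N r mu i + - r)"
        using Lam_out[OF that(2), of ?N] by (intro G(2)) (simp add: node_def rho_def)
      also have "\<dots> = F r (node n r mu)"
        by (intro semisym_fam_cong[OF F(1)]) (auto simp: node_def rho_def Suc_diff_le algebra_simps)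
      finally show ?thesis using F(2)[OF that] by simp
    qed
    show ?case
    proof (cases "d < card J")
      case True
      \<comment> \<open>A partition with positive last part has size at least \<open>card J\<close>,
        so below this degree no correction is required.\<close>
      have "G r (node ?N r mu) = data r mu" if "allowed r" "mu \<in> Lam ?N" "csize c ?N mu \<le> d" for r mu
        using that(2)
      proof (cases rule: Lam_cases)
        case 1
        then show ?thesis using G_val that by (simp add: csize_Suc)
      next
        case (2 nu)
        then show ?thesis using that(3) True by (simp add: csize_add_ones[OF c] J_def)
      qed
      then show ?thesis using G(1) by blast
    next
      case False
      define q where "q r mu = (\<Prod>j\<in>J. node ?N r (add_ones ?N mu) j)" for r :: 'a and mu
      have q_nz: "q r mu \<noteq> 0" if "allowed r" for r mu
        using node_cls_nonzero[OF that] cls_subset[of c ?N ?N] by (auto simp: q_def J_def prod_zero_iff)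
      \<comment> \<open>The error left by \<open>G\<close>, divided by the value of the product that
        will multiply the correction.\<close>
      define data' where "data' r mu = (data r (add_ones ?N mu) - G r (node ?N r (add_ones ?N mu))) / q r mu" for r :: 'a and mu
      have "\<exists>H W. semisym_fam c ?N (d - card J) H W \<and> (\<forall>r mu. allowed r \<longrightarrow> mu \<in> Lam ?N \<longrightarrow>
        csize c ?N mu \<le> d - card J \<longrightarrow> H r (node ?N r mu) = data' r mu)"
      proof (rule less.IH)
        show "d - card J < d" using False card_cls_pos[of c n] by (simp add: J_def)
        fix mu assume "mu \<in> Lam ?N"
        then show "regular (\<lambda>r. data' r mu)"
          unfolding data'_def using q_nz
          by (intro regular_divide regular_diff less.prems Lam_add_ones semisym_fam_regular_value[OF G(1)] regular_node)
            (auto simp: q_def intro: regular_prod regular_node)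
      qed
      then obtain H U where H: "semisym_fam c ?N (d - card J) H U"
        "\<And>r mu. allowed r \<Longrightarrow> mu \<in> Lam ?N \<Longrightarrow> csize c ?N mu \<le> d - card J \<Longrightarrow> H r (node ?N r mu) = data' r mu"
        by blast
      obtain U1 where H1: "semisym_fam c ?N (d - card J) (\<lambda>r x. H r (\<lambda>i. x i + - 1)) U1"
        using semisym_fam_shift[OF H(1) regular_const[of "- 1"]] by auto
      define L where "L r x = G r x + esym J (card J) x * H r (\<lambda>i. x i + - 1)" for r x
      have "\<exists>V. semisym_fam c ?N d L V"
        using semisym_fam_add[OF G(1), of "\<lambda>r x. esym J (card J) x * H r (\<lambda>i. x i + - 1)"]
          semisym_fam_mult[OF semisym_fam_esym[of c ?N "card J" ?N] H1] False
        unfolding L_def[abs_def] J_def by auto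
      moreover have "L r (node ?N r mu) = data r mu" if "allowed r" "mu \<in> Lam ?N" "csize c ?N mu \<le> d" for r mu
        using that(2)
      proof (cases rule: Lam_cases)
        case 1
        have "node ?N r mu ?N = 0" using Lam_out[OF 1, of ?N] by (simp add: node_def rho_def)
        then have "esym J (card J) (node ?N r mu) = 0"
          using Suc_in_cls[of n c] by (subst esym_card) (auto simp: J_def prod_zero_iff)
        then show ?thesis using G_val 1 that by (simp add: L_def csize_Suc)
      next
        case (2 nu)
        have "esym J (card J) (node ?N r mu) = q r nu"
          unfolding 2 q_def by (subst esym_card) (auto simp: J_def)
        moreover have "H r (\<lambda>i. node ?N r mu i + - 1) = H r (node ?N r nu)"
          unfolding 2 by (rule semisym_fam_cong[OF H(1)]) (simp add: node_add_ones)
        moreover have "H r (node ?N r nu) = data' r nu"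
          using that(3) 2 by (intro H(2) that(1)) (auto simp: csize_add_ones[OF c] J_def)
        ultimately show ?thesis using q_nz[OF that(1), of nu] by (simp add: L_def data'_def 2)
      qed
      ultimately show ?thesis by blast
    qed
  qed
qed

section \<open>Semisymmetric functions and their top components\<close>

lemma semisym_zero: "semisym c n d (\<lambda>x. 0) 0"
  by (induction d) (auto intro: semisym_Suc semisym_const)

lemma semisym_mono:
  assumes "semisym c n d f v" "d < e"
  shows "semisym c n e f 0"
proof -
  obtain k where "e = Suc (d + k)" using assms(2) less_imp_Suc_add by blast
  moreover have "semisym c n (Suc (d + k)) f 0"
    by (induction k) (auto intro: semisym_Suc assms(1))
  ultimately show ?thesis by simp
qed

lemma semisym_scale: "semisym c n d f v \<Longrightarrow> semisym c n d (\<lambda>x. a * f x) (a * v)"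
  using semisym_mult[OF semisym_const[of c n a]] by simp

lemma semisym_diff: "semisym c n d f v \<Longrightarrow> semisym c n d g w \<Longrightarrow> semisym c n d (\<lambda>x. f x - g x) (v - w)"
  using semisym_add[OF _ semisym_scale[of c n d g w "- 1"], of f v] by simp

lemma semisym_sum:
  assumes "\<And>i. i \<in> I \<Longrightarrow> semisym c n d (f i) (v i)"
  shows "semisym c n d (\<lambda>x. \<Sum>i\<in>I. f i x) (\<Sum>i\<in>I. v i)"
  using assms by (induction I rule: infinite_finite_induct) (auto intro: semisym_zero semisym_add)

lemma esym_poly_fun:
  assumes "finite I" "I \<subseteq> {1..n}"
  shows "poly_fun n k (esym I k :: (nat \<Rightarrow> 'a::field_char_0) \<Rightarrow> 'a)"
  using assms
proof (induction I arbitrary: k rule: finite_induct)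
  case empty
  have "esym {} k = (\<lambda>x::nat \<Rightarrow> 'a. if k = 0 then 1 else 0)" by (rule ext) (simp add: esym_empty)
  then show ?case by (simp add: poly_fun_const)
next
  case (insert i I)
  have *: "esym (insert i I) k = (\<lambda>x::nat \<Rightarrow> 'a. esym I k x + x i * (if k = 0 then 0 else esym I (k - 1) x))"
    by (rule ext) (simp add: esym_insert insert.hyps)
  show ?case
  proof (cases k)
    case 0
    have "esym I 0 = (\<lambda>x::nat \<Rightarrow> 'a. 1)" by (rule ext) (simp add: esym_0 insert.hyps)
    then show ?thesis unfolding * using 0 by (simp add: poly_fun_const)
  next
    case (Suc m)
    have "poly_fun n (Suc m) (\<lambda>x::nat \<Rightarrow> 'a. esym I (Suc m) x + x i * esym I m x)"
      using insert by (intro poly_fun_add poly_fun_var) auto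
    then show ?thesis unfolding * using Suc by simp
  qed
qed

lemma semisym_poly_fun: "semisym c n d f v \<Longrightarrow> poly_fun n d f"
proof (induction rule: semisym.induct)
  case (semisym_esym k q)
  then show ?case using cls_subset by (intro esym_poly_fun) auto
qed (auto intro: poly_fun.intros poly_fun_mult)

lemma semisym_permute:
  assumes "semisym c n d f v" "\<And>q. bij_betw p (cls c n q) (cls c n q)"
  shows "f (x \<circ> p) = f x"
  using assms by (induction rule: semisym.induct) (auto simp: esym_permute)

lemma semisym_csym: "semisym c n d f v \<Longrightarrow> csym c n f"
  unfolding csym_def by (intro ballI impI allI semisym_permute transpose_cls) auto

text \<open>Ties the value tracked by the rules to a coefficient of the restriction to the diagonal,
  the quantity that \<open>mpoly_diag\<close> relates to the homogeneous component.\<close>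

lemma semisym_diag:
  assumes "semisym c n d f v"
  shows "\<exists>P. (\<forall>t. poly P t = f (\<lambda>i. t)) \<and> degree P \<le> d \<and> coeff P d = v"
  using assms
proof (induction rule: semisym.induct)
  case (semisym_const a)
  show ?case by (intro exI[of _ "[:a:]"]) simp
next
  case (semisym_esym k q)
  show ?case
    by (intro exI[of _ "monom (of_nat (card (cls c n q) choose k)) k"])
      (simp add: poly_monom esym_diag degree_monom_le)
next
  case (semisym_add d f v g w)
  then obtain P Q where "\<forall>t. poly P t = f (\<lambda>i. t)" "degree P \<le> d" "coeff P d = v"
    "\<forall>t. poly Q t = g (\<lambda>i. t)" "degree Q \<le> d" "coeff Q d = w" by blast
  then show ?case by (intro exI[of _ "P + Q"]) (auto intro: degree_add_le)
next
  case (semisym_mult d f v e g w)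
  then obtain P Q where *: "\<forall>t. poly P t = f (\<lambda>i. t)" "degree P \<le> d" "coeff P d = v"
    "\<forall>t. poly Q t = g (\<lambda>i. t)" "degree Q \<le> e" "coeff Q e = w" by blast
  have "degree (P * Q) \<le> d + e" using degree_mult_le[of P Q] * by linarith
  moreover have "coeff (P * Q) (d + e) = v * w"
  proof -
    have "coeff (P * Q) (d + e) = (\<Sum>i\<le>d + e. coeff P i * coeff Q (d + e - i))" by (rule coeff_mult)
    also have "\<dots> = (\<Sum>i\<in>{d}. coeff P i * coeff Q (d + e - i))"
    proof (intro sum.mono_neutral_right ballI)
      fix i assume i: "i \<in> {..d + e} - {d}"
      show "coeff P i * coeff Q (d + e - i) = 0"
      proof (cases "i < d")
        case True
        then have "degree Q < d + e - i" using * by simp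
        then show ?thesis by (simp add: coeff_eq_0)
      next
        case False
        then have "degree P < i" using i * by auto
        then show ?thesis by (simp add: coeff_eq_0)
      qed
    qed auto
    finally show ?thesis using * by simp
  qed
  ultimately show ?case using * by (intro exI[of _ "P * Q"]) simp
next
  case (semisym_Suc d f v)
  then obtain P where "\<forall>t. poly P t = f (\<lambda>i. t)" "degree P \<le> d" by blast
  then show ?case by (intro exI[of _ P]) (auto intro: coeff_eq_0)
qed

text \<open>The tracked value is a coefficient of the diagonal restriction, so two derivations for
  the same function and the same degree bound must agree on it.\<close>

lemma semisym_symbol_unique:
  assumes "semisym c n d f v" "semisym c' n' d g w" "\<And>t. f (\<lambda>i. t) = g (\<lambda>i. t)"
  shows "v = w"
proof -
  obtain P where P: "\<forall>t. poly P t = f (\<lambda>i. t)" "coeff P d = v" using semisym_diag[OF assms(1)] by blast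
  obtain Q where Q: "\<forall>t. poly Q t = g (\<lambda>i. t)" "coeff Q d = w" using semisym_diag[OF assms(2)] by blast
  have "poly (P - Q) t = 0" for t using P Q assms(3) by simp
  then have "P - Q = 0" by (intro poly_infinite_zeros)
  then show ?thesis using P Q by simp
qed

text \<open>
  Polynomials in \<open>t\<close> with semisymmetric coefficients. The last argument is the component of total
  degree \<open>d\<close> at \<open>x = (1, \<dots>, 1)\<close>, as a polynomial in \<open>t - 1\<close>.
\<close>

inductive semisym_poly :: "nat \<Rightarrow> nat \<Rightarrow> nat \<Rightarrow> ('a \<Rightarrow> (nat \<Rightarrow> 'a::field_char_0) \<Rightarrow> 'a) \<Rightarrow> 'a poly \<Rightarrow> bool" for c n where
  semisym_poly_mono: "semisym c n d f v \<Longrightarrow> semisym_poly c n (d + l) (\<lambda>t x. t ^ l * f x) (smult v ([:1, 1:] ^ l))"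
| semisym_poly_add: "semisym_poly c n d h w \<Longrightarrow> semisym_poly c n d k u \<Longrightarrow> semisym_poly c n d (\<lambda>t x. h t x + k t x) (w + u)"

lemma semisym_poly_semisym: "semisym c n d f v \<Longrightarrow> semisym_poly c n d (\<lambda>t x. f x) [:v:]"
  using semisym_poly_mono[of c n d f v 0] by simp

lemma semisym_poly_var: "semisym_poly c n 1 (\<lambda>t x. t) [:1, 1:]"
  using semisym_poly_mono[OF semisym_const[of c n 1], of 1] by simp

lemma semisym_poly_zero: "semisym_poly c n d (\<lambda>t x. 0) 0"
  using semisym_poly_semisym[OF semisym_zero[of c n d]] by simp

lemma semisym_poly_Suc: "semisym_poly c n d h w \<Longrightarrow> semisym_poly c n (Suc d) h 0"
proof (induction rule: semisym_poly.induct)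
  case (semisym_poly_mono d f v l)
  from semisym_poly.semisym_poly_mono[OF semisym_Suc[OF semisym_poly_mono], of l] show ?case by simp
next
  case (semisym_poly_add d h w k u)
  from semisym_poly.semisym_poly_add[OF semisym_poly_add.IH] show ?case by simp
qed

lemma semisym_poly_mult:
  assumes "semisym_poly c n e k u" "semisym_poly c n d h w"
  shows "semisym_poly c n (d + e) (\<lambda>t x. h t x * k t x) (w * u)"
  using assms
proof (induction arbitrary: d h w rule: semisym_poly.induct)
  case (semisym_poly_mono e g v l)
  note g = semisym_poly_mono(1)
  from semisym_poly_mono(2) show ?case
  proof (induction rule: semisym_poly.induct)
    case (semisym_poly_mono d f a m)
    from semisym_poly.semisym_poly_mono[OF semisym_mult[OF semisym_poly_mono g], of "m + l"] show ?case
      by (simp add: power_add ac_simps)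
  next
    case (semisym_poly_add d h w k u)
    from semisym_poly.semisym_poly_add[OF semisym_poly_add.IH] show ?case by (simp only: distrib_right)
  qed
next
  case (semisym_poly_add e k1 u1 k2 u2)
  from semisym_poly.semisym_poly_add[OF semisym_poly_add.IH(1)[OF semisym_poly_add.prems] semisym_poly_add.IH(2)[OF semisym_poly_add.prems]]
  show ?case by (simp add: distrib_left)
qed

lemma semisym_poly_scale: "semisym_poly c n d h w \<Longrightarrow> semisym_poly c n d (\<lambda>t x. a * h t x) (smult a w)"
  using semisym_poly_mult[OF _ semisym_poly_semisym[OF semisym_const[of c n a]], of d h w] by simp

lemma semisym_poly_sum:
  assumes "\<And>i. i \<in> I \<Longrightarrow> semisym_poly c n d (h i) (w i)"
  shows "semisym_poly c n d (\<lambda>t x. \<Sum>i\<in>I. h i t x) (\<Sum>i\<in>I. w i)"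
  using assms by (induction I rule: infinite_finite_induct) (auto intro: semisym_poly_zero semisym_poly_add)

lemma semisym_poly_power: "semisym_poly c n d h w \<Longrightarrow> semisym_poly c n (p * d) (\<lambda>t x. h t x ^ p) (w ^ p)"
proof (induction p)
  case 0
  show ?case using semisym_poly_semisym[OF semisym_const[of c n 1]] by (simp add: one_pCons)
next
  case (Suc p)
  from semisym_poly_mult[OF Suc.IH[OF Suc.prems] Suc.prems] show ?case by simp
qed

text \<open>Here \<open>d\<close> is a strict bound for the degree of \<open>h\<close>.\<close>

definition slope :: "nat \<Rightarrow> nat \<Rightarrow> nat \<Rightarrow> ('a \<Rightarrow> (nat \<Rightarrow> 'a::field_char_0) \<Rightarrow> 'a) \<Rightarrow> 'a poly \<Rightarrow> bool" where
  "slope c n d h D \<longleftrightarrow> (d = 0 \<and> h = (\<lambda>t x. 0) \<and> D = 0) \<or> (\<exists>e. d = Suc e \<and> semisym_poly c n e h D)"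

lemma slope_zero: "slope c n d (\<lambda>t x. 0) 0"
  unfolding slope_def using semisym_poly_zero[of c n] by (cases d) blast+

lemma slope_add:
  assumes "slope c n d h D" "slope c n d k E"
  shows "slope c n d (\<lambda>t x. h t x + k t x) (D + E)"
  using assms unfolding slope_def by (cases d) (auto intro: semisym_poly_add)

lemma slope_Suc:
  assumes "slope c n d h D"
  shows "slope c n (Suc d) h 0"
  using assms unfolding slope_def by (cases d) (auto intro: semisym_poly_zero semisym_poly_Suc)

lemma slope_semisym_mult:
  assumes "semisym c n d f v" "slope c n e h D"
  shows "slope c n (d + e) (\<lambda>t x. f x * h t x) (smult v D)"
proof (cases e)
  case 0
  then have "h = (\<lambda>t x. 0)" "D = 0" using assms(2) by (auto simp: slope_def)
  then show ?thesis by (simp add: slope_zero)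
next
  case (Suc a)
  then have "semisym_poly c n a h D" using assms(2) by (auto simp: slope_def)
  from semisym_poly_mult[OF this semisym_poly_semisym[OF assms(1)]] Suc show ?thesis by (simp add: slope_def)
qed

text \<open>Both factors have degree one below their bounds, so the product falls two below
  \<open>d + e\<close>, hence one below the degree that is tracked.\<close>

lemma slope_mult:
  assumes "slope c n d h D" "slope c n e k E"
  shows "slope c n (d + e) (\<lambda>t x. h t x * k t x) 0"
proof (cases "d = 0 \<or> e = 0")
  case True
  then have "(\<lambda>t x. h t x * k t x) = (\<lambda>t x. 0)" using assms by (auto simp: slope_def)
  then show ?thesis by (simp add: slope_zero)
next
  case False
  then obtain a b where ab: "d = Suc a" "e = Suc b" "semisym_poly c n a h D" "semisym_poly c n b k E"
    using assms by (auto simp: slope_def)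
  from semisym_poly_Suc[OF semisym_poly_mult[OF ab(4,3)]] ab(1,2) show ?thesis by (simp add: slope_def)
qed

text \<open>Solves the recursion of \<open>esym_insert\<close> for the smaller set. Leaving out one
  index breaks the symmetry; the formula restores symmetric coefficients at the price of powers of
  \<open>x i\<close>, which become powers of t.\<close>

lemma esym_remove:
  fixes x :: "nat \<Rightarrow> 'a::comm_ring_1"
  assumes "finite I" "i \<in> I"
  shows "esym (I - {i}) m x = (\<Sum>l\<le>m. (- 1) ^ l * (x i ^ l * esym I (m - l) x))"
proof (induction m)
  case 0
  then show ?case using assms by (simp add: esym_0)
next
  case (Suc m)
  have "esym I (Suc m) x = esym (I - {i}) (Suc m) x + x i * esym (I - {i}) m x"
    using esym_insert[of "I - {i}" i "Suc m" x] assms by (simp add: insert_absorb)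
  then have "esym (I - {i}) (Suc m) x = esym I (Suc m) x - x i * esym (I - {i}) m x" by simp
  then show ?case unfolding Suc.IH
    by (subst sum.atMost_Suc_shift) (simp add: sum_distrib_left sum_negf[symmetric] mult_ac)
qed

text \<open>
  The two shifts have difference quotients with the same top component, which links the raising and
  the lowering operator.
\<close>

lemma semisym_difference:
  assumes "semisym c n d f v"
  shows "\<exists>D. \<forall>\<delta>\<in>{1, - 1}. \<exists>h. slope c n d h D \<and>
    (\<forall>x. \<forall>i\<in>cls c n 1. f (x(i := x i + \<delta>)) = f x + \<delta> * h (x i) x)"
  using assms
proof (induction rule: semisym.induct)
  case (semisym_const a)
  show ?case by (intro exI[of _ 0] ballI exI[of _ "\<lambda>t x. 0"]) (auto simp: slope_zero)
next
  case (semisym_esym k q)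
  let ?I = "cls c n 1"
  show ?case
  proof (cases "q mod c = 1 mod c \<and> k > 0")
    case False
    have "esym (cls c n q) k (x(i := x i + \<delta>)) = esym (cls c n q) k x" if "i \<in> ?I" for x i and \<delta> :: 'a
    proof (cases "k > 0")
      case True
      then have "i \<notin> cls c n q" using False that by (auto simp: cls_def)
      then show ?thesis by (intro esym_cong) auto
    next
      case False
      then show ?thesis by (simp add: esym_0)
    qed
    then show ?thesis
      by (intro exI[of _ 0] ballI exI[of _ "\<lambda>t x. 0"]) (simp add: slope_zero del: fun_upd_apply)
  next
    case True
    then obtain m where m: "k = Suc m" by (cases k) auto
    have I: "cls c n q = ?I" using True by (simp add: cls_def)
    define h where "h t x = (\<Sum>l\<le>m. (- 1) ^ l * (t ^ l * esym ?I (m - l) x))" for t :: 'a and x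
    define D where "D = (\<Sum>l\<le>m. smult ((- 1) ^ l) (smult (of_nat (card ?I choose (m - l))) ([:1, 1:] ^ l :: 'a poly)))"
    have "semisym_poly c n m h D"
      unfolding h_def[abs_def] D_def
    proof (intro semisym_poly_sum semisym_poly_scale)
      fix l assume "l \<in> {..m}"
      then show "semisym_poly c n m (\<lambda>t x. t ^ l * esym ?I (m - l) x) (smult (of_nat (card ?I choose (m - l))) ([:1, 1:] ^ l))"
        using semisym_poly_mono[OF semisym.semisym_esym[of c n "m - l" 1], of l] by simp
    qed
    then have "slope c n k h D" by (simp add: slope_def m)
    moreover have "esym (cls c n q) k (x(i := x i + \<delta>)) = esym (cls c n q) k x + \<delta> * h (x i) x"
      if i: "i \<in> ?I" for x i and \<delta> :: 'a
    proof -
      have "esym ?I k y = esym (?I - {i}) k y + y i * esym (?I - {i}) m y" for y :: "nat \<Rightarrow> 'a"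
        using esym_insert[of "?I - {i}" i k y] i m by (simp add: insert_absorb)
      moreover have "esym (?I - {i}) j (x(i := x i + \<delta>)) = esym (?I - {i}) j x" for j
        by (intro esym_cong) auto
      moreover have "esym (?I - {i}) m x = h (x i) x"
        unfolding h_def using i by (intro esym_remove) auto
      ultimately show ?thesis unfolding I by (simp add: algebra_simps)
    qed
    ultimately show ?thesis by blast
  qed
next
  case (semisym_add d f v g w)
  then obtain D E where D: "\<forall>\<delta>\<in>{1, - 1}. \<exists>h. slope c n d h D \<and>
      (\<forall>x. \<forall>i\<in>cls c n 1. f (x(i := x i + \<delta>)) = f x + \<delta> * h (x i) x)"
    and E: "\<forall>\<delta>\<in>{1, - 1}. \<exists>h. slope c n d h E \<and>
      (\<forall>x. \<forall>i\<in>cls c n 1. g (x(i := x i + \<delta>)) = g x + \<delta> * h (x i) x)" by blast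
  show ?case
  proof (intro exI[of _ "D + E"] ballI)
    fix \<delta> :: 'a assume "\<delta> \<in> {1, - 1}"
    then obtain h k where "slope c n d h D" "slope c n d k E"
      and hk: "\<forall>x. \<forall>i\<in>cls c n 1. f (x(i := x i + \<delta>)) = f x + \<delta> * h (x i) x"
       "\<forall>x. \<forall>i\<in>cls c n 1. g (x(i := x i + \<delta>)) = g x + \<delta> * k (x i) x" using D E by meson
    then have "slope c n d (\<lambda>t x. h t x + k t x) (D + E)" by (intro slope_add)
    then show "\<exists>h. slope c n d h (D + E) \<and> (\<forall>x. \<forall>i\<in>cls c n 1.
        f (x(i := x i + \<delta>)) + g (x(i := x i + \<delta>)) = f x + g x + \<delta> * h (x i) x)"
      using hk by (intro exI[of _ "\<lambda>t x. h t x + k t x"]) (simp add: algebra_simps)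
  qed
next
  case (semisym_mult d f v e g w)
  then obtain D E where D: "\<forall>\<delta>\<in>{1, - 1}. \<exists>h. slope c n d h D \<and>
      (\<forall>x. \<forall>i\<in>cls c n 1. f (x(i := x i + \<delta>)) = f x + \<delta> * h (x i) x)"
    and E: "\<forall>\<delta>\<in>{1, - 1}. \<exists>h. slope c n e h E \<and>
      (\<forall>x. \<forall>i\<in>cls c n 1. g (x(i := x i + \<delta>)) = g x + \<delta> * h (x i) x)" by blast
  show ?case
  proof (intro exI[of _ "smult v E + smult w D"] ballI)
    fix \<delta> :: 'a assume "\<delta> \<in> {1, - 1}"
    then obtain h k where h: "slope c n d h D" and k: "slope c n e k E"
      and hk: "\<forall>x. \<forall>i\<in>cls c n 1. f (x(i := x i + \<delta>)) = f x + \<delta> * h (x i) x"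
       "\<forall>x. \<forall>i\<in>cls c n 1. g (x(i := x i + \<delta>)) = g x + \<delta> * k (x i) x" using D E by meson
    \<comment> \<open>The Leibniz rule. Only its cross term carries an explicit
      \<open>\<delta>\<close>, and by \<open>slope_mult\<close> that term is too low in degree to
      affect the top component; hence one \<open>D\<close> serves both shifts.\<close>
    let ?l = "\<lambda>t x. f x * k t x + g x * h t x + \<delta> * (h t x * k t x)"
    have "slope c n (d + e) (\<lambda>t x. g x * h t x) (smult w D)"
      using slope_semisym_mult[OF semisym_mult(2) h] by (simp add: add.commute)
    then have "slope c n (d + e) ?l (smult v E + smult w D + 0)"
      using slope_semisym_mult[OF semisym_mult(1) k] slope_semisym_mult[OF semisym_const[of c n \<delta>] slope_mult[OF h k]]
      by (intro slope_add) auto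
    then show "\<exists>h. slope c n (d + e) h (smult v E + smult w D) \<and> (\<forall>x. \<forall>i\<in>cls c n 1.
        f (x(i := x i + \<delta>)) * g (x(i := x i + \<delta>)) = f x * g x + \<delta> * h (x i) x)"
      using hk by (intro exI[of _ ?l]) (simp add: algebra_simps)
  qed
next
  case (semisym_Suc d f v)
  then obtain D where D: "\<forall>\<delta>\<in>{1, - 1}. \<exists>h. slope c n d h D \<and>
      (\<forall>x. \<forall>i\<in>cls c n 1. f (x(i := x i + \<delta>)) = f x + \<delta> * h (x i) x)" by blast
  show ?case
  proof (intro exI[of _ 0] ballI)
    fix \<delta> :: 'a assume "\<delta> \<in> {1, - 1}"
    with D obtain h where "slope c n d h D"
      and h: "\<forall>x. \<forall>i\<in>cls c n 1. f (x(i := x i + \<delta>)) = f x + \<delta> * h (x i) x" by blast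
    then have "slope c n (Suc d) h 0" by (intro slope_Suc)
    with h show "\<exists>h. slope c n (Suc d) h 0 \<and>
      (\<forall>x. \<forall>i\<in>cls c n 1. f (x(i := x i + \<delta>)) = f x + \<delta> * h (x i) x)" by blast
  qed
qed

section \<open>Lagrange sums\<close>

text \<open>The sum is the coefficient of degree \<open>card I - 1\<close> in the Lagrange
  interpolant of \<open>q\<close>, and the interpolant equals \<open>q\<close> because
  \<open>q\<close> has degree below the number of nodes.\<close>

lemma lagrange_coeff:
  fixes x :: "nat \<Rightarrow> 'a::field"
  assumes I: "finite I" and inj: "inj_on x I" and deg: "degree q < card I"
  shows "(\<Sum>i\<in>I. poly q (x i) / (\<Prod>k\<in>I - {i}. x i - x k)) = coeff q (card I - 1)"
proof -
  define w where "w i = (\<Prod>k\<in>I - {i}. x i - x k)" for i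
  define b where "b i = (\<Prod>k\<in>I - {i}. [:- x k, 1:])" for i
  define L where "L = (\<Sum>i\<in>I. smult (poly q (x i) / w i) (b i))"
  have w: "w i \<noteq> 0" if "i \<in> I" for i
    using that inj I by (auto simp: w_def prod_zero_iff inj_on_def)
  have b_val: "poly (b i) (x j) = (if i = j then w i else 0)" if "i \<in> I" "j \<in> I" for i j
  proof (cases "i = j")
    case True
    then show ?thesis by (simp add: b_def w_def poly_prod)
  next
    case False
    then show ?thesis using that I by (auto simp: b_def poly_prod prod_zero_iff)
  qed
  have b_deg: "degree (b i) = card I - 1" if "i \<in> I" for i
    unfolding b_def using I that by (subst degree_prod_eq_sum_degree) auto
  have b_coeff: "coeff (b i) (card I - 1) = 1" if "i \<in> I" for i
  proof -
    have "lead_coeff (b i) = 1" unfolding b_def lead_coeff_prod by simp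
    then show ?thesis by (simp add: b_deg[OF that])
  qed
  have pos: "card I > 0" using deg by simp
  have "q - L = 0"
  proof (rule ccontr)
    assume nz: "q - L \<noteq> 0"
    have "poly (q - L) (x j) = 0" if j: "j \<in> I" for j
    proof -
      have "poly L (x j) = (\<Sum>i\<in>I. if i = j then poly q (x j) else 0)"
        unfolding L_def poly_sum using j by (intro sum.cong) (auto simp: b_val w)
      then show ?thesis using j I by simp
    qed
    then have "x ` I \<subseteq> {t. poly (q - L) t = 0}" by auto
    then have "card (x ` I) \<le> card {t. poly (q - L) t = 0}"
      using poly_roots_finite[OF nz] by (rule card_mono[rotated])
    also have "\<dots> \<le> degree (q - L)" by (rule card_poly_roots_bound[OF nz])
    also have "\<dots> \<le> card I - 1"
    proof (rule degree_diff_le)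
      show "degree q \<le> card I - 1" using deg by simp
      show "degree L \<le> card I - 1"
        unfolding L_def by (intro degree_sum_le I order.trans[OF degree_smult_le]) (simp add: b_deg)
    qed
    finally show False using pos by (simp add: card_image[OF inj])
  qed
  then have "coeff q (card I - 1) = coeff L (card I - 1)" by simp
  also have "\<dots> = (\<Sum>i\<in>I. poly q (x i) / w i * coeff (b i) (card I - 1))"
    by (simp add: L_def coeff_sum)
  also have "\<dots> = (\<Sum>i\<in>I. poly q (x i) / w i)"
    by (intro sum.cong refl) (simp only: b_coeff mult_1_right)
  finally show ?thesis by (simp add: w_def)
qed

text \<open>Compare coefficients of v^(M-1) in v^M (1 + v)^(l-M), which is 0 there, after expanding
  v^M as ((1 + v) - 1)^M. This is the recurrence of \<open>lagrange_sum_power\<close> with all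
  variables equal to 1.\<close>

lemma choose_recurrence:
  assumes "1 \<le> M" "M \<le> l"
  shows "(\<Sum>k=1..M. (- 1) ^ (k + 1) * (of_nat (M choose k) * of_nat ((l - k) choose (M - 1)))) =
    (of_nat (l choose (M - 1)) :: 'a::comm_ring_1)"
proof -
  let ?v = "[:1, 1:] :: 'a poly"
  have "(monom 1 1 :: 'a poly) = - 1 + ?v" by (simp add: monom_altdef one_pCons)
  then have "(monom 1 1 :: 'a poly) ^ M * ?v ^ (l - M) = (\<Sum>k\<le>M. of_nat (M choose k) * (- 1) ^ k * ?v ^ (M - k)) * ?v ^ (l - M)"
    by (simp only: binomial_ring)
  also have "\<dots> = (\<Sum>k\<le>M. smult ((- 1) ^ k * of_nat (M choose k)) (?v ^ (l - k)))"
    unfolding sum_distrib_right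
  proof (intro sum.cong refl)
    fix k assume "k \<in> {..M}"
    then have "?v ^ (M - k) * ?v ^ (l - M) = ?v ^ (l - k)" using assms by (simp flip: power_add)
    moreover have "(of_nat (M choose k) * (- 1) ^ k :: 'a poly) = [:(- 1) ^ k * of_nat (M choose k):]"
      by (cases "even k") (simp_all add: of_nat_poly)
    ultimately show "of_nat (M choose k) * (- 1) ^ k * ?v ^ (M - k) * ?v ^ (l - M) =
        smult ((- 1) ^ k * of_nat (M choose k)) (?v ^ (l - k))"
      by (simp add: mult.assoc)
  qed
  finally have "coeff (monom 1 M * ?v ^ (l - M)) (M - 1) =
      (\<Sum>k\<le>M. (- 1) ^ k * of_nat (M choose k) * of_nat ((l - k) choose (M - 1)))"
    by (simp add: coeff_sum coeff_linear_power_1 monom_power)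
  moreover have "coeff (monom 1 M * ?v ^ (l - M)) (M - 1) = 0"
    using assms by (simp add: coeff_monom_mult)
  moreover have "{..M} = insert 0 {1..M}" by auto
  ultimately show ?thesis by (simp add: sum_negf mult.assoc add_eq_0_iff)
qed

definition lagrange_sum :: "nat set \<Rightarrow> (nat \<Rightarrow> 'a) \<Rightarrow> (nat \<Rightarrow> 'a::field) \<Rightarrow> 'a" where
  "lagrange_sum I f x = (\<Sum>i\<in>I. f i / (\<Prod>k\<in>I - {i}. x i - x k))"

text \<open>With M nodes, the sum is the complete homogeneous symmetric polynomial of degree l - (M
  - 1); the binomial coefficient is its number of monomials, that is, its value at (1, ...,
  1).\<close>

lemma lagrange_sum_power:
  defines "I \<equiv> \<lambda>c n. cls c n 1"
  assumes pos: "card (I c n) > 0"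
  shows "\<exists>g. semisym c n (l - (card (I c n) - 1)) g (of_nat (l choose (card (I c n) - 1))) \<and>
    (l < card (I c n) - 1 \<longrightarrow> g = (\<lambda>x. 0)) \<and>
    (\<forall>x. inj_on x (I c n) \<longrightarrow> lagrange_sum (I c n) (\<lambda>i. x i ^ l) x = (g x :: 'a::field_char_0))"
proof (induction l rule: less_induct)
  case (less l)
  define J where "J = I c n"
  define M where "M = card J"
  have J: "finite J" by (simp add: J_def I_def)
  have M: "M \<ge> 1" using pos by (simp add: M_def J_def)
  note IH = less.IH[folded J_def M_def]
  show ?case unfolding J_def[symmetric] M_def[symmetric]
  proof (cases "l < M")
    case True
    have val: "lagrange_sum J (\<lambda>i. x i ^ l) x = (if l = M - 1 then 1 else 0)" if "inj_on x J" for x :: "nat \<Rightarrow> 'a"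
    proof -
      have "degree (monom 1 l :: 'a poly) < card J" using True by (simp add: M_def degree_monom_eq)
      from lagrange_coeff[OF J that this] show ?thesis
        using M True by (auto simp: lagrange_sum_def poly_monom M_def)
    qed
    have "semisym c n (l - (M - 1)) (\<lambda>x. if l = M - 1 then 1 else 0 :: 'a) (of_nat (l choose (M - 1)))"
      using True M by (cases "l = M - 1") (auto simp: binomial_eq_0 intro: semisym_const)
    then show "\<exists>g. semisym c n (l - (M - 1)) g (of_nat (l choose (M - 1))) \<and>
      (l < M - 1 \<longrightarrow> g = (\<lambda>x. 0)) \<and> (\<forall>x. inj_on x J \<longrightarrow> lagrange_sum J (\<lambda>i. x i ^ l) x = (g x :: 'a))"
      using val by (intro exI[of _ "\<lambda>x. if l = M - 1 then 1 else 0"]) auto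
  next
    case False
    have "\<exists>G. \<forall>l'. l' < l \<longrightarrow> semisym c n (l' - (M - 1)) (G l') (of_nat (l' choose (M - 1))) \<and>
      (l' < M - 1 \<longrightarrow> G l' = (\<lambda>x. 0)) \<and>
      (\<forall>x. inj_on x J \<longrightarrow> lagrange_sum J (\<lambda>i. x i ^ l') x = (G l' x :: 'a))"
      by (rule choice) (use IH in auto)
    then obtain G where G: "\<And>l'. l' < l \<Longrightarrow> semisym c n (l' - (M - 1)) (G l') (of_nat (l' choose (M - 1)))"
      "\<And>l'. l' < l \<Longrightarrow> l' < M - 1 \<Longrightarrow> G l' = (\<lambda>x. 0)"
      "\<And>l' x. l' < l \<Longrightarrow> inj_on x J \<Longrightarrow> lagrange_sum J (\<lambda>i. x i ^ l') x = (G l' x :: 'a)" by blast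
    \<comment> \<open>The recurrence that expresses complete homogeneous polynomials through
      elementary ones, with alternating signs.\<close>
    define g where "g x = (\<Sum>k=1..M. (- 1) ^ (k + 1) * (esym J k x * G (l - k) x))" for x
    have "semisym c n (l - (M - 1)) g (\<Sum>k=1..M. (- 1) ^ (k + 1) * (of_nat (M choose k) * of_nat ((l - k) choose (M - 1))))"
      unfolding g_def[abs_def]
    proof (intro semisym_sum semisym_scale)
      fix k assume k: "k \<in> {1..M}"
      show "semisym c n (l - (M - 1)) (\<lambda>x. esym J k x * G (l - k) x) (of_nat (M choose k) * of_nat ((l - k) choose (M - 1)))"
      proof (cases "l - k < M - 1")
        case True
        moreover have "G (l - k) = (\<lambda>x. 0)" using True k False by (intro G(2)) auto
        ultimately show ?thesis using semisym_zero[of c n] by (simp add: binomial_eq_0)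
      next
        case kl: False
        have "semisym c n (k + (l - k - (M - 1))) (\<lambda>x. esym J k x * G (l - k) x) (of_nat (M choose k) * of_nat ((l - k) choose (M - 1)))"
          unfolding J_def I_def M_def using k False G(1)[of "l - k", unfolded M_def J_def I_def]
          by (intro semisym_mult semisym_esym) (auto simp: M_def J_def I_def)
        moreover have "k + (l - k - (M - 1)) = l - (M - 1)" using kl k False by auto
        ultimately show ?thesis by (simp only:)
      qed
    qed
    then have "semisym c n (l - (M - 1)) g (of_nat (l choose (M - 1)))"
      using choose_recurrence[of M l, where 'a = 'a] M False by simp
    moreover have "lagrange_sum J (\<lambda>i. x i ^ l) x = g x" if x: "inj_on x J" for x
    proof -
      have pw: "x i ^ l = (\<Sum>k=1..M. (- 1) ^ (k + 1) * (esym J k x * x i ^ (l - k)))" if i: "i \<in> J" for i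
      proof -
        \<comment> \<open>Each node is a root of the monic polynomial whose roots are all the nodes,
          so its powers satisfy a linear recurrence with coefficients
          \<open>esym J k x\<close>.\<close>
        have "0 = (\<Prod>k\<in>J. x i + - 1 * x k)" using i J by (auto simp: prod_zero_iff)
        also have "\<dots> = (\<Sum>k\<le>M. esym J k x * (- 1) ^ k * x i ^ (M - k))"
          unfolding M_def by (rule prod_linear_esym[where h = "\<lambda>u. u"]) (use J in auto)
        finally have "0 = (\<Sum>k\<le>M. esym J k x * (- 1) ^ k * x i ^ (M - k)) * x i ^ (l - M)" by simp
        also have "\<dots> = (\<Sum>k\<le>M. (- 1) ^ k * (esym J k x * x i ^ (l - k)))"
          unfolding sum_distrib_right
        proof (intro sum.cong refl)
          fix k assume "k \<in> {..M}"
          then have "x i ^ (M - k) * x i ^ (l - M) = x i ^ (l - k)" using False by (simp flip: power_add)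
          then show "esym J k x * (- 1) ^ k * x i ^ (M - k) * x i ^ (l - M) = (- 1) ^ k * (esym J k x * x i ^ (l - k))"
            by (simp add: mult_ac)
        qed
        also have "{..M} = insert 0 {1..M}" by auto
        finally show ?thesis by (simp add: esym_0 J sum_negf eq_neg_iff_add_eq_0)
      qed
      have "lagrange_sum J (\<lambda>i. x i ^ l) x = (\<Sum>i\<in>J. \<Sum>k=1..M. (- 1) ^ (k + 1) * (esym J k x * (x i ^ (l - k) / (\<Prod>k\<in>J - {i}. x i - x k))))"
        unfolding lagrange_sum_def by (intro sum.cong refl) (subst pw, auto simp: sum_divide_distrib)
      also have "\<dots> = (\<Sum>k=1..M. (- 1) ^ (k + 1) * (esym J k x * lagrange_sum J (\<lambda>i. x i ^ (l - k)) x))"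
        unfolding lagrange_sum_def sum_distrib_left by (rule sum.swap)
      also have "\<dots> = g x"
        unfolding g_def using x M False by (intro sum.cong refl) (simp add: G(3))
      finally show ?thesis .
    qed
    ultimately show "\<exists>g. semisym c n (l - (M - 1)) g (of_nat (l choose (M - 1))) \<and>
      (l < M - 1 \<longrightarrow> g = (\<lambda>x. 0)) \<and> (\<forall>x. inj_on x J \<longrightarrow> lagrange_sum J (\<lambda>i. x i ^ l) x = (g x :: 'a))"
      using False by (intro exI[of _ g]) auto
  qed
qed

lemma lagrange_sum_add: "lagrange_sum I (\<lambda>i. f i + g i) x = lagrange_sum I f x + lagrange_sum I g x"
  by (simp add: lagrange_sum_def add_divide_distrib sum.distrib)

lemma lagrange_sum_mult_right: "lagrange_sum I (\<lambda>i. f i * a) x = lagrange_sum I f x * a"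
  by (simp add: lagrange_sum_def sum_distrib_right)

text \<open>
  When all nodes are 1, the Lagrange sum turns into the coefficient of \<open>(t - 1)\<^bsup>M-1\<^esup>\<close>, where \<open>M\<close> is the
  number of nodes.
\<close>

lemma lagrange_sum_semisym_poly:
  assumes "semisym_poly c n e h w" "e = d + (card (cls c n 1) - 1)" "card (cls c n 1) > 0"
  shows "\<exists>g :: (nat \<Rightarrow> 'a::field_char_0) \<Rightarrow> 'a. semisym c n d g (coeff w (card (cls c n 1) - 1)) \<and>
    (\<forall>x. inj_on x (cls c n 1) \<longrightarrow> lagrange_sum (cls c n 1) (\<lambda>i. h (x i) x) x = g x)"
  using assms
proof (induction rule: semisym_poly.induct)
  case (semisym_poly_mono a f v l)
  let ?M = "card (cls c n 1)"
  obtain g :: "(nat \<Rightarrow> 'a) \<Rightarrow> 'a" where g: "semisym c n (l - (?M - 1)) g (of_nat (l choose (?M - 1)))"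
    "l < ?M - 1 \<longrightarrow> g = (\<lambda>x. 0)"
    "\<And>x. inj_on x (cls c n 1) \<Longrightarrow> lagrange_sum (cls c n 1) (\<lambda>i. x i ^ l) x = g x"
    using lagrange_sum_power[of c n l] semisym_poly_mono by blast
  have "semisym c n d (\<lambda>x. g x * f x) (of_nat (l choose (?M - 1)) * v)"
  proof (cases "l < ?M - 1")
    case True
    then have "g = (\<lambda>x. 0)" using g(2) by blast
    then show ?thesis unfolding binomial_eq_0[OF True] using semisym_zero[of c n d] by simp
  next
    case False
    then have "l - (?M - 1) + a = d" using semisym_poly_mono by simp
    then show ?thesis using semisym_mult[OF g(1) semisym_poly_mono(1)] by simp
  qed
  moreover have "coeff (smult v ([:1, 1:] ^ l)) (?M - 1) = of_nat (l choose (?M - 1)) * v"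
    by (simp add: coeff_linear_power_1 mult.commute)
  moreover have "lagrange_sum (cls c n 1) (\<lambda>i. x i ^ l * f x) x = g x * f x" if "inj_on x (cls c n 1)" for x
    unfolding lagrange_sum_mult_right g(3)[OF that] ..
  ultimately show ?case by (intro exI[of _ "\<lambda>x. g x * f x"]) (simp only: simp_thms, blast)
next
  case (semisym_poly_add e h w k u)
  then obtain g1 g2 where "semisym c n d g1 (coeff w (card (cls c n 1) - 1))"
    "semisym c n d g2 (coeff u (card (cls c n 1) - 1))"
    "\<And>x. inj_on x (cls c n 1) \<Longrightarrow> lagrange_sum (cls c n 1) (\<lambda>i. h (x i) x) x = g1 x"
    "\<And>x. inj_on x (cls c n 1) \<Longrightarrow> lagrange_sum (cls c n 1) (\<lambda>i. k (x i) x) x = g2 x" by blast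
  then show ?case
    by (intro exI[of _ "\<lambda>x. g1 x + g2 x"]) (auto simp: lagrange_sum_add intro: semisym_add)
qed

section \<open>Numerators of the difference operators as polynomials in t\<close>

definition next_cls :: "nat \<Rightarrow> nat \<Rightarrow> nat \<Rightarrow> nat set" where
  "next_cls c n i = {l \<in> {1..n}. l \<noteq> i \<and> l mod c = (i + 1) mod c}"

lemma semisym_poly_var_plus: "semisym_poly c n 1 (\<lambda>t x. t + a) [:1, 1:]"
proof -
  have "semisym_poly c n 1 (\<lambda>t x. a) 0" using semisym_poly_Suc[OF semisym_poly_semisym[OF semisym_const[of c n a]]] by simp
  from semisym_poly_add[OF semisym_poly_var this] show ?thesis by simp
qed

lemma semisym_poly_var_power: "semisym_poly c n p (\<lambda>t x. (t + a) ^ p) ([:1, 1:] ^ p)"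
  using semisym_poly_power[OF semisym_poly_var_plus, of c n p a] by simp

lemma semisym_poly_esym: "semisym_poly c n k (\<lambda>t x. esym (cls c n q) k x) [:of_nat (card (cls c n q) choose k):]"
  by (rule semisym_poly_semisym[OF semisym_esym])

lemma monom_1_power: "monom (1::'a::comm_ring_1) m = (\<Sum>k\<le>m. [:of_nat (m choose k):] * [:(- 1) ^ k:] * [:1, 1:] ^ (m - k))"
proof -
  have "(monom 1 1 :: 'a poly) = - 1 + [:1, 1:]" by (simp add: monom_altdef one_pCons)
  then have "(monom 1 1 :: 'a poly) ^ m = (\<Sum>k\<le>m. of_nat (m choose k) * (- 1) ^ k * [:1, 1:] ^ (m - k))"
    by (simp only: binomial_ring)
  moreover have "((- 1) ^ k :: 'a poly) = [:(- 1) ^ k:]" for k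
    by (induction k) (simp_all add: one_pCons)
  ultimately show ?thesis by (simp add: of_nat_poly monom_power)
qed

text \<open>At x = (1, ..., 1) the top component of the product is (t - 1)^m; the constant
  \<open>a\<close> enters only in lower degree.\<close>

lemma semisym_poly_prod_even:
  "semisym_poly c n (card (cls c n q)) (\<lambda>t x. \<Prod>l\<in>cls c n q. t - x l + a) (monom 1 (card (cls c n q)))"
proof -
  let ?m = "card (cls c n q)"
  have "semisym_poly c n ?m (\<lambda>t x. \<Sum>k\<le>?m. esym (cls c n q) k x * (- 1) ^ k * (t + a) ^ (?m - k))
    (\<Sum>k\<le>?m. [:of_nat (?m choose k):] * [:(- 1) ^ k:] * [:1, 1:] ^ (?m - k))"
  proof (rule semisym_poly_sum)
    fix k assume k: "k \<in> {..?m}"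
    have "semisym_poly c n (k + 0 + (?m - k)) (\<lambda>t x. esym (cls c n q) k x * (- 1) ^ k * (t + a) ^ (?m - k))
      ([:of_nat (?m choose k):] * [:(- 1) ^ k:] * [:1, 1:] ^ (?m - k))"
      by (intro semisym_poly_mult semisym_poly_esym semisym_poly_var_power semisym_poly_semisym[OF semisym_const])
    then show "semisym_poly c n ?m (\<lambda>t x. esym (cls c n q) k x * (- 1) ^ k * (t + a) ^ (?m - k))
      ([:of_nat (?m choose k):] * [:(- 1) ^ k:] * [:1, 1:] ^ (?m - k))" using k by simp
  qed
  moreover have "(\<Prod>l\<in>cls c n q. t - x l + a) = (\<Sum>k\<le>?m. esym (cls c n q) k x * (- 1) ^ k * (t + a) ^ (?m - k))" for t x
    using prod_linear_esym[where h = "\<lambda>u. u" and a = "t + a" and b = "- 1" and I = "cls c n q" and x = x]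
    by (simp add: algebra_simps)
  ultimately show ?thesis by (simp only: monom_1_power)
qed

lemma semisym_poly_quotient: "semisym_poly c n (p - 1) (\<lambda>t x. \<Sum>i<p. t ^ (p - Suc i) * (t + a) ^ i) (of_nat p * [:1, 1:] ^ (p - 1))"
proof -
  have "semisym_poly c n (p - 1) (\<lambda>t x. \<Sum>i<p. t ^ (p - Suc i) * (t + a) ^ i) (\<Sum>i<p. [:1, 1:] ^ (p - Suc i) * [:1, 1:] ^ i)"
  proof (rule semisym_poly_sum)
    fix i assume i: "i \<in> {..<p}"
    have "semisym_poly c n (p - Suc i + i) (\<lambda>t x. (t + 0) ^ (p - Suc i) * (t + a) ^ i) ([:1, 1:] ^ (p - Suc i) * [:1, 1:] ^ i)"
      by (intro semisym_poly_mult semisym_poly_var_power)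
    then show "semisym_poly c n (p - 1) (\<lambda>t x. t ^ (p - Suc i) * (t + a) ^ i) ([:1, 1:] ^ (p - Suc i) * [:1, 1:] ^ i)"
      using i by simp
  qed
  moreover have "(\<Sum>i<p. [:1, 1:] ^ (p - Suc i) * [:1, 1:] ^ i :: 'a poly) = (\<Sum>i<p. [:1, 1:] ^ (p - 1))"
    by (intro sum.cong refl) (auto simp flip: power_add)
  ultimately show ?thesis by simp
qed

text \<open>For stride 1 the product omits the index \<open>i\<close>, so it is not yet a polynomial
  in t = x_i with symmetric coefficients. The full product at shift \<open>a\<close> minus the full
  product at shift 0, which vanishes at t = x_i, equals \<open>a\<close> times the wanted one.
  Division by \<open>a\<close> gives a difference quotient whose top component is the derivative of
  (t - 1)^n; this explains the factor \<open>of_nat n\<close>.\<close>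

lemma semisym_poly_prod_all:
  fixes a :: "'a::field_char_0"
  assumes a: "a \<noteq> 0" and n: "n \<ge> 1"
  shows "\<exists>h. semisym_poly 1 n (n - 1) h (monom (of_nat n) (n - 1)) \<and>
    (\<forall>x. \<forall>i\<in>{1..n}. h (x i) x = (\<Prod>l\<in>{1..n} - {i}. x i - x l + a))"
proof -
  have cls: "cls 1 n q = {1..n}" for q by (auto simp: cls_def)
  define h where "h t x = (\<Sum>k<n. esym {1..n} k x * (- 1) ^ k * (\<Sum>i<n - k. t ^ (n - k - Suc i) * (t + a) ^ i))" for t :: 'a and x
  have "semisym_poly 1 n (n - 1) h (\<Sum>k<n. [:of_nat (n choose k):] * [:(- 1) ^ k:] * (of_nat (n - k) * [:1, 1:] ^ (n - k - 1)))"
    unfolding h_def[abs_def]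
  proof (rule semisym_poly_sum)
    fix k assume k: "k \<in> {..<n}"
    have "semisym_poly 1 n (k + 0 + (n - k - 1)) (\<lambda>t x. esym (cls 1 n 1) k x * (- 1) ^ k * (\<Sum>i<n - k. t ^ (n - k - Suc i) * (t + a) ^ i))
      ([:of_nat (card (cls 1 n 1) choose k):] * [:(- 1) ^ k:] * (of_nat (n - k) * [:1, 1:] ^ (n - k - 1)))"
      by (intro semisym_poly_mult semisym_poly_esym semisym_poly_quotient semisym_poly_semisym[OF semisym_const])
    then show "semisym_poly 1 n (n - 1) (\<lambda>t x. esym {1..n} k x * (- 1) ^ k * (\<Sum>i<n - k. t ^ (n - k - Suc i) * (t + a) ^ i))
      ([:of_nat (n choose k):] * [:(- 1) ^ k:] * (of_nat (n - k) * [:1, 1:] ^ (n - k - 1)))"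
      unfolding cls using k by simp
  qed
  also have "(\<Sum>k<n. [:of_nat (n choose k):] * [:(- 1) ^ k:] * (of_nat (n - k) * [:1, 1:] ^ (n - k - 1))) =
    of_nat n * (\<Sum>k\<le>n - 1. [:of_nat ((n - 1) choose k):] * [:(- 1) ^ k:] * [:1, 1:] ^ (n - 1 - k) :: 'a poly)"
    unfolding sum_distrib_left
  proof (rule sum.cong)
    show "{..<n} = {..n - 1}" using n by auto
    fix k assume "k \<in> {..n - 1}"
    then have "(n - k) * (n choose k) = n * ((n - 1) choose k)" using n
      by (simp add: binomial_absorb_comp)
    then have "(of_nat (n - k) * of_nat (n choose k) :: 'a poly) = of_nat n * of_nat ((n - 1) choose k)"
      by (simp only: of_nat_mult[symmetric])
    note absorb = this
    have e: "n - k - 1 = n - 1 - k" by simp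
    have "[:of_nat (n choose k):] * [:(- 1) ^ k:] * (of_nat (n - k) * [:1, 1:] ^ (n - k - 1)) =
       (of_nat (n - k) * of_nat (n choose k)) * ([:(- 1) ^ k:] * [:1, 1:] ^ (n - 1 - k) :: 'a poly)"
      unfolding e by (simp only: of_nat_poly mult_ac)
    also have "\<dots> = of_nat n * ([:of_nat ((n - 1) choose k):] * [:(- 1) ^ k:] * [:1, 1:] ^ (n - 1 - k))"
      unfolding absorb by (simp only: of_nat_poly mult.assoc)
    finally show "[:of_nat (n choose k):] * [:(- 1) ^ k:] * (of_nat (n - k) * [:1, 1:] ^ (n - k - 1)) =
       (of_nat n * ([:of_nat ((n - 1) choose k):] * [:(- 1) ^ k:] * [:1, 1:] ^ (n - 1 - k)) :: 'a poly)" .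
  qed
  also have "\<dots> = monom (of_nat n) (n - 1)"
    unfolding monom_1_power[symmetric] by (simp add: of_nat_poly smult_monom)
  finally have "semisym_poly 1 n (n - 1) h (monom (of_nat n) (n - 1))" .
  moreover have "h (x i) x = (\<Prod>l\<in>{1..n} - {i}. x i - x l + a)" if i: "i \<in> {1..n}" for x i
  proof -
    let ?p = "\<lambda>a. \<Prod>l\<in>{1..n}. x i - x l + a"
    have p: "?p b = (\<Sum>k\<le>n. esym {1..n} k x * (- 1) ^ k * (x i + b) ^ (n - k))" for b
      using prod_linear_esym[where h = "\<lambda>u. u" and a = "x i + b" and b = "- 1" and I = "{1..n}" and x = x]
      by (simp add: algebra_simps)
    have "?p a = a * (\<Prod>l\<in>{1..n} - {i}. x i - x l + a)"
      using i by (subst prod.remove[of _ i]) auto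
    moreover have "?p 0 = 0" using i by (subst prod.remove[of _ i]) auto
    ultimately have "a * (\<Prod>l\<in>{1..n} - {i}. x i - x l + a) = ?p a - ?p 0" by simp
    also have "\<dots> = (\<Sum>k\<le>n. esym {1..n} k x * (- 1) ^ k * ((x i + a) ^ (n - k) - x i ^ (n - k)))"
      unfolding p by (simp add: sum_subtractf algebra_simps)
    also have "\<dots> = (\<Sum>k<n. esym {1..n} k x * (- 1) ^ k * ((x i + a) ^ (n - k) - x i ^ (n - k)))"
      by (intro sum.mono_neutral_right) auto
    also have "\<dots> = a * h (x i) x"
      unfolding h_def sum_distrib_left power_diff_sumr2 by (intro sum.cong refl) (simp add: mult_ac sum_distrib_left)
    finally show ?thesis using a by simp
  qed
  ultimately show ?thesis by blast
qed

section \<open>Difference operators at the interpolation nodes\<close>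

text \<open>
  The numerators vanish at the node of \<open>\<mu>\<close> whenever \<open>\<mu> + \<epsilon>\<^sub>i\<close> (first definition) or \<open>\<mu> - \<epsilon>\<^sub>i\<close> (second
  definition) fails to be a partition.
\<close>

definition raise_coeff :: "nat \<Rightarrow> nat \<Rightarrow> 'a::field_char_0 \<Rightarrow> (nat \<Rightarrow> 'a) \<Rightarrow> nat \<Rightarrow> 'a" where
  "raise_coeff c n r x i = (\<Prod>l\<in>next_cls c n i. x i - x l + r) / (\<Prod>k\<in>cls c n 1 - {i}. x i - x k)"

definition lower_coeff :: "nat \<Rightarrow> nat \<Rightarrow> 'a::field_char_0 \<Rightarrow> (nat \<Rightarrow> 'a) \<Rightarrow> nat \<Rightarrow> 'a" where
  "lower_coeff c n r x i = (if n mod c = 1 mod c then x i else 1) * (\<Prod>l\<in>next_cls c n i. x i - x l - r) /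
     (\<Prod>k\<in>cls c n 1 - {i}. x i - x k)"

lemma next_cls_1: "next_cls 1 n i = {1..n} - {i}"
  by (auto simp: next_cls_def)

lemma next_cls_2: "i \<in> cls 2 n 1 \<Longrightarrow> next_cls 2 n i = cls 2 n 0"
  by (auto simp: next_cls_def cls_def mod2_eq_if)

lemma cls_1: "cls 1 n q = {1..n}"
  by (auto simp: cls_def)

lemma card_cls_2: "card (cls 2 n 1) = card (cls 2 n 0) + n mod 2"
proof (induction n)
  case (Suc n)
  have "Suc n \<notin> cls 2 n q" for q by (simp add: cls_def)
  then show ?case using Suc by (auto simp: cls_Suc mod2_eq_if)
qed simp

text \<open>For strides 1 and 2 this is the number of factors in the product over
  \<open>next_cls c n i\<close> for \<open>i\<close> in the class of 1: all indices but
  \<open>i\<close>, respectively the even indices.\<close>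

definition top_deg :: "nat \<Rightarrow> nat \<Rightarrow> nat" where
  "top_deg c n = (if n mod c = 1 mod c then card (cls c n 1) - 1 else card (cls c n 1))"

lemma card_cls_1_pos: "n \<ge> 1 \<Longrightarrow> card (cls c n 1) > 0"
  by (auto simp: card_gt_0_iff cls_def)

lemma semisym_poly_next_cls:
  fixes a :: "'a::field_char_0"
  assumes c: "c = 1 \<or> c = 2" and n: "n \<ge> 1" and a: "a \<noteq> 0"
  shows "\<exists>h. semisym_poly c n (top_deg c n) h (monom (if c = 1 then of_nat n else 1) (top_deg c n)) \<and>
    (\<forall>x. \<forall>i\<in>cls c n 1. h (x i) x = (\<Prod>l\<in>next_cls c n i. x i - x l + a))"
proof (cases "c = 1")
  case True
  then show ?thesis using semisym_poly_prod_all[OF a n] by (simp add: cls_1[unfolded One_nat_def] top_deg_def next_cls_1[unfolded One_nat_def])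
next
  case False
  then have "c = 2" using c by simp
  moreover have "card (cls 2 n 0) = top_deg 2 n"
    using card_cls_2[of n] by (auto simp: top_deg_def mod2_eq_if)
  ultimately show ?thesis using semisym_poly_prod_even[of 2 n 0 a]
    by (intro exI[of _ "\<lambda>t x. \<Prod>l\<in>cls 2 n 0. t - x l + a"]) (auto simp: next_cls_2)
qed

text \<open>The factor \<open>x i\<close> is present exactly when the product over
  \<open>next_cls\<close> has only M - 1 factors, so the numerator always has degree M. After the
  division by M - 1 differences one degree remains, which repays the degree lost in the difference
  quotient.\<close>

lemma semisym_poly_lower_coeff:
  fixes r :: "'a::field_char_0"
  assumes c: "c = 1 \<or> c = 2" and n: "n \<ge> 1" and r: "r \<noteq> 0"
  defines "M \<equiv> card (cls c n 1)"
  shows "\<exists>h. semisym_poly c n M h (if n mod c = 1 mod c then monom (if c = 1 then of_nat n else 1) (M - 1) * [:1, 1:] else monom 1 M) \<and>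
    (\<forall>x. \<forall>i\<in>cls c n 1. h (x i) x = (if n mod c = 1 mod c then x i else 1) * (\<Prod>l\<in>next_cls c n i. x i - x l - r))"
proof -
  have M: "M > 0" unfolding M_def using card_cls_1_pos[OF n] .
  obtain h where h: "semisym_poly c n (top_deg c n) h (monom (if c = 1 then of_nat n else 1) (top_deg c n))"
    "\<And>x i. i \<in> cls c n 1 \<Longrightarrow> h (x i) x = (\<Prod>l\<in>next_cls c n i. x i - x l + - r)"
    using semisym_poly_next_cls[OF c n, of "- r"] r by (metis neg_equal_0_iff_equal)
  show ?thesis
  proof (cases "n mod c = 1 mod c")
    case True
    have "semisym_poly c n (Suc (M - 1)) (\<lambda>t x. h t x * t) (monom (if c = 1 then of_nat n else 1) (M - 1) * [:1, 1:])"
      using semisym_poly_mult[OF semisym_poly_var h(1)] True by (simp add: top_deg_def M_def)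
    then show ?thesis using True M h(2)
      by (intro exI[of _ "\<lambda>t x. h t x * t"]) (simp add: mult.commute)
  next
    case False
    then have "c = 2" using c by auto
    then show ?thesis using False h by (intro exI[of _ h]) (simp add: top_deg_def M_def)
  qed
qed

lemma operators:
  fixes r :: "'a::field_char_0"
  assumes c: "c = 1 \<or> c = 2" and n: "n \<ge> 1" "n mod c = 1 mod c" and r: "r \<noteq> 0"
    and f: "semisym c n (Suc d) f v"
  shows "\<exists>gU gX s. semisym c n d gU s \<and> semisym c n (Suc d) gX s \<and> (\<forall>x. inj_on x (cls c n 1) \<longrightarrow>
    gU x = (\<Sum>i\<in>cls c n 1. raise_coeff c n r x i * (f (x(i := x i + 1)) - f x)) \<and>
    gX x = (\<Sum>i\<in>cls c n 1. lower_coeff c n r x i * (f x - f (x(i := x i - 1)))))"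
proof -
  define M where "M = card (cls c n 1)"
  define C where "C = (if c = 1 then of_nat n else 1 :: 'a)"
  have M: "M > 0" unfolding M_def using card_cls_1_pos[OF n(1)] .
  obtain D where D: "\<forall>\<delta>\<in>{1, - 1}. \<exists>h. slope c n (Suc d) h D \<and>
    (\<forall>x. \<forall>i\<in>cls c n 1. f (x(i := x i + \<delta>)) = f x + \<delta> * h (x i) x)"
    using semisym_difference[OF f] by blast
  obtain h where h: "semisym_poly c n d h D" "\<And>x i. i \<in> cls c n 1 \<Longrightarrow> f (x(i := x i + 1)) = f x + 1 * h (x i) x"
    using bspec[OF D, of 1] by (auto simp: slope_def simp del: fun_upd_apply)
  obtain k where k: "semisym_poly c n d k D" "\<And>x i. i \<in> cls c n 1 \<Longrightarrow> f (x(i := x i + - 1)) = f x + - 1 * k (x i) x"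
    using bspec[OF D, of "- 1"] by (auto simp: slope_def simp del: fun_upd_apply)
  obtain p where p: "semisym_poly c n (M - 1) p (monom C (M - 1))"
    "\<And>x i. i \<in> cls c n 1 \<Longrightarrow> p (x i) x = (\<Prod>l\<in>next_cls c n i. x i - x l + r)"
    using semisym_poly_next_cls[OF c n(1) r] n(2) by (auto simp: top_deg_def M_def C_def)
  obtain q where q: "semisym_poly c n M q (monom C (M - 1) * [:1, 1:])"
    "\<And>x i. i \<in> cls c n 1 \<Longrightarrow> q (x i) x = x i * (\<Prod>l\<in>next_cls c n i. x i - x l - r)"
    using semisym_poly_lower_coeff[OF c n(1) r] n(2) by (auto simp: M_def C_def)
  obtain gU where gU: "semisym c n d gU (coeff (D * monom C (M - 1)) (M - 1))"
    "\<And>x. inj_on x (cls c n 1) \<Longrightarrow> lagrange_sum (cls c n 1) (\<lambda>i. h (x i) x * p (x i) x) x = gU x"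
    using lagrange_sum_semisym_poly[OF semisym_poly_mult[OF p(1) h(1)], of d] M unfolding M_def by auto
  obtain gX where gX: "semisym c n (Suc d) gX (coeff (D * (monom C (M - 1) * [:1, 1:])) (M - 1))"
    "\<And>x. inj_on x (cls c n 1) \<Longrightarrow> lagrange_sum (cls c n 1) (\<lambda>i. k (x i) x * q (x i) x) x = gX x"
    using lagrange_sum_semisym_poly[OF semisym_poly_mult[OF q(1) k(1)], of "Suc d"] M unfolding M_def by auto
  \<comment> \<open>The numerator already contributes (t - 1)^(M-1), so only the value of
    \<open>D\<close> at t = 1 counts.\<close>
  have sU: "coeff (D * monom C (M - 1)) (M - 1) = C * coeff D 0"
    by (subst mult.commute) (simp add: coeff_monom_mult)
  \<comment> \<open>The additional factor t = 1 + (t - 1) takes the value 1 at t = 1, so the result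
    is the same as for the other operator.\<close>
  have sX: "coeff (D * (monom C (M - 1) * [:1, 1:])) (M - 1) = C * coeff D 0"
  proof -
    have "D * (monom C (M - 1) * [:1, 1:]) = monom C (M - 1) * (D * [:1, 1:])" by (simp only: mult_ac)
    then show ?thesis by (simp only: coeff_monom_mult) (simp add: coeff_mult)
  qed
  have eU: "gU x = (\<Sum>i\<in>cls c n 1. raise_coeff c n r x i * (f (x(i := x i + 1)) - f x))"
    if "inj_on x (cls c n 1)" for x
    unfolding gU(2)[OF that, symmetric] lagrange_sum_def raise_coeff_def by (intro sum.cong refl) (simp add: h(2) p(2) del: fun_upd_apply)
  have eX: "gX x = (\<Sum>i\<in>cls c n 1. lower_coeff c n r x i * (f x - f (x(i := x i - 1))))"
    if "inj_on x (cls c n 1)" for x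
    unfolding gX(2)[OF that, symmetric] lagrange_sum_def lower_coeff_def
    by (intro sum.cong refl) (use k(2) q(2) n(2) in \<open>simp del: fun_upd_apply\<close>)
  show ?thesis
    using gU(1) gX(1) eU eX unfolding sU sX
    by (intro exI[of _ gU] exI[of _ gX] exI[of _ "C * coeff D 0"]) (simp del: fun_upd_apply)
qed

text \<open>For even \<open>n\<close> there are as many even as odd indices, so the numerator
  contributes (t - 1)^M and no multiple of it has a term of degree M - 1.\<close>

lemma operator_even:
  fixes r :: "'a::field_char_0"
  assumes n: "n \<ge> 1" "even n" and r: "r \<noteq> 0" and f: "semisym 2 n d f v"
  shows "\<exists>g. semisym 2 n d g 0 \<and> (\<forall>x. inj_on x (cls 2 n 1) \<longrightarrow>
    g x = (\<Sum>i\<in>cls 2 n 1. lower_coeff 2 n r x i * (f x - f (x(i := x i - 1)))))"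
proof -
  have c: "(2::nat) = 1 \<or> (2::nat) = 2" by simp
  define M where "M = card (cls 2 n 1)"
  have M: "M > 0" unfolding M_def using card_cls_1_pos[OF n(1)] .
  obtain D k where k: "slope 2 n d k D" "\<And>x i. i \<in> cls 2 n 1 \<Longrightarrow> f (x(i := x i + - 1)) = f x + - 1 * k (x i) x"
    using semisym_difference[OF f] by blast
  have nm: "n mod 2 \<noteq> 1 mod 2" using n(2) by (simp add: mod2_eq_if)
  obtain q where q: "semisym_poly 2 n M q (monom 1 M)"
    "\<And>x i. i \<in> cls 2 n 1 \<Longrightarrow> q (x i) x = (\<Prod>l\<in>next_cls 2 n i. x i - x l - r)"
    using semisym_poly_lower_coeff[OF c n(1) r] nm by (auto simp: M_def)
  have eq: "lagrange_sum (cls 2 n 1) (\<lambda>i. k (x i) x * q (x i) x) x = (\<Sum>i\<in>cls 2 n 1. lower_coeff 2 n r x i * (f x - f (x(i := x i - 1))))" for x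
    unfolding lagrange_sum_def lower_coeff_def
    by (intro sum.cong refl) (use k(2) q(2) nm in \<open>simp del: fun_upd_apply\<close>)
  show ?thesis
  proof (cases d)
    case 0
    then have "k = (\<lambda>t x. 0)" using k(1) by (auto simp: slope_def)
    then have "0 = lagrange_sum (cls 2 n 1) (\<lambda>i. k (x i) x * q (x i) x) x" for x by (simp add: lagrange_sum_def)
    then show ?thesis unfolding eq by (intro exI[of _ "\<lambda>x. 0"]) (auto intro: semisym_zero)
  next
    case (Suc e)
    then have "semisym_poly 2 n e k D" using k(1) by (auto simp: slope_def)
    from lagrange_sum_semisym_poly[OF semisym_poly_mult[OF q(1) this], of d] obtain g
      where g: "semisym 2 n d g (coeff (D * monom 1 M) (M - 1))"
       "\<And>x. inj_on x (cls 2 n 1) \<Longrightarrow> lagrange_sum (cls 2 n 1) (\<lambda>i. k (x i) x * q (x i) x) x = g x"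
      using M Suc unfolding M_def by auto
    have "coeff (D * monom 1 M) (M - 1) = 0"
      using M by (subst mult.commute) (simp add: coeff_monom_mult)
    then show ?thesis using g eq by (intro exI[of _ g]) auto
  qed
qed

lemma sum_lower_coeff_semisym:
  fixes r :: "'a::field_char_0"
  assumes c: "c = 1 \<or> c = 2" and n: "n \<ge> 1" and r: "r \<noteq> 0"
  shows "\<exists>g s. semisym c n 1 g s \<and> (\<forall>x. inj_on x (cls c n 1) \<longrightarrow> g x = (\<Sum>i\<in>cls c n 1. lower_coeff c n r x i))"
proof -
  have M: "card (cls c n 1) > 0" using card_cls_1_pos[OF n] .
  obtain h w where h: "semisym_poly c n (card (cls c n 1)) h w"
    "\<And>x i. i \<in> cls c n 1 \<Longrightarrow> h (x i) x = (if n mod c = 1 mod c then x i else 1) * (\<Prod>l\<in>next_cls c n i. x i - x l - r)"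
    using semisym_poly_lower_coeff[OF c n r] by blast
  obtain g where "semisym c n 1 g (coeff w (card (cls c n 1) - 1))"
    "\<And>x. inj_on x (cls c n 1) \<Longrightarrow> lagrange_sum (cls c n 1) (\<lambda>i. h (x i) x) x = g x"
    using lagrange_sum_semisym_poly[OF h(1), of 1] M by auto
  moreover have "lagrange_sum (cls c n 1) (\<lambda>i. h (x i) x) x = (\<Sum>i\<in>cls c n 1. lower_coeff c n r x i)" for x
    unfolding lagrange_sum_def lower_coeff_def by (intro sum.cong refl) (simp add: h(2))
  ultimately show ?thesis by metis
qed

section \<open>Nodes of partitions when a box is added or removed\<close>

lemma Lam_le:
  assumes "mu \<in> Lam n" "1 \<le> i" "i \<le> k"
  shows "mu k \<le> mu i"
  using assms Lam_out[OF assms(1), of k] by (cases "k \<le> n") (auto simp: Lam_def)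

lemma node_diff:
  assumes "mu \<in> Lam n" "1 \<le> i" "i \<le> k" "k \<le> n"
  shows "node n r mu i - node n r mu k = of_nat (k - i) * r + of_nat (mu i - mu k)"
proof -
  have "n - i = (n - k) + (k - i)" using assms by simp
  then have "rho n r i = rho n r k + of_nat (k - i) * r"
    unfolding rho_def by (simp only: of_nat_add distrib_right)
  moreover have "(of_nat (mu i) :: 'a) = of_nat (mu k) + of_nat (mu i - mu k)"
    using Lam_le[OF assms(1-3)] by (simp flip: of_nat_add)
  ultimately show ?thesis by (simp add: node_def)
qed

text \<open>For distinct indices the difference is k r + m with k > 0 and m a natural number. At r =
  0 equal parts would give equal coordinates and a pole in the Lagrange sums.\<close>

lemma node_inj:
  assumes r: "allowed r" "r \<noteq> 0" and mu: "mu \<in> Lam n"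
  shows "inj_on (node n r mu) (cls c n q)"
proof -
  have "node n r mu i \<noteq> node n r mu k" if "1 \<le> i" "i < k" "k \<le> n" for i k
  proof -
    have "of_nat (k - i) * r + of_nat (mu i - mu k) \<noteq> 0"
      using allowed_nonzero[OF r(1), of "mu i - mu k" "k - i"] r(2) that by (cases "mu i - mu k = 0") auto
    then show ?thesis using node_diff[OF mu, of i k r] that by auto
  qed
  then show ?thesis
    by (intro linorder_inj_onI) (auto simp: cls_def)
qed

definition remove_box :: "(nat \<Rightarrow> nat) \<Rightarrow> nat \<Rightarrow> nat \<Rightarrow> nat" where
  "remove_box mu i = mu(i := mu i - 1)"

lemma Lam_remove_box:
  assumes "mu \<in> Lam n" "i \<in> {1..n}" "mu (Suc i) < mu i"
  shows "remove_box mu i \<in> Lam n"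
  unfolding Lam_def mem_Collect_eq
proof (intro conjI allI impI ballI)
  fix j assume "j \<notin> {1..n}"
  then show "remove_box mu i j = 0" using assms by (auto simp: remove_box_def Lam_def)
next
  fix j k assume "j \<in> {1..n}" "k \<in> {1..n}" "j \<le> k"
  then show "remove_box mu i k \<le> remove_box mu i j"
    using assms Lam_le[OF assms(1), of j k] Lam_le[OF assms(1), of "Suc i" k] by (auto simp: remove_box_def)
qed

lemma Lam_inc:
  assumes "mu \<in> Lam n" "i \<in> {1..n}" "i = 1 \<or> mu i < mu (i - 1)"
  shows "mu(i := mu i + 1) \<in> Lam n"
  unfolding Lam_def mem_Collect_eq
proof (intro conjI allI impI ballI)
  fix j assume "j \<notin> {1..n}"
  then show "(mu(i := mu i + 1)) j = 0" using assms by (auto simp: Lam_def)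
next
  fix j k assume jk: "j \<in> {1..n}" "k \<in> {1..n}" "j \<le> k"
  have "mu i + 1 \<le> mu j" if "k = i" "j \<noteq> i"
  proof -
    have "j \<le> i - 1" "i \<noteq> 1" using jk that by auto
    then show ?thesis using Lam_le[OF assms(1), of j "i - 1"] jk assms(3) by auto
  qed
  then show "(mu(i := mu i + 1)) k \<le> (mu(i := mu i + 1)) j"
    using Lam_le[OF assms(1), of j k] jk by auto
qed

lemma node_remove_box: "mu i > 0 \<Longrightarrow> node n r (remove_box mu i) = (node n r mu)(i := node n r mu i - 1)"
  by (auto simp: node_def remove_box_def of_nat_diff)

lemma node_inc: "node n r (mu(i := mu i + 1)) = (node n r mu)(i := node n r mu i + 1)"
  by (auto simp: node_def)

lemma csize_inc:
  assumes "i \<in> cls c n 1"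
  shows "csize c n (mu(i := mu i + 1)) = Suc (csize c n mu)"
  unfolding csize_def using assms by (simp add: sum.remove[of _ i])

lemma remove_box_inc: "mu i > 0 \<Longrightarrow> (remove_box mu i)(i := remove_box mu i i + 1) = mu"
  by (auto simp: remove_box_def)

lemma csize_remove_box:
  assumes "i \<in> cls c n 1" "mu i > 0"
  shows "csize c n mu = Suc (csize c n (remove_box mu i))"
  using csize_inc[OF assms(1), of "remove_box mu i"] remove_box_inc[of mu i] assms(2) by simp

text \<open>If rows \<open>i\<close> and \<open>Suc i\<close> are equal, the factor for l =
  \<open>Suc i\<close> vanishes. The last row has no successor; if it lies in the class of 1, the
  extra factor \<open>x i\<close> takes over, being equal to the last part at a node.\<close>

lemma lower_coeff_zero:
  assumes c: "c = 1 \<or> c = 2" and mu: "mu \<in> Lam n" and i: "i \<in> cls c n 1" and eq: "\<not> mu (Suc i) < mu i"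
  shows "lower_coeff c n r (node n r mu) i = 0"
proof (cases "i = n")
  case True
  then have "mu i = 0" using eq Lam_out[OF mu, of "Suc i"] by simp
  then have "node n r mu i = 0" using True by (simp add: node_def rho_def)
  then show ?thesis using i True by (simp add: lower_coeff_def cls_def)
next
  case False
  then have i': "1 \<le> i" "Suc i \<le> n" using i by (auto simp: cls_def)
  have "mu i = mu (Suc i)" using eq Lam_le[OF mu, of i "Suc i"] i' by simp
  then have "node n r mu i - node n r mu (Suc i) - r = 0"
    using node_diff[OF mu, of i "Suc i" r] i' by simp
  moreover have "Suc i \<in> next_cls c n i" using i' by (simp add: next_cls_def)
  moreover have "finite (next_cls c n i)" by (simp add: next_cls_def)
  ultimately have "(\<Prod>l\<in>next_cls c n i. node n r mu i - node n r mu l - r) = 0" by (auto simp: prod_zero_iff)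
  then show ?thesis by (simp add: lower_coeff_def)
qed

text \<open>If rows \<open>i - 1\<close> and \<open>i\<close> are equal, the factor for l =
  \<open>i - 1\<close> vanishes.\<close>

lemma raise_coeff_zero:
  assumes c: "c = 1 \<or> c = 2" and mu: "mu \<in> Lam n" and i: "i \<in> cls c n 1" and eq: "\<not> (i = 1 \<or> mu i < mu (i - 1))"
  shows "raise_coeff c n r (node n r mu) i = 0"
proof -
  have i': "1 \<le> i - 1" "i \<le> n" "i \<ge> 1" using i eq by (auto simp: cls_def)
  have "mu i = mu (i - 1)" using eq Lam_le[OF mu, of "i - 1" i] i' by simp
  then have "node n r mu i - node n r mu (i - 1) + r = 0"
    using node_diff[OF mu, of "i - 1" i r] i' by (simp add: algebra_simps)
  moreover have "i - 1 \<in> next_cls c n i"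
  proof -
    obtain j where "i = Suc j" using i' by (cases i) auto
    then show ?thesis using i' c by (auto simp: next_cls_def mod2_eq_if)
  qed
  moreover have "finite (next_cls c n i)" by (simp add: next_cls_def)
  ultimately have "(\<Prod>l\<in>next_cls c n i. node n r mu i - node n r mu l + r) = 0" by (auto simp: prod_zero_iff)
  then show ?thesis by (simp add: raise_coeff_def)
qed

section \<open>Interpolation functions and the action of the two operators on them\<close>

lemma semisym_vanish_unique:
  assumes c: "c = 1 \<or> c = 2" and r: "allowed r"
    and "semisym c n d f v" "semisym c n d g w"
    and "\<And>mu. mu \<in> Lam n \<Longrightarrow> csize c n mu \<le> d \<Longrightarrow> f (node n r mu) = g (node n r mu)"
  shows "f = g"
proof
  fix x
  have *: "semisym c n d (\<lambda>x. f x - g x) (v - w)" by (rule semisym_diff[OF assms(3,4)])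
  have "f x - g x = 0"
    by (rule csym_vanish_imp_zero[OF c r semisym_poly_fun[OF *] semisym_csym[OF *]]) (simp add: assms(5))
  then show "f x = g x" by simp
qed

definition delta_fun :: "nat \<Rightarrow> nat \<Rightarrow> 'a::field_char_0 \<Rightarrow> (nat \<Rightarrow> nat) \<Rightarrow> ((nat \<Rightarrow> 'a) \<Rightarrow> 'a) \<Rightarrow> 'a \<Rightarrow> bool" where
  "delta_fun c n r lam f v \<longleftrightarrow> semisym c n (csize c n lam) f v \<and>
    (\<forall>mu\<in>Lam n. csize c n mu \<le> csize c n lam \<longrightarrow> f (node n r mu) = (if mu = lam then 1 else 0))"

lemma delta_fun_exists:
  assumes "c = 1 \<or> c = 2" "allowed r"
  shows "\<exists>f v. delta_fun c n r lam f v"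
proof -
  obtain F V where "semisym_fam c n (csize c n lam) F V" "\<forall>(r::'a) mu. allowed r \<longrightarrow> mu \<in> Lam n \<longrightarrow>
     csize c n mu \<le> csize c n lam \<longrightarrow> F r (node n r mu) = (if mu = lam then 1 else 0)"
    using interpolation[OF assms(1), of n "\<lambda>(r::'a) mu. if mu = lam then 1 else 0" "csize c n lam"] regular_const by blast
  then show ?thesis unfolding delta_fun_def
    by (intro exI[of _ "F r"] exI[of _ "V r"]) (simp add: semisym_fam_imp_semisym assms(2))
qed

text \<open>At a node of size at most |lam|, every shifted node with nonzero coefficient belongs to
  a strictly smaller partition, where \<open>f\<close> is 0. Only the diagonal term survives, and
  uniqueness of interpolation does the rest.\<close>

lemma delta_fun_eigen:
  assumes c: "c = 1 \<or> c = 2" and r: "allowed r" "r \<noteq> 0" and lam: "lam \<in> Lam n"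
    and f: "delta_fun c n r lam f v"
    and g: "semisym c n (csize c n lam) g s"
      "\<And>x. inj_on x (cls c n 1) \<Longrightarrow> g x = (\<Sum>i\<in>cls c n 1. lower_coeff c n r x i * (f x - f (x(i := x i - 1))))"
  shows "s = (\<Sum>i\<in>cls c n 1. lower_coeff c n r (node n r lam) i) * v"
proof -
  let ?W = "\<Sum>i\<in>cls c n 1. lower_coeff c n r (node n r lam) i"
  have semisym: "semisym c n (csize c n lam) (\<lambda>x. ?W * f x) (?W * v)"
    using f by (intro semisym_scale) (simp add: delta_fun_def)
  have "g = (\<lambda>x. ?W * f x)"
  proof (rule semisym_vanish_unique[OF c r(1) g(1) semisym])
    fix mu assume mu: "mu \<in> Lam n" "csize c n mu \<le> csize c n lam"
    have "lower_coeff c n r (node n r mu) i * f ((node n r mu)(i := node n r mu i - 1)) = 0" if i: "i \<in> cls c n 1" for i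
    proof (cases "mu (Suc i) < mu i")
      case True
      then have pos: "mu i > 0" by simp
      have "remove_box mu i \<in> Lam n" using mu(1) i True by (intro Lam_remove_box) (auto simp: cls_def)
      moreover have "csize c n (remove_box mu i) < csize c n lam" using csize_remove_box[where mu = mu, OF i pos] mu(2) by simp
      ultimately have "f (node n r (remove_box mu i)) = 0" using f by (auto simp: delta_fun_def)
      then show ?thesis using node_remove_box[where mu = mu, OF pos, of n r] by simp
    next
      case False
      then show ?thesis using lower_coeff_zero[where r = r, OF c mu(1) i False] by (simp only: mult_zero_left)
    qed
    then have "(\<Sum>i\<in>cls c n 1. lower_coeff c n r (node n r mu) i * f ((node n r mu)(i := node n r mu i - 1))) = 0"
      by (intro sum.neutral ballI)
    then have "g (node n r mu) = (\<Sum>i\<in>cls c n 1. lower_coeff c n r (node n r mu) i) * f (node n r mu)"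
      unfolding g(2)[OF node_inj[OF r mu(1)]] by (simp add: right_diff_distrib sum_subtractf sum_distrib_right)
    then show "g (node n r mu) = ?W * f (node n r mu)"
      using f mu by (cases "mu = lam") (auto simp: delta_fun_def)
  qed
  then show ?thesis using semisym_symbol_unique[OF g(1) semisym] by simp
qed

text \<open>At a node of size at most |lam| - 1, \<open>F lam\<close> is 0 and it is 1 at a shifted
  node exactly when the added box produces \<open>lam\<close>. This gives the values of the image at
  all nodes needed to determine it.\<close>

lemma delta_fun_lower:
  assumes c: "c = 1 \<or> c = 2" and r: "allowed r" "r \<noteq> 0" and lam: "lam \<in> Lam n" "csize c n lam = Suc d"
    and f: "\<And>nu. nu \<in> Lam n \<Longrightarrow> delta_fun c n r nu (F nu) (V nu)"
    and g: "semisym c n d g s"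
      "\<And>x. inj_on x (cls c n 1) \<Longrightarrow> g x = (\<Sum>i\<in>cls c n 1. raise_coeff c n r x i * (F lam (x(i := x i + 1)) - F lam x))"
  shows "s = (\<Sum>i\<in>{i\<in>cls c n 1. lam (Suc i) < lam i}. raise_coeff c n r (node n r (remove_box lam i)) i * V (remove_box lam i))"
proof -
  let ?S = "{i\<in>cls c n 1. lam (Suc i) < lam i}"
  have remove_box_Lam: "remove_box lam i \<in> Lam n" "csize c n (remove_box lam i) = d" if "i \<in> ?S" for i
  proof -
    show "remove_box lam i \<in> Lam n" using that lam(1) by (intro Lam_remove_box) (auto simp: cls_def)
    show "csize c n (remove_box lam i) = d" using that csize_remove_box[of i c n lam] lam(2) by auto
  qed
  let ?G = "\<lambda>x. \<Sum>i\<in>?S. raise_coeff c n r (node n r (remove_box lam i)) i * F (remove_box lam i) x"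
  have semisym: "semisym c n d ?G (\<Sum>i\<in>?S. raise_coeff c n r (node n r (remove_box lam i)) i * V (remove_box lam i))"
  proof (intro semisym_sum semisym_scale)
    fix i assume "i \<in> ?S"
    then show "semisym c n d (F (remove_box lam i)) (V (remove_box lam i))"
      using f[OF remove_box_Lam(1)] remove_box_Lam(2) by (auto simp: delta_fun_def)
  qed
  have "g = ?G"
  proof (rule semisym_vanish_unique[OF c r(1) g(1) semisym])
    fix mu assume mu: "mu \<in> Lam n" "csize c n mu \<le> d"
    have mu_ne: "mu \<noteq> lam" using mu(2) lam(2) by auto
    have F0: "F lam (node n r mu) = 0" using f[OF lam(1)] mu lam(2) mu_ne by (auto simp: delta_fun_def)
    have iff: "mu(i := mu i + 1) = lam \<longleftrightarrow> i \<in> ?S \<and> mu = remove_box lam i" if i: "i \<in> cls c n 1" for i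
    proof
      assume *: "mu(i := mu i + 1) = lam"
      have "mu (Suc i) \<le> mu i" using Lam_le[OF mu(1), of i "Suc i"] i by (simp add: cls_def)
      then have "lam (Suc i) < lam i" unfolding *[symmetric] by simp
      moreover have "mu = remove_box lam i" unfolding *[symmetric] remove_box_def by simp
      ultimately show "i \<in> ?S \<and> mu = remove_box lam i" using i by simp
    next
      assume *: "i \<in> ?S \<and> mu = remove_box lam i"
      then have "lam i > 0" by auto
      from remove_box_inc[of lam i, OF this] * show "mu(i := mu i + 1) = lam" by simp
    qed
    have "raise_coeff c n r (node n r mu) i * F lam ((node n r mu)(i := node n r mu i + 1)) =
       (if i \<in> ?S \<and> mu = remove_box lam i then raise_coeff c n r (node n r (remove_box lam i)) i else 0)" if i: "i \<in> cls c n 1" for i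
    proof (cases "i = 1 \<or> mu i < mu (i - 1)")
      case True
      have "mu(i := mu i + 1) \<in> Lam n" using i True by (intro Lam_inc mu) (auto simp: cls_def)
      moreover have "csize c n (mu(i := mu i + 1)) \<le> csize c n lam" using csize_inc[OF i] mu(2) lam(2) by simp
      ultimately have "F lam (node n r (mu(i := mu i + 1))) = (if mu(i := mu i + 1) = lam then 1 else 0)"
        using f[OF lam(1)] by (auto simp: delta_fun_def simp del: fun_upd_apply)
      then show ?thesis unfolding node_inc iff[OF i] by (auto simp del: fun_upd_apply)
    next
      case False
      have "mu(i := mu i + 1) \<noteq> lam"
      proof
        assume *: "mu(i := mu i + 1) = lam"
        have "i \<noteq> 1" using False by simp
        moreover have "i \<ge> 1" using i by (simp add: cls_def)
        ultimately have i1: "1 \<le> i - 1" "i - 1 \<noteq> i" by auto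
        have "lam i \<le> lam (i - 1)" using Lam_le[OF lam(1) i1(1), of i] by simp
        then show False using False i1 unfolding *[symmetric] by simp
      qed
      then have nS: "\<not> (i \<in> ?S \<and> mu = remove_box lam i)" using iff[OF i] by blast
      show ?thesis unfolding raise_coeff_zero[OF c mu(1) i False] using nS by (simp only: if_False mult_zero_left)
    qed
    then have "g (node n r mu) = (\<Sum>i\<in>cls c n 1. if i \<in> ?S \<and> mu = remove_box lam i then raise_coeff c n r (node n r (remove_box lam i)) i else 0)"
      unfolding g(2)[OF node_inj[OF r mu(1)]] F0 by (intro sum.cong refl) (simp del: fun_upd_apply)
    also have "\<dots> = (\<Sum>i\<in>?S. if mu = remove_box lam i then raise_coeff c n r (node n r (remove_box lam i)) i else 0)"
      by (rule sum.mono_neutral_cong_right) auto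
    also have "\<dots> = ?G (node n r mu)"
    proof (intro sum.cong refl)
      fix i assume i: "i \<in> ?S"
      have "F (remove_box lam i) (node n r mu) = (if mu = remove_box lam i then 1 else 0)"
        using f[OF remove_box_Lam(1)[OF i]] mu remove_box_Lam(2)[OF i] by (auto simp: delta_fun_def)
      then show "(if mu = remove_box lam i then raise_coeff c n r (node n r (remove_box lam i)) i else 0) = raise_coeff c n r (node n r (remove_box lam i)) i * F (remove_box lam i) (node n r mu)"
        by simp
    qed
    finally show "g (node n r mu) = ?G (node n r mu)" .
  qed
  then show ?thesis using semisym_symbol_unique[OF g(1) semisym] by simp
qed

section \<open>The recursion for the top values\<close>

text \<open>The eigenvalue of the operator with shift -1: it is [lam]_1 for stride 2 and |lam| for
  stride 1.\<close>

definition alt_size :: "nat \<Rightarrow> nat \<Rightarrow> (nat \<Rightarrow> nat) \<Rightarrow> 'a::field_char_0" where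
  "alt_size c n lam = of_nat (csize c n lam) - (if c = 2 then of_nat (\<Sum>i\<in>cls 2 n 0. lam i) else 0)"

lemma esym_1: "finite I \<Longrightarrow> esym I 1 x = (\<Sum>i\<in>I. x i)"
  by (induction I rule: finite_induct) (auto simp: esym_empty esym_insert esym_0)

lemma Lam_zero:
  assumes "mu \<in> Lam n" "mu 1 = 0"
  shows "mu i = 0"
proof (cases "i \<ge> 1")
  case True
  then show ?thesis using Lam_le[OF assms(1), of 1 i] assms(2) by simp
next
  case False
  then show ?thesis using assms(1) by (auto simp: Lam_def)
qed

lemma csize_ge:
  assumes "i \<in> cls c n 1"
  shows "mu i \<le> csize c n mu"
  unfolding csize_def using assms by (intro member_le_sum) auto

lemma one_in_cls: "n \<ge> 1 \<Longrightarrow> 1 \<in> cls c n 1"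
  by (simp add: cls_def)

lemma csize_0_iff:
  assumes "mu \<in> Lam n"
  shows "csize c n mu = 0 \<longleftrightarrow> mu = (\<lambda>i. 0)"
proof
  assume *: "csize c n mu = 0"
  have "mu 1 = 0"
  proof (cases "n \<ge> 1")
    case True
    then show ?thesis using csize_ge[OF one_in_cls, of n mu c] * by simp
  next
    case False
    then show ?thesis using assms by (auto simp: Lam_def)
  qed
  then show "mu = (\<lambda>i. 0)" using Lam_zero[OF assms] by auto
qed (simp add: csize_def)

lemma next_cls_first: "c = 1 \<or> c = 2 \<Longrightarrow> next_cls c (Suc m) 1 = Suc ` cls c m 1"
proof -
  assume c: "c = 1 \<or> c = 2"
  have "l \<in> next_cls c (Suc m) 1 \<longleftrightarrow> l \<in> Suc ` cls c m 1" for l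
  proof (cases l)
    case 0
    then show ?thesis by (auto simp: next_cls_def)
  next
    case (Suc k)
    then show ?thesis using c by (elim disjE) (auto simp: next_cls_def cls_def image_iff mod2_eq_if)
  qed
  then show ?thesis by blast
qed

text \<open>The factor of the numerator for row k + 1 equals the factor \<open>G k\<close> of the
  denominator for row k, and \<open>x 1\<close> supplies \<open>G n\<close> when \<open>n\<close> is
  in the class. Everything cancels except \<open>G 1\<close> = 1.\<close>

lemma lower_coeff_first:
  fixes r :: "'a::field_char_0"
  assumes c: "c = 1 \<or> c = 2" and n: "n \<ge> 1" and r: "allowed r"
  shows "lower_coeff c n r (node n r (\<lambda>i. if i = 1 then 1 else 0)) 1 = 1"
proof -
  obtain m where m: "n = Suc m" using n by (cases n) auto
  let ?x = "node n r (\<lambda>i. if i = 1 then 1 else 0)"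
  define G where "G k = of_nat (k - 1) * r + 1" for k
  have G: "G k \<noteq> 0" for k using allowed_nonzero[OF r, of 1 "k - 1"] by (simp add: G_def)
  have d: "?x 1 - ?x k = G k" if "2 \<le> k" "k \<le> n" for k
  proof -
    have "n - 1 = (n - k) + (k - 1)" using that by simp
    then have "of_nat (n - 1) * r = of_nat (n - k) * r + of_nat (k - 1) * r"
      by (simp only: of_nat_add distrib_right)
    then show ?thesis using that by (simp add: node_def rho_def G_def)
  qed
  have "(\<Prod>l\<in>next_cls c n 1. ?x 1 - ?x l - r) = (\<Prod>k\<in>cls c m 1. ?x 1 - ?x (Suc k) - r)"
    unfolding m next_cls_first[OF c] by (subst prod.reindex) auto
  also have "\<dots> = (\<Prod>k\<in>cls c m 1. G k)"
  proof (intro prod.cong refl)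
    fix k assume "k \<in> cls c m 1"
    then have k: "1 \<le> k" "k \<le> m" by (auto simp: cls_def)
    then obtain j where "k = Suc j" by (cases k) auto
    then show "?x 1 - ?x (Suc k) - r = G k" using k d[of "Suc k"] by (simp add: m G_def algebra_simps)
  qed
  finally have num: "(if n mod c = 1 mod c then ?x 1 else 1) * (\<Prod>l\<in>next_cls c n 1. ?x 1 - ?x l - r) = (\<Prod>k\<in>cls c n 1. G k)"
  proof -
    assume *: "(\<Prod>l\<in>next_cls c n 1. ?x 1 - ?x l - r) = (\<Prod>k\<in>cls c m 1. G k)"
    have "Suc m \<notin> cls c m 1" by (simp add: cls_def)
    moreover have "?x 1 = G n" by (simp add: node_def rho_def G_def)
    ultimately show ?thesis unfolding * unfolding m by (simp add: cls_Suc)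
  qed
  also have "\<dots> = G 1 * (\<Prod>k\<in>cls c n 1 - {1}. G k)"
    using one_in_cls[OF n] by (intro prod.remove) auto
  also have "(\<Prod>k\<in>cls c n 1 - {1}. G k) = (\<Prod>k\<in>cls c n 1 - {1}. ?x 1 - ?x k)"
  proof (intro prod.cong refl)
    fix k assume "k \<in> cls c n 1 - {1}"
    then show "G k = ?x 1 - ?x k" by (intro d[symmetric]) (auto simp: cls_def)
  qed
  finally have "lower_coeff c n r ?x 1 = G 1 * (\<Prod>k\<in>cls c n 1 - {1}. ?x 1 - ?x k) / (\<Prod>k\<in>cls c n 1 - {1}. ?x 1 - ?x k)"
    unfolding lower_coeff_def by (simp only:)
  moreover have "(\<Prod>k\<in>cls c n 1 - {1}. ?x 1 - ?x k) \<noteq> 0"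
    using d G by (auto simp: prod_zero_iff cls_def)
  ultimately show ?thesis by (simp add: G_def)
qed

text \<open>The possible partitions are 0, (1, 0, ...) and, for stride 2, also (1, 1, 0, ...). In
  the last one the only removable box lies in an even row, so all coefficients vanish.\<close>

lemma sum_lower_coeff_small:
  fixes r :: "'a::field_char_0"
  assumes c: "c = 1 \<or> c = 2" and n: "n \<ge> 1" and r: "allowed r" and mu: "mu \<in> Lam n" "csize c n mu \<le> 1"
  shows "(\<Sum>i\<in>cls c n 1. lower_coeff c n r (node n r mu) i) = alt_size c n mu"
proof -
  have zero: "lower_coeff c n r (node n r mu) i = 0" if "i \<in> cls c n 1" "\<not> mu (Suc i) < mu i" for i
    using lower_coeff_zero[OF c mu(1) that] .
  have le1: "mu 1 \<le> 1" using csize_ge[OF one_in_cls[OF n], of mu c] mu(2) by simp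
  consider "mu 1 = 0" | "mu 1 = 1" "mu 2 = 0" | "mu 1 = 1" "mu 2 = 1"
    using le1 Lam_le[OF mu(1), of 1 2] by fastforce
  then show ?thesis
  proof cases
    case 1
    then have "mu i = 0" for i by (rule Lam_zero[OF mu(1)])
    then have "(\<Sum>i\<in>cls c n 1. lower_coeff c n r (node n r mu) i) = 0" "alt_size c n mu = (0::'a)"
      using zero by (simp_all add: alt_size_def csize_def)
    then show ?thesis by simp
  next
    case 2
    have mu_eq: "mu = (\<lambda>i. if i = 1 then 1 else 0)"
    proof
      fix i show "mu i = (if i = 1 then 1 else 0)"
        using 2 Lam_le[OF mu(1), of 2 i] mu(1) by (cases "i = 0 \<or> i = 1") (auto simp: Lam_def)
    qed
    have "(\<Sum>i\<in>cls c n 1. lower_coeff c n r (node n r mu) i) = (\<Sum>i\<in>{1}. lower_coeff c n r (node n r mu) i)"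
    proof (intro sum.mono_neutral_right ballI)
      fix i assume i: "i \<in> cls c n 1 - {1}"
      then have "\<not> mu (Suc i) < mu i" unfolding mu_eq by simp
      then show "lower_coeff c n r (node n r mu) i = 0" using zero i by blast
    qed (use one_in_cls[OF n] in auto)
    also have "\<dots> = 1" unfolding mu_eq using lower_coeff_first[OF c n r] by simp
    also have "1 = (alt_size c n mu :: 'a)"
    proof -
      have "csize c n mu = 1" using one_in_cls[OF n, of c] unfolding csize_def mu_eq by simp
      moreover have "(\<Sum>i\<in>cls 2 n 0. mu i) = 0" unfolding mu_eq by (simp add: cls_def)
      ultimately show ?thesis by (simp add: alt_size_def)
    qed
    finally show ?thesis .
  next
    case 3
    have n2: "n \<ge> 2"
    proof (rule ccontr)
      assume "\<not> n \<ge> 2"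
      then show False using Lam_out[OF mu(1), of 2] 3 by simp
    qed
    have c2: "c = 2"
    proof (rule ccontr)
      assume "c \<noteq> 2"
      then have "c = 1" using c by simp
      then have "{1, 2} \<subseteq> cls c n 1" using n2 by (auto simp: cls_def)
      then have "(\<Sum>i\<in>{1,2}. mu i) \<le> csize c n mu" unfolding csize_def by (intro sum_mono2) auto
      then show False using 3 mu(2) by simp
    qed
    have "mu 3 = 0"
    proof (cases "n \<ge> 3")
      case True
      then have "{1, 3} \<subseteq> cls c n 1" by (auto simp: cls_def c2)
      then have "(\<Sum>i\<in>{1,3}. mu i) \<le> csize c n mu" unfolding csize_def by (intro sum_mono2) auto
      then show ?thesis using 3 mu(2) by simp
    next
      case False
      then show ?thesis using Lam_out[OF mu(1), of 3] by simp
    qed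
    then have mu_eq: "mu i = (if i = 1 \<or> i = 2 then 1 else 0)" for i
      using 3 Lam_le[OF mu(1), of 3 i] mu(1) by (cases "i = 0 \<or> i = 1 \<or> i = 2") (auto simp: Lam_def)
    have "(\<Sum>i\<in>cls c n 1. lower_coeff c n r (node n r mu) i) = 0"
    proof (intro sum.neutral ballI zero)
      fix i assume "i \<in> cls c n 1"
      then have "i \<noteq> 2" by (auto simp: cls_def c2)
      then show "\<not> mu (Suc i) < mu i" unfolding mu_eq by auto
    qed
    moreover have "alt_size c n mu = (0::'a)"
    proof -
      have "csize c n mu = (\<Sum>i\<in>cls c n 1. if i = 1 then 1 else 0)"
        unfolding csize_def by (intro sum.cong refl) (auto simp: mu_eq cls_def c2)
      moreover have "(\<Sum>i\<in>cls 2 n 0. mu i) = (\<Sum>i\<in>cls 2 n 0. if i = 2 then 1 else 0)"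
        by (intro sum.cong refl) (auto simp: mu_eq cls_def)
      moreover have "2 \<in> cls 2 n 0" using n2 by (simp add: cls_def)
      ultimately show ?thesis using one_in_cls[OF n, of c] by (simp add: alt_size_def c2)
    qed
    ultimately show ?thesis by simp
  qed
qed

text \<open>Although every single coefficient has denominators, their sum is semisymmetric of degree
  at most 1. So is the linear function \<open>L\<close>, and the two agree at all partitions of size
  at most 1.\<close>

lemma sum_lower_coeff_value:
  fixes r :: "'a::field_char_0"
  assumes c: "c = 1 \<or> c = 2" and n: "n \<ge> 1" and r: "allowed r" "r \<noteq> 0" and lam: "lam \<in> Lam n"
  shows "(\<Sum>i\<in>cls c n 1. lower_coeff c n r (node n r lam) i) = alt_size c n lam"
proof -
  obtain g s where g: "semisym c n 1 g s" "\<And>x. inj_on x (cls c n 1) \<Longrightarrow> g x = (\<Sum>i\<in>cls c n 1. lower_coeff c n r x i)"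
    using sum_lower_coeff_semisym[OF c n r(2)] by blast
  \<comment> \<open>The constant is subtracted so that \<open>S q\<close> at the node of
    \<open>mu\<close> is the sum of the parts of \<open>mu\<close> in the class.\<close>
  define S where "S q x = esym (cls c n q) 1 x - (\<Sum>i\<in>cls c n q. rho n r i)" for q and x :: "nat \<Rightarrow> 'a"
  define L where "L x = S 1 x - (if c = 2 then 1 else 0) * S 0 x" for x
  have semisym_S: "\<exists>v. semisym c n 1 (S q) v" for q
  proof -
    have "semisym c n 1 (\<lambda>x. \<Sum>i\<in>cls c n q. rho n r i) 0"
      using semisym_Suc[OF semisym_const[of c n "\<Sum>i\<in>cls c n q. rho n r i"]] by simp
    from semisym_diff[OF semisym_esym[of c n 1 q] this] show ?thesis unfolding S_def[abs_def] by blast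
  qed
  have S_val: "S q (node n r mu) = of_nat (\<Sum>i\<in>cls c n q. mu i)" for q mu
    unfolding S_def by (subst esym_1) (auto simp: node_def sum.distrib)
  have L_val: "L (node n r mu) = alt_size c n mu" for mu
    unfolding L_def S_val alt_size_def csize_def by simp
  obtain v1 v0 where v: "semisym c n 1 (S 1) v1" "semisym c n 1 (S 0) v0" using semisym_S by blast
  have semisym_L: "semisym c n 1 L (v1 - (if c = 2 then 1 else 0) * v0)"
    unfolding L_def[abs_def] by (intro semisym_diff semisym_scale v)
  have "g = L"
  proof (rule semisym_vanish_unique[OF c r(1) g(1) semisym_L])
    fix mu assume mu: "mu \<in> Lam n" "csize c n mu \<le> 1"
    then show "g (node n r mu) = L (node n r mu)"
      unfolding L_val g(2)[OF node_inj[OF r mu(1)]] by (intro sum_lower_coeff_small c n r)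
  qed
  then show ?thesis using g(2)[OF node_inj[OF r lam]] L_val[of lam] by simp
qed

section \<open>The product formula as a solution of the recursion\<close>

definition B_factor :: "nat \<Rightarrow> 'a::field_char_0 \<Rightarrow> nat \<Rightarrow> nat \<Rightarrow> 'a" where
  "B_factor c r e D = (if e mod c = 1 mod c then pochhammer (of_nat (e + 1) * r) D else 1) /
                (if e mod c = 0 then pochhammer (of_nat e * r) D else 1)"

definition value_factor :: "nat \<Rightarrow> 'a::field_char_0 \<Rightarrow> nat \<Rightarrow> nat \<Rightarrow> 'a" where
  "value_factor c r e D = B_factor c r e D / norm_factor c r e D"

text \<open>
  For stride 2 this is \<open>B\<^sub>\<lambda> / R\<^sub>\<lambda>(\<rho> + \<lambda>)\<close>, the value at \<open>(1, \<dots>, 1)\<close> of the top component of \<open>f\<^sub>\<lambda>\<close>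
  whenever that value is not 0.
\<close>

definition delta_value :: "nat \<Rightarrow> nat \<Rightarrow> (nat \<Rightarrow> nat) \<Rightarrow> 'a::field_char_0 \<Rightarrow> 'a" where
  "delta_value c n lam r = (\<Prod>l=1..n. \<Prod>j=1..<l. value_factor c r (l - j) (lam j - lam l)) /
     (\<Prod>j\<in>cls c n n. pochhammer (of_nat (n - j) * r + 1) (lam j))"

lemma value_factor_0 [simp]: "value_factor c r e 0 = 1"
  by (simp add: value_factor_def B_factor_def norm_factor_def)

lemma delta_value_zero: "delta_value c n (\<lambda>i. 0) r = 1"
  by (simp add: delta_value_def)

lemma allowed_mult_nonzero:
  assumes "allowed r" "r \<noteq> 0" "k \<ge> 1"
  shows "of_nat k * r + of_nat D \<noteq> 0"
  using allowed_nonzero[OF assms(1), of D k] assms(2,3) by (cases "D = 0") auto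

lemma pochhammer_mult_nonzero:
  assumes "allowed r" "r \<noteq> 0" "k \<ge> 1"
  shows "pochhammer (of_nat k * r) D \<noteq> 0"
proof
  assume "pochhammer (of_nat k * r) D = 0"
  then obtain i where "of_nat k * r = - of_nat i" by (auto simp: pochhammer_eq_0_iff)
  then have "of_nat k * r + of_nat i = 0" by simp
  then show False using allowed_mult_nonzero[OF assms] by blast
qed

lemma quotient_if_mult:
  fixes A :: "'a::field"
  shows "(if P then A * a else 1) / (if Q then B * b else 1) / ((if P then C * c else 1) / (if Q then E * e else 1)) =
    (if P then A else 1) / (if Q then B else 1) / ((if P then C else 1) / (if Q then E else 1)) *
    ((if P then a / c else 1) * (if Q then e / b else 1))"
  by (cases P; cases Q) (simp_all add: mult_ac)

lemma value_factor_Suc: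
  fixes r :: "'a::field_char_0"
  shows "value_factor c r e (Suc D) = value_factor c r e D *
    ((if e mod c = 1 mod c then (of_nat (e + 1) * r + of_nat D) / (of_nat (e - 1) * r + 1 + of_nat D) else 1) *
     (if e mod c = 0 then (of_nat e * r + 1 + of_nat D) / (of_nat e * r + of_nat D) else 1))"
  unfolding value_factor_def B_factor_def norm_factor_def pochhammer_Suc by (rule quotient_if_mult)

lemma prod_pairs_split:
  fixes H :: "nat \<Rightarrow> nat \<Rightarrow> 'a::comm_monoid_mult"
  assumes i: "i \<in> {1..n}"
  shows "(\<Prod>l=1..n. \<Prod>j=1..<l. H j l) =
    (\<Prod>l\<in>{1..n} - {i}. \<Prod>j\<in>{1..<l} - {i}. H j l) * (\<Prod>l\<in>{1..n} - {i}. if l < i then H l i else H i l)"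
proof -
  have 1: "(\<Prod>j=1..<i. H j i) = (\<Prod>l\<in>{1..n} - {i}. if l < i then H l i else 1)"
    using i by (intro prod.mono_neutral_cong_left) auto
  have 2: "(\<Prod>j=1..<l. H j l) = (\<Prod>j\<in>{1..<l} - {i}. H j l) * (if l < i then 1 else H i l)" if "l \<in> {1..n} - {i}" for l
  proof (cases "l < i")
    case True
    then have "{1..<l} - {i} = {1..<l}" by auto
    then show ?thesis using True by simp
  next
    case False
    then have "i \<in> {1..<l}" using that i by auto
    then show ?thesis using False by (subst prod.remove[of _ i]) (auto simp: mult.commute)
  qed
  have "(\<Prod>l=1..n. \<Prod>j=1..<l. H j l) = (\<Prod>j=1..<i. H j i) * (\<Prod>l\<in>{1..n} - {i}. \<Prod>j=1..<l. H j l)"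
    using i by (subst prod.remove[of _ i]) auto
  also have "(\<Prod>l\<in>{1..n} - {i}. \<Prod>j=1..<l. H j l) =
     (\<Prod>l\<in>{1..n} - {i}. (\<Prod>j\<in>{1..<l} - {i}. H j l) * (if l < i then 1 else H i l))"
    using 2 by (intro prod.cong refl) auto
  also have "(\<Prod>j=1..<i. H j i) * \<dots> = (\<Prod>l\<in>{1..n} - {i}. \<Prod>j\<in>{1..<l} - {i}. H j l) *
     (\<Prod>l\<in>{1..n} - {i}. (if l < i then H l i else 1) * (if l < i then 1 else H i l))"
    unfolding 1 prod.distrib by (simp only: mult_ac)
  also have "(\<Prod>l\<in>{1..n} - {i}. (if l < i then H l i else 1) * (if l < i then 1 else H i l)) =
     (\<Prod>l\<in>{1..n} - {i}. if l < i then H l i else H i l)"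
    by (intro prod.cong refl) auto
  finally show ?thesis .
qed

lemma prod_filter_quotient:
  fixes f g :: "nat \<Rightarrow> 'a::field"
  assumes "finite A"
  shows "(\<Prod>l\<in>{l\<in>A. P l}. f l) / (\<Prod>l\<in>{l\<in>A. Q l}. g l) =
    (\<Prod>l\<in>A. (if P l then f l else 1) / (if Q l then g l else 1))"
  using assms by (simp add: prod_dividef prod.inter_filter)

lemma quotient_if_cancel:
  fixes a :: "'a::field"
  assumes "p \<noteq> 0" "q \<noteq> 0" "s \<noteq> 0"
  shows "(if P then - p else 1) / (if Q then - s else 1) * (G * ((if P then a / p else 1) * (if Q then s / q else 1))) =
      (if P then - a else 1) / (if Q then - q else 1) * G"
    and "(if P then a else 1) / (if Q then q else 1) * G =
      (if P then p else 1) / (if Q then s else 1) * (G * ((if P then a / p else 1) * (if Q then s / q else 1)))"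
  using assms by (cases P; cases Q; simp)+

text \<open>Both sides split over the indices l other than \<open>i\<close>. For each l, removing
  the box changes one difference of parts by 1, and the resulting step of
  \<open>value_factor_Suc\<close> is the quotient of the factors of the two operator
  coefficients.\<close>

lemma delta_value_ratio:
  fixes r :: "'a::field_char_0"
  assumes c: "c = 1 \<or> c = 2" and n: "n mod c = 1 mod c" and r: "allowed r" "r \<noteq> 0"
    and lam: "lam \<in> Lam n" and i: "i \<in> cls c n 1" "lam (Suc i) < lam i"
  shows "raise_coeff c n r (node n r (remove_box lam i)) i * delta_value c n (remove_box lam i) r = lower_coeff c n r (node n r lam) i * delta_value c n lam r"
proof -
  let ?A = "{1..n} - {i}"
  let ?x = "node n r lam"
  let ?y = "node n r (remove_box lam i)"
  have i1: "1 \<le> i" "i \<le> n" and ic: "i mod c = 1 mod c" using i(1) by (auto simp: cls_def)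
  have pos: "lam i > 0" using i(2) by simp
  have y: "?y = ?x(i := ?x i - 1)" using pos by (rule node_remove_box)
  define T where "T mu l = (if l < i then value_factor c r (i - l) (mu l - mu i) else value_factor c r (l - i) (mu i - mu l))" for mu :: "nat \<Rightarrow> nat" and l
  define R where "R = (\<Prod>l\<in>?A. \<Prod>j\<in>{1..<l} - {i}. value_factor c r (l - j) (lam j - lam l))"
  define Z where "Z mu = (\<Prod>j\<in>cls c n n. pochhammer (of_nat (n - j) * r + 1) (mu j))" for mu :: "nat \<Rightarrow> nat"
  have om1: "delta_value c n lam r = R * (\<Prod>l\<in>?A. T lam l) / Z lam"
    unfolding delta_value_def R_def T_def Z_def using i1 by (subst prod_pairs_split[of i]) auto
  have om2: "delta_value c n (remove_box lam i) r = R * (\<Prod>l\<in>?A. T (remove_box lam i) l) / Z (remove_box lam i)"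
  proof -
    have "(\<Prod>l\<in>?A. \<Prod>j\<in>{1..<l} - {i}. value_factor c r (l - j) (remove_box lam i j - remove_box lam i l)) = R"
      unfolding R_def by (intro prod.cong refl) (auto simp: remove_box_def)
    then show ?thesis
      unfolding delta_value_def T_def Z_def using i1 by (subst prod_pairs_split[of i]) auto
  qed
  \<comment> \<open>The last factor of the rising factorial of row \<open>i\<close> is the
    coordinate \<open>?x i\<close>, which is the extra factor in \<open>lower_coeff\<close>; this
    needs \<open>i\<close> to be in the class of \<open>n\<close>.\<close>
  have Z: "Z lam = Z (remove_box lam i) * ?x i"
  proof -
    have "i \<in> cls c n n" using i1 ic n by (simp add: cls_def)
    then have "Z mu = pochhammer (of_nat (n - i) * r + 1) (mu i) * (\<Prod>j\<in>cls c n n - {i}. pochhammer (of_nat (n - j) * r + 1) (mu j))" for mu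
      unfolding Z_def by (intro prod.remove) auto
    moreover have "(\<Prod>j\<in>cls c n n - {i}. pochhammer (of_nat (n - j) * r + 1) (remove_box lam i j)) =
      (\<Prod>j\<in>cls c n n - {i}. pochhammer (of_nat (n - j) * r + 1) (lam j))"
      by (intro prod.cong refl) (auto simp: remove_box_def)
    moreover have "pochhammer (of_nat (n - i) * r + 1) (lam i) = pochhammer (of_nat (n - i) * r + 1) (remove_box lam i i) * ?x i"
    proof -
      obtain k where k: "lam i = Suc k" using pos by (cases "lam i") auto
      show ?thesis by (simp add: k remove_box_def pochhammer_Suc node_def rho_def algebra_simps)
    qed
    ultimately show ?thesis by (simp only: mult_ac)
  qed
  have Zn: "Z mu \<noteq> 0" for mu
    unfolding Z_def using pochhammer_allowed_nonzero[OF r(1)] by (auto simp: prod_zero_iff)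
  have xi: "?x i \<noteq> 0"
    using allowed_nonzero[OF r(1) pos, of "n - i"] by (simp add: node_def rho_def)
  let ?P = "\<lambda>l. l mod c = (i + 1) mod c"
  let ?Q = "\<lambda>l. l mod c = i mod c"
  have next_cls: "next_cls c n i = {l \<in> ?A. ?P l}" and same: "cls c n 1 - {i} = {l \<in> ?A. ?Q l}"
    using ic by (auto simp: next_cls_def cls_def)
  have raise_coeff: "raise_coeff c n r ?y i = (\<Prod>l\<in>?A. (if ?P l then ?y i - ?y l + r else 1) / (if ?Q l then ?y i - ?y l else 1))"
    unfolding raise_coeff_def next_cls same by (rule prod_filter_quotient) simp
  have lower_coeff: "lower_coeff c n r ?x i = ?x i * (\<Prod>l\<in>?A. (if ?P l then ?x i - ?x l - r else 1) / (if ?Q l then ?x i - ?x l else 1))"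
    unfolding lower_coeff_def next_cls same prod_filter_quotient[OF finite_Diff[OF finite_atLeastAtMost], symmetric] using n by simp
  \<comment> \<open>For l < i the removal increases the difference of parts, for l > i it decreases
    it, so \<open>value_factor_Suc\<close> is applied in opposite directions. In the first case all
    coordinate differences are negated, on both sides alike.\<close>
  have fac: "(if ?P l then ?y i - ?y l + r else 1) / (if ?Q l then ?y i - ?y l else 1) * T (remove_box lam i) l =
     (if ?P l then ?x i - ?x l - r else 1) / (if ?Q l then ?x i - ?x l else 1) * T lam l" if l: "l \<in> ?A" for l
  proof (cases "l < i")
    case True
    define e where "e = i - l"
    define D where "D = lam l - lam i"
    have e: "e \<ge> 1" "of_nat e = (1::'a) + of_nat (e - 1)" using True by (auto simp: e_def of_nat_diff)
    have "lam i \<le> lam l" using Lam_le[OF lam, of l i] l True by simp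
    then have T: "T (remove_box lam i) l = value_factor c r e (Suc D)" "T lam l = value_factor c r e D"
      using True pos by (auto simp: T_def e_def D_def remove_box_def Suc_diff_le)
    have d: "?x i - ?x l = - (of_nat e * r + of_nat D)"
      using node_diff[OF lam, of l i r] l True i1 by (simp add: e_def D_def algebra_simps)
    have d': "?y i - ?y l = - (of_nat e * r + of_nat D + 1)"
      using d True unfolding y by (simp add: algebra_simps)
    have P: "?P l \<longleftrightarrow> e mod c = 1 mod c" and Q: "?Q l \<longleftrightarrow> e mod c = 0"
      using stride_dist[OF c, of l i] True c unfolding e_def by (elim disjE; auto simp: mod2_eq_if)+
    have n1: "of_nat (e - 1) * r + 1 + of_nat D \<noteq> 0" using allowed_nonzero[OF r(1), of "Suc D" "e - 1"] by (simp add: algebra_simps)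
    have n2: "of_nat e * r + of_nat D \<noteq> 0" using allowed_mult_nonzero[OF r e(1)] .
    have n3: "of_nat e * r + 1 + of_nat D \<noteq> 0" using allowed_nonzero[OF r(1), of "Suc D" e] by (simp add: algebra_simps)
    have s1: "?y i - ?y l + r = - (of_nat (e - 1) * r + 1 + of_nat D)" unfolding d' e(2) by (simp add: algebra_simps)
    have s2: "?x i - ?x l - r = - (of_nat (e + 1) * r + of_nat D)" unfolding d by (simp add: algebra_simps)
    have s3: "?y i - ?y l = - (of_nat e * r + 1 + of_nat D)" unfolding d' by (simp add: algebra_simps)
    show ?thesis
      unfolding P Q T value_factor_Suc s1 s2 unfolding s3 d by (rule quotient_if_cancel(1)[OF n1 n2 n3])
  next
    case False
    define e where "e = l - i"
    have il: "i < l" "l \<le> n" using False l by auto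
    have e: "e \<ge> 1" "of_nat e = (1::'a) + of_nat (e - 1)" using il by (auto simp: e_def of_nat_diff)
    have "lam l \<le> lam (Suc i)" using Lam_le[OF lam, of "Suc i" l] il by simp
    then obtain D where D: "lam i - lam l = Suc D" using i(2) by (metis Suc_diff_Suc le_less_trans)
    have T: "T (remove_box lam i) l = value_factor c r e D" "T lam l = value_factor c r e (Suc D)"
    proof -
      have "lam i - Suc (lam l) = D" using D by simp
      then show "T (remove_box lam i) l = value_factor c r e D" using il by (simp add: T_def e_def remove_box_def)
      show "T lam l = value_factor c r e (Suc D)" using il D by (simp add: T_def e_def)
    qed
    have d: "?x i - ?x l = of_nat e * r + of_nat D + 1"
      using node_diff[OF lam, of i l r] il i1 D by (simp add: e_def algebra_simps)
    have d': "?y i - ?y l = of_nat e * r + of_nat D"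
      using d il unfolding y by (simp add: algebra_simps)
    have P: "?P l \<longleftrightarrow> e mod c = 1 mod c" and Q: "?Q l \<longleftrightarrow> e mod c = 0"
      using stride_dist[OF c, of i l] il unfolding e_def by auto
    have n1: "of_nat (e - 1) * r + 1 + of_nat D \<noteq> 0" using allowed_nonzero[OF r(1), of "Suc D" "e - 1"] by (simp add: algebra_simps)
    have n2: "of_nat e * r + of_nat D \<noteq> 0" using allowed_mult_nonzero[OF r e(1)] .
    have n3: "of_nat e * r + 1 + of_nat D \<noteq> 0" using allowed_nonzero[OF r(1), of "Suc D" e] by (simp add: algebra_simps)
    have s1: "?y i - ?y l + r = of_nat (e + 1) * r + of_nat D" unfolding d' by (simp add: algebra_simps)
    have s2: "?x i - ?x l - r = of_nat (e - 1) * r + 1 + of_nat D" unfolding d e(2) by (simp add: algebra_simps)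
    have s3: "?x i - ?x l = of_nat e * r + 1 + of_nat D" unfolding d by (simp add: algebra_simps)
    show ?thesis
      unfolding P Q T value_factor_Suc s1 s2 unfolding s3 d' by (rule quotient_if_cancel(2)[OF n1 n2 n3])
  qed
  have "raise_coeff c n r ?y i * (\<Prod>l\<in>?A. T (remove_box lam i) l) = (\<Prod>l\<in>?A. (if ?P l then ?x i - ?x l - r else 1) / (if ?Q l then ?x i - ?x l else 1)) * (\<Prod>l\<in>?A. T lam l)"
    unfolding raise_coeff prod.distrib[symmetric] by (intro prod.cong refl fac)
  then show ?thesis
    unfolding om1 om2 lower_coeff Z using Zn[of "remove_box lam i"] xi by (simp add: field_simps)
qed

lemma delta_fun_symbol_zero:
  assumes c: "c = 1 \<or> c = 2" and r: "allowed r" and f: "delta_fun c n r (\<lambda>i. 0) f v"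
  shows "v = 1"
proof -
  have 0: "csize c n (\<lambda>i. 0) = 0" by (simp add: csize_def)
  have semisym: "semisym c n 0 f v" using f 0 by (simp add: delta_fun_def)
  have "f = (\<lambda>x. 1)"
  proof (rule semisym_vanish_unique[OF c r semisym semisym_const])
    fix mu assume "mu \<in> Lam n" "csize c n mu \<le> 0"
    then show "f (node n r mu) = 1" using f csize_0_iff[of mu n c] 0 by (auto simp: delta_fun_def)
  qed
  then show ?thesis using semisym_symbol_unique[OF semisym semisym_const[of c n 1]] by simp
qed

text \<open>Induction on the size. The two operators give the same top value \<open>s\<close>, one
  as the eigenvalue times \<open>V lam\<close>, the other as a sum over smaller partitions;
  \<open>delta_value_ratio\<close> makes the proposed product satisfy this equation. The eigenvalue
  must be divided out, so the partitions where it is 0 enter through \<open>base\<close>.\<close>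

lemma delta_fun_symbol:
  fixes r :: "'a::field_char_0"
  assumes c: "c = 1 \<or> c = 2" and n: "n \<ge> 1" "n mod c = 1 mod c" and r: "allowed r" "r \<noteq> 0"
    and f: "\<And>nu. nu \<in> Lam n \<Longrightarrow> delta_fun c n r nu (F nu) (V nu)"
    and base: "\<And>nu. nu \<in> Lam n \<Longrightarrow> alt_size c n nu = (0::'a) \<Longrightarrow> V nu = delta_value c n nu r"
    and lam: "lam \<in> Lam n"
  shows "V lam = delta_value c n lam r"
  using lam
proof (induction "csize c n lam" arbitrary: lam rule: less_induct)
  case less
  show ?case
  proof (cases "alt_size c n lam = (0::'a)")
    case True
    then show ?thesis using base less.prems by blast
  next
    case False
    have "csize c n lam \<noteq> 0"
    proof
      assume "csize c n lam = 0"
      then have "lam = (\<lambda>i. 0)" using csize_0_iff[OF less.prems] by blast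
      then have "alt_size c n lam = (0::'a)" by (simp add: alt_size_def csize_def)
      then show False using False by blast
    qed
    then obtain d where d: "csize c n lam = Suc d" by (cases "csize c n lam") auto
    have semisym: "semisym c n (Suc d) (F lam) (V lam)" using f[OF less.prems] d by (simp add: delta_fun_def)
    obtain gU gX s where gU: "semisym c n d gU s"
       "\<And>x. inj_on x (cls c n 1) \<Longrightarrow> gU x = (\<Sum>i\<in>cls c n 1. raise_coeff c n r x i * (F lam (x(i := x i + 1)) - F lam x))"
      and gX: "semisym c n (Suc d) gX s"
       "\<And>x. inj_on x (cls c n 1) \<Longrightarrow> gX x = (\<Sum>i\<in>cls c n 1. lower_coeff c n r x i * (F lam x - F lam (x(i := x i - 1))))"
      using operators[OF c n r(2) semisym] by blast
    have gX1: "semisym c n (csize c n lam) gX s" using gX(1) d by simp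
    have "s = (\<Sum>i\<in>cls c n 1. lower_coeff c n r (node n r lam) i) * V lam"
      by (rule delta_fun_eigen[where f = "F lam" and g = gX, OF c r less.prems f[OF less.prems] gX1 gX(2)])
    then have s1: "s = alt_size c n lam * V lam" using sum_lower_coeff_value[OF c n(1) r less.prems] by simp
    let ?S = "{i\<in>cls c n 1. lam (Suc i) < lam i}"
    have "s = (\<Sum>i\<in>?S. raise_coeff c n r (node n r (remove_box lam i)) i * V (remove_box lam i))"
      by (rule delta_fun_lower[where F = F and V = V and g = gU, OF c r less.prems d f gU])
    also have "\<dots> = (\<Sum>i\<in>?S. lower_coeff c n r (node n r lam) i * delta_value c n lam r)"
    proof (intro sum.cong refl)
      fix i assume i: "i \<in> ?S"
      have "V (remove_box lam i) = delta_value c n (remove_box lam i) r"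
      proof (rule less.hyps)
        show "remove_box lam i \<in> Lam n" using i less.prems by (intro Lam_remove_box) (auto simp: cls_def)
        show "csize c n (remove_box lam i) < csize c n lam" using i csize_remove_box[of i c n lam] by auto
      qed
      then show "raise_coeff c n r (node n r (remove_box lam i)) i * V (remove_box lam i) = lower_coeff c n r (node n r lam) i * delta_value c n lam r"
        using delta_value_ratio[OF c n(2) r less.prems] i by simp
    qed
    also have "\<dots> = (\<Sum>i\<in>cls c n 1. lower_coeff c n r (node n r lam) i * delta_value c n lam r)"
      by (rule sum.mono_neutral_left) (auto simp: lower_coeff_zero[OF c less.prems])
    also have "\<dots> = alt_size c n lam * delta_value c n lam r"
      unfolding sum_distrib_right[symmetric] sum_lower_coeff_value[OF c n(1) r less.prems] ..
    finally show ?thesis using s1 False by simp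
  qed
qed

text \<open>The eigenvalue is |lam| here and is 0 only for the empty partition, so the recursion
  starts without further input.\<close>

lemma delta_fun_symbol_1:
  fixes r :: "'a::field_char_0"
  assumes r: "allowed r" "r \<noteq> 0" and lam: "lam \<in> Lam n" and f: "delta_fun 1 n r lam f v"
  shows "v = delta_value 1 n lam r"
proof (cases "n \<ge> 1")
  case False
  then have "lam = (\<lambda>i. 0)" using lam by (auto simp: Lam_def)
  then show ?thesis using delta_fun_symbol_zero[OF _ r(1), of 1 n f v] f delta_value_zero by metis
next
  case True
  have c: "(1::nat) = 1 \<or> (1::nat) = 2" by simp
  obtain F0 V0 where FV: "\<And>nu. delta_fun 1 n r nu (F0 nu) (V0 nu)"
    using delta_fun_exists[OF c r(1)] by metis
  \<comment> \<open>The recursion involves a whole system of interpolation functions; an arbitrary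
    system is modified at \<open>lam\<close> to contain the given one.\<close>
  define F where "F = F0(lam := f)"
  define V where "V = V0(lam := v)"
  have d: "delta_fun 1 n r nu (F nu) (V nu)" for nu using FV f by (simp add: F_def V_def)
  have "V lam = delta_value 1 n lam r"
  proof (rule delta_fun_symbol[OF c True _ r d _ lam])
    fix nu assume nu: "nu \<in> Lam n" "alt_size 1 n nu = (0::'a)"
    then have "csize 1 n nu = 0" by (simp add: alt_size_def)
    then have "nu = (\<lambda>i. 0)" using csize_0_iff[OF nu(1)] by blast
    then show "V nu = delta_value 1 n nu r" using delta_fun_symbol_zero[OF c r(1)] d delta_value_zero by metis
  qed simp
  then show ?thesis by (simp add: V_def)
qed

section \<open>Reduction of the balanced case to symmetric functions\<close>

lemma allowed_double:
  assumes "allowed r"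
  shows "allowed (of_nat 2 * r)"
  unfolding allowed_def
proof
  assume "\<exists>q::rat. q < 0 \<and> of_nat 2 * r = of_rat q"
  then obtain q :: rat where q: "q < 0" "of_nat 2 * r = of_rat q" by blast
  have "r = of_rat q / of_nat 2" using q(2) by (simp add: field_simps)
  then have "r = of_rat (q / 2)" by (simp add: of_rat_divide)
  moreover have "q / 2 < 0" using q(1) by simp
  ultimately show False using assms unfolding allowed_def by blast
qed

lemma cls_even: "cls 2 n 0 = (\<lambda>k. 2 * k) ` {1..n div 2}"
proof -
  have "i \<in> cls 2 n 0 \<longleftrightarrow> i \<in> (\<lambda>k. 2 * k) ` {1..n div 2}" for i
  proof
    assume "i \<in> cls 2 n 0"
    then have "i = 2 * (i div 2)" "i div 2 \<in> {1..n div 2}" by (auto simp: cls_def div_le_mono)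
    then show "i \<in> (\<lambda>k. 2 * k) ` {1..n div 2}" by (rule image_eqI)
  qed (auto simp: cls_def)
  then show ?thesis by blast
qed

lemma cls_odd: "cls 2 n 1 = (\<lambda>k. 2 * k - 1) ` {1..n div 2} \<union> (if odd n then {n} else {})"
proof -
  have "i \<in> cls 2 n 1 \<longleftrightarrow> i \<in> (\<lambda>k. 2 * k - 1) ` {1..n div 2} \<union> (if odd n then {n} else {})" for i
  proof
    assume "i \<in> cls 2 n 1"
    then have i: "odd i" "1 \<le> i" "i \<le> n" by (auto simp: cls_def odd_iff_mod_2_eq_one)
    then obtain k where k: "i = 2 * k + 1" by (elim oddE)
    show "i \<in> (\<lambda>k. 2 * k - 1) ` {1..n div 2} \<union> (if odd n then {n} else {})"
    proof (cases "i = n")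
      case True
      then show ?thesis using i by auto
    next
      case False
      then have "Suc k \<in> {1..n div 2}" using i k by auto
      moreover have "i = 2 * Suc k - 1" using k by simp
      ultimately show ?thesis by blast
    qed
  next
    assume "i \<in> (\<lambda>k. 2 * k - 1) ` {1..n div 2} \<union> (if odd n then {n} else {})"
    then consider k where "k \<in> {1..n div 2}" "i = 2 * k - 1" | "odd n" "i = n" by (auto split: if_splits)
    then show "i \<in> cls 2 n 1"
    proof cases
      case 1
      then obtain j where "k = Suc j" by (cases k) auto
      then show ?thesis using 1 by (auto simp: cls_def)
    next
      case 2
      then show ?thesis by (auto simp: cls_def odd_iff_mod_2_eq_one odd_pos Suc_leI)
    qed
  qed
  then show ?thesis by blast
qed

lemma inj_double: "inj_on (\<lambda>k. 2 * k :: nat) A"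
  by (auto simp: inj_on_def)

lemma sum_cls_even: "(\<Sum>i\<in>cls 2 n 0. f i) = (\<Sum>k=1..n div 2. f (2 * k))"
  unfolding cls_even by (subst sum.reindex) (auto simp: inj_on_def)

lemma sum_cls_odd: "(\<Sum>i\<in>cls 2 n 1. f i) = (\<Sum>k=1..n div 2. f (2 * k - 1)) + (if odd n then f n else 0)"
proof -
  have inj: "inj_on (\<lambda>k. 2 * k - 1 :: nat) {1..n div 2}" by (auto simp: inj_on_def)
  have "n \<notin> (\<lambda>k. 2 * k - 1) ` {1..n div 2}" if "odd n"
  proof
    assume "n \<in> (\<lambda>k. 2 * k - 1) ` {1..n div 2}"
    then obtain k where "k \<in> {1..n div 2}" "n = 2 * k - 1" by blast
    then show False by auto
  qed
  then show ?thesis unfolding cls_odd using sum.reindex[OF inj, of f] by (auto simp: add.commute)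
qed

definition even_parts :: "nat \<Rightarrow> (nat \<Rightarrow> nat) \<Rightarrow> nat \<Rightarrow> nat" where
  "even_parts n mu = (\<lambda>k. if k \<in> {1..n div 2} then mu (2 * k) else 0)"

lemma even_parts_Lam:
  assumes "mu \<in> Lam n"
  shows "even_parts n mu \<in> Lam (n div 2)"
  unfolding Lam_def even_parts_def using Lam_le[OF assms] by auto

lemma csize_even_parts: "csize 1 (n div 2) (even_parts n mu) = (\<Sum>i\<in>cls 2 n 0. mu i)"
  unfolding csize_def cls_1 sum_cls_even by (intro sum.cong) (auto simp: even_parts_def)

text \<open>For partitions this is the condition [mu]_1 = 0: rows come in equal pairs, and an
  unpaired last row is 0.\<close>

definition balanced :: "nat \<Rightarrow> (nat \<Rightarrow> nat) \<Rightarrow> bool" where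
  "balanced n mu \<longleftrightarrow> (\<forall>k\<in>{1..n div 2}. mu (2 * k - 1) = mu (2 * k)) \<and> (odd n \<longrightarrow> mu n = 0)"

text \<open>The alternating sum is a sum of nonnegative differences over pairs of consecutive rows,
  plus the last part for odd \<open>n\<close>; it is 0 only if every term is.\<close>

lemma even_sum_le:
  assumes mu: "mu \<in> Lam n"
  shows "(\<Sum>i\<in>cls 2 n 0. mu i) \<le> csize 2 n mu"
    and "(\<Sum>i\<in>cls 2 n 0. mu i) = csize 2 n mu \<Longrightarrow> balanced n mu"
proof -
  let ?m = "n div 2"
  have le: "mu (2 * k) \<le> mu (2 * k - 1)" if "k \<in> {1..?m}" for k
    using that by (intro Lam_le[OF mu]) auto
  have eq: "csize 2 n mu = (\<Sum>k=1..?m. mu (2 * k - 1)) + (if odd n then mu n else 0)"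
    unfolding csize_def by (rule sum_cls_odd)
  have le': "(\<Sum>k=1..?m. mu (2 * k)) \<le> (\<Sum>k=1..?m. mu (2 * k - 1))" using le by (intro sum_mono) auto
  then show "(\<Sum>i\<in>cls 2 n 0. mu i) \<le> csize 2 n mu" unfolding eq sum_cls_even by simp
  assume "(\<Sum>i\<in>cls 2 n 0. mu i) = csize 2 n mu"
  then have *: "(\<Sum>k=1..?m. mu (2 * k)) = (\<Sum>k=1..?m. mu (2 * k - 1))" "odd n \<longrightarrow> mu n = 0"
    using le' unfolding eq sum_cls_even by (auto split: if_splits)
  have "mu (2 * k - 1) = mu (2 * k)" if k: "k \<in> {1..?m}" for k
  proof (rule ccontr)
    assume "mu (2 * k - 1) \<noteq> mu (2 * k)"
    then have "mu (2 * k) < mu (2 * k - 1)" using le[OF k] by simp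
    then have "(\<Sum>k=1..?m. mu (2 * k)) < (\<Sum>k=1..?m. mu (2 * k - 1))"
      using le k by (intro sum_strict_mono_ex1) auto
    then show False using * by simp
  qed
  then show "balanced n mu" using * by (auto simp: balanced_def)
qed

lemma balanced_eqI:
  assumes "mu \<in> Lam n" "lam \<in> Lam n" "balanced n mu" "balanced n lam" "even_parts n mu = even_parts n lam"
  shows "mu = lam"
proof
  fix i
  have ev: "mu (2 * k) = lam (2 * k)" if "k \<in> {1..n div 2}" for k
    using fun_cong[OF assms(5), of k] that by (simp add: even_parts_def)
  have od: "mu (2 * k - 1) = lam (2 * k - 1)" if "k \<in> {1..n div 2}" for k
    using ev that assms(3,4) by (simp add: balanced_def)
  consider "i \<notin> {1..n}" | "i \<in> cls 2 n 0" | "i \<in> cls 2 n 1"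
    unfolding cls_def by (cases "even i") (auto simp: odd_iff_mod_2_eq_one)
  then show "mu i = lam i"
  proof cases
    case 1
    then show ?thesis using assms(1,2) by (auto simp: Lam_def)
  next
    case 2
    then show ?thesis unfolding cls_even using ev by auto
  next
    case 3
    then consider k where "k \<in> {1..n div 2}" "i = 2 * k - 1" | "odd n" "i = n"
      unfolding cls_odd by (auto split: if_splits)
    then show ?thesis
    proof cases
      case 1
      then show ?thesis using od by simp
    next
      case 2
      then show ?thesis using assms(3,4) by (simp add: balanced_def)
    qed
  qed
qed

lemma semisym_esym_shift:
  "semisym c n k (\<lambda>x. esym (cls c n q) k (\<lambda>i. x i + a)) (of_nat (card (cls c n q) choose k))"
proof -
  let ?I = "cls c n q"
  let ?M = "card ?I"
  have "semisym c n k (\<lambda>x. \<Sum>l\<le>min k ?M. shift_coeff ?M a k l * esym ?I l x)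
     (\<Sum>l\<le>min k ?M. if l = k then of_nat (?M choose k) else 0)"
  proof (rule semisym_sum)
    fix l assume l: "l \<in> {..min k ?M}"
    show "semisym c n k (\<lambda>x. shift_coeff ?M a k l * esym ?I l x) (if l = k then of_nat (?M choose k) else 0)"
    proof (cases "l = k")
      case True
      then show ?thesis using semisym_esym[of c n k q] by (simp add: shift_coeff_def)
    next
      case False
      then have "l < k" using l by simp
      from semisym_scale[OF semisym_mono[OF semisym_esym[of c n l q] this], of "shift_coeff ?M a k l"] False show ?thesis by simp
    qed
  qed
  moreover have "(\<Sum>l\<le>min k ?M. if l = k then of_nat (?M choose k) else 0) = (of_nat (?M choose k) :: 'a)"
    by (cases "k \<le> ?M") (auto simp: binomial_eq_0)
  ultimately show ?thesis by (simp add: esym_shift)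
qed

lemma semisym_transfer:
  assumes "semisym 1 (n div 2) d g v"
  shows "semisym 2 n d (\<lambda>x. g (\<lambda>k. x (2 * k) + a)) v"
  using assms
proof (induction rule: semisym.induct)
  case (semisym_esym k q)
  have "esym (cls 1 (n div 2) q) k (\<lambda>k. x (2 * k) + a) = esym (cls 2 n 0) k (\<lambda>i. x i + a)" for x
    unfolding esym_def cls_even cls_1 by (subst prod.reindex) (auto simp: inj_double)
  moreover have "card (cls 1 (n div 2) q) = card (cls 2 n 0)"
    unfolding cls_even cls_1 by (simp add: card_image inj_double)
  ultimately show ?case using semisym_esym_shift[of 2 n k 0 a] by simp
qed (auto intro: semisym.intros)

text \<open>Even coordinates of \<open>rho\<close> decrease in steps of 2 r and, for odd
  \<open>n\<close>, end in r instead of 0; hence the doubled parameter and the shift by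
  \<open>- r\<close>. At other partitions the even parts have total size at most |mu|, and equality
  forces \<open>mu\<close> to be balanced, so no foreign \<open>mu\<close> has the same even parts
  as \<open>lam\<close>.\<close>

lemma delta_fun_transfer:
  fixes r :: "'a::field_char_0"
  assumes lam: "lam \<in> Lam n" "balanced n lam"
    and g: "delta_fun 1 (n div 2) (of_nat 2 * r) (even_parts n lam) g v"
  shows "delta_fun 2 n r lam (\<lambda>x. g (\<lambda>k. x (2 * k) + (if odd n then - r else 0))) v"
proof -
  let ?m = "n div 2"
  let ?F = "\<lambda>x. g (\<lambda>k. x (2 * k) + (if odd n then - r else 0))"
  have bal_size: "csize 2 n lam = (\<Sum>i\<in>cls 2 n 0. lam i)"
    unfolding csize_def sum_cls_odd sum_cls_even using lam(2) by (auto simp: balanced_def)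
  then have size: "csize 1 ?m (even_parts n lam) = csize 2 n lam" using csize_even_parts by simp
  have semisym: "semisym 1 ?m (csize 2 n lam) g v" using g size by (simp add: delta_fun_def)
  have val: "?F (node n r mu) = g (node ?m (of_nat 2 * r) (even_parts n mu))" for mu
  proof (rule poly_fun_cong[OF semisym_poly_fun[OF semisym]])
    fix k assume k: "k \<in> {1..?m}"
    have e: "n - 2 * k = 2 * (?m - k) + (if odd n then 1 else 0)" using k by (auto elim!: evenE oddE)
    have "of_nat (2 * u + (if odd n then 1 else 0)) * r = of_nat u * (of_nat 2 * r) + (if odd n then r else 0)" for u
      by (simp add: algebra_simps)
    then have "of_nat (n - 2 * k) * r = of_nat (?m - k) * (of_nat 2 * r) + (if odd n then r else 0)"
      unfolding e .
    then have "rho n r (2 * k) + (if odd n then - r else 0) = rho ?m (of_nat 2 * r) k"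
      unfolding rho_def by simp
    moreover have "even_parts n mu k = mu (2 * k)" using k by (simp add: even_parts_def)
    ultimately show "node n r mu (2 * k) + (if odd n then - r else 0) = node ?m (of_nat 2 * r) (even_parts n mu) k"
      unfolding node_def by (simp add: add.commute add.left_commute)
  qed
  have "?F (node n r mu) = (if mu = lam then 1 else 0)" if mu: "mu \<in> Lam n" "csize 2 n mu \<le> csize 2 n lam" for mu
  proof -
    have h: "csize 1 ?m (even_parts n mu) \<le> csize 1 ?m (even_parts n lam)"
      unfolding size unfolding csize_even_parts using even_sum_le(1)[OF mu(1)] mu(2) by simp
    have "even_parts n mu = even_parts n lam \<longleftrightarrow> mu = lam"
    proof
      assume eq: "even_parts n mu = even_parts n lam"
      have "(\<Sum>i\<in>cls 2 n 0. mu i) = csize 2 n lam" using csize_even_parts[of n mu] eq size by simp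
      then have "(\<Sum>i\<in>cls 2 n 0. mu i) = csize 2 n mu" using even_sum_le(1)[OF mu(1)] mu(2) by simp
      then have "balanced n mu" by (rule even_sum_le(2)[OF mu(1)])
      then show "mu = lam" using balanced_eqI[OF mu(1) lam(1) _ lam(2) eq] by blast
    qed simp
    then show ?thesis unfolding val using g even_parts_Lam[OF mu(1)] h by (auto simp: delta_fun_def)
  qed
  then show ?thesis using semisym_transfer[OF semisym] unfolding delta_fun_def by blast
qed

section \<open>Merging pairs of equal rows in the product formula\<close>

lemma prod_double: "(\<Prod>j=1..2 * m. f j) = (\<Prod>k=1..m. f (2 * k - 1) * f (2 * k))" for f :: "nat \<Rightarrow> 'a::comm_monoid_mult"
  by (induction m) (simp_all add: mult.assoc)

lemma prod_double':
  fixes f :: "nat \<Rightarrow> 'a::comm_monoid_mult"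
  assumes "m \<ge> 1"
  shows "(\<Prod>j=1..<2 * m - 1. f j) = (\<Prod>k=1..<m. f (2 * k - 1) * f (2 * k))"
proof -
  obtain k where m: "m = Suc k" using assms by (cases m) auto
  have "{1..<2 * m - 1} = {1..2 * k}" "{1..<m} = {1..k}" using m by auto
  then show ?thesis using prod_double[of f k] by simp
qed

lemma prod_pairs_double:
  fixes H :: "nat \<Rightarrow> nat \<Rightarrow> 'a::comm_monoid_mult"
  shows "(\<Prod>l=1..2 * m. \<Prod>j=1..<l. H j l) =
    (\<Prod>l=1..m. H (2 * l - 1) (2 * l) * (\<Prod>j=1..<l. H (2 * j - 1) (2 * l - 1) * H (2 * j) (2 * l - 1) *
       (H (2 * j - 1) (2 * l) * H (2 * j) (2 * l))))"
  unfolding prod_double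
proof (intro prod.cong refl)
  fix l assume l: "l \<in> {1..m}"
  then have l1: "l \<ge> 1" by simp
  then have "{1..<2 * l} = insert (2 * l - 1) {1..<2 * l - 1}" by auto
  then have "(\<Prod>j=1..<2 * l. H j (2 * l)) = H (2 * l - 1) (2 * l) * (\<Prod>j=1..<2 * l - 1. H j (2 * l))" by simp
  then show "(\<Prod>j=1..<2 * l - 1. H j (2 * l - 1)) * (\<Prod>j=1..<2 * l. H j (2 * l)) =
    H (2 * l - 1) (2 * l) * (\<Prod>j=1..<l. H (2 * j - 1) (2 * l - 1) * H (2 * j) (2 * l - 1) *
       (H (2 * j - 1) (2 * l) * H (2 * j) (2 * l)))"
    unfolding prod_double'[OF l1] by (simp only: prod.distrib mult_ac)
qed

text \<open>Two merged pairs at distance \<open>e\<close> contain four pairs of rows, at distances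
  2e, 2e - 1, 2e + 1 and 2e. Their factors telescope to the single factor of stride 1 with parameter
  2 r.\<close>

lemma value_factor_block:
  fixes r :: "'a::field_char_0"
  assumes r: "allowed r" "r \<noteq> 0" and e: "e \<ge> 1"
  shows "value_factor 2 r (2 * e) D * value_factor 2 r (2 * e - 1) D * (value_factor 2 r (2 * e + 1) D * value_factor 2 r (2 * e) D) = value_factor 1 (of_nat 2 * r) e D"
proof -
  obtain k where k: "e = Suc k" using e by (cases e) auto
  define a where "a = pochhammer (of_nat (2 * e) * r) D"
  define b where "b = pochhammer (of_nat (2 * e) * r + 1) D"
  define p where "p = pochhammer (of_nat (2 * e + 2) * r) D"
  define q where "q = pochhammer (of_nat (2 * k) * r + 1) D"
  have nz: "a \<noteq> 0" "b \<noteq> 0"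
    unfolding a_def b_def using e by (intro pochhammer_mult_nonzero[OF r] pochhammer_allowed_nonzero[OF r(1)]; simp)+
  have 1: "value_factor 2 r (2 * e) D = b / a" by (simp add: value_factor_def B_factor_def norm_factor_def a_def b_def)
  have 2: "value_factor 2 r (2 * e - 1) D = a / q"
    by (simp add: value_factor_def B_factor_def norm_factor_def a_def q_def k mod2_eq_if)
  have 3: "value_factor 2 r (2 * e + 1) D = p / b"
    by (simp add: value_factor_def B_factor_def norm_factor_def p_def b_def mod2_eq_if)
  have 4: "value_factor 1 (of_nat 2 * r) e D = p / a / (q / b)"
    by (simp add: value_factor_def B_factor_def norm_factor_def a_def b_def p_def q_def k algebra_simps)
  show ?thesis unfolding 1 2 3 4 using nz by (simp add: mult.commute)
qed

text \<open>For odd \<open>n\<close>, the two factors that a pair of rows forms with the zero last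
  row convert its boundary factor into the one that belongs to \<open>n div 2\<close> variables and
  parameter 2 r.\<close>

lemma value_factor_end:
  fixes r :: "'a::field_char_0"
  assumes r: "allowed r" "r \<noteq> 0" and e: "e \<ge> 1"
  shows "value_factor 2 r (2 * e) D * value_factor 2 r (2 * e - 1) D / pochhammer (of_nat (2 * e) * r + 1) D =
    1 / pochhammer (of_nat (2 * (e - 1)) * r + 1) D"
proof -
  obtain k where k: "e = Suc k" using e by (cases e) auto
  define a where "a = pochhammer (of_nat (2 * e) * r) D"
  define b where "b = pochhammer (of_nat (2 * e) * r + 1) D"
  define q where "q = pochhammer (of_nat (2 * k) * r + 1) D"
  have nz: "a \<noteq> 0" "b \<noteq> 0"
    unfolding a_def b_def using e by (intro pochhammer_mult_nonzero[OF r] pochhammer_allowed_nonzero[OF r(1)]; simp)+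
  have 1: "value_factor 2 r (2 * e) D = b / a" by (simp add: value_factor_def B_factor_def norm_factor_def a_def b_def)
  have 2: "value_factor 2 r (2 * e - 1) D = a / q"
    by (simp add: value_factor_def B_factor_def norm_factor_def a_def q_def k mod2_eq_if)
  have 3: "e - 1 = k" by (simp add: k)
  show ?thesis unfolding 1 2 3 b_def[symmetric] q_def[symmetric] using nz by simp
qed

lemma prod_cls_even: "(\<Prod>i\<in>cls 2 n 0. f i) = (\<Prod>k=1..n div 2. f (2 * k))"
  unfolding cls_even by (subst prod.reindex) (auto simp: inj_on_def)

text \<open>Inside a merged pair the difference of parts is 0 and contributes 1. What remains are
  the blocks of \<open>value_factor_block\<close> and the boundary product; the parities of
  \<open>n\<close> differ only in the latter.\<close>

lemma delta_value_transfer: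
  fixes r :: "'a::field_char_0"
  assumes r: "allowed r" "r \<noteq> 0" and bal: "balanced n lam"
  shows "delta_value 2 n lam r = delta_value 1 (n div 2) (even_parts n lam) (of_nat 2 * r)"
proof -
  define m where "m = n div 2"
  define al where "al = even_parts n lam"
  have al: "lam (2 * k) = al k" "lam (2 * k - 1) = al k" if "k \<in> {1..m}" for k
    using that bal by (auto simp: al_def even_parts_def balanced_def m_def)
  let ?B = "\<lambda>j l. value_factor 2 r (2 * l - 1 - (2 * j - 1)) (lam (2 * j - 1) - lam (2 * l - 1)) *
       value_factor 2 r (2 * l - 1 - 2 * j) (lam (2 * j) - lam (2 * l - 1)) *
       (value_factor 2 r (2 * l - (2 * j - 1)) (lam (2 * j - 1) - lam (2 * l)) *
        value_factor 2 r (2 * l - 2 * j) (lam (2 * j) - lam (2 * l)))"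
  have pairs: "(\<Prod>l=1..2 * m. \<Prod>j=1..<l. value_factor 2 r (l - j) (lam j - lam l)) =
     (\<Prod>l=1..m. \<Prod>j=1..<l. value_factor 1 (of_nat 2 * r) (l - j) (al j - al l))"
    unfolding prod_pairs_double
  proof (intro prod.cong refl)
    fix l assume l: "l \<in> {1..m}"
    have "?B j l = value_factor 1 (of_nat 2 * r) (l - j) (al j - al l)"
      if j: "j \<in> {1..<l}" for j
    proof -
      have e: "2 * l - 1 - (2 * j - 1) = 2 * (l - j)" "2 * l - 1 - 2 * j = 2 * (l - j) - 1"
        "2 * l - (2 * j - 1) = 2 * (l - j) + 1" "2 * l - 2 * j = 2 * (l - j)" "l - j \<ge> 1"
        using j by auto
      have j': "j \<in> {1..m}" using j l by auto
      show ?thesis unfolding e(1-4) al[OF l] al[OF j'] by (rule value_factor_block[OF r e(5)])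
    qed
    then have "(\<Prod>j=1..<l. ?B j l) = (\<Prod>j=1..<l. value_factor 1 (of_nat 2 * r) (l - j) (al j - al l))"
      by (intro prod.cong refl)
    then show "value_factor 2 r (2 * l - (2 * l - 1)) (lam (2 * l - 1) - lam (2 * l)) *
      (\<Prod>j=1..<l. ?B j l) = (\<Prod>j=1..<l. value_factor 1 (of_nat 2 * r) (l - j) (al j - al l))"
      unfolding al[OF l] by simp
  qed
  have last: "(\<Prod>j\<in>cls 1 m m. pochhammer (of_nat (m - j) * (of_nat 2 * r) + 1) (al j)) =
     (\<Prod>k=1..m. pochhammer (of_nat (2 * (m - k)) * r + 1) (al k))"
    unfolding cls_1 by (intro prod.cong refl) (simp add: algebra_simps)
  have om1: "delta_value 1 m al (of_nat 2 * r) = (\<Prod>l=1..m. \<Prod>j=1..<l. value_factor 1 (of_nat 2 * r) (l - j) (al j - al l)) /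
     (\<Prod>k=1..m. pochhammer (of_nat (2 * (m - k)) * r + 1) (al k))"
    unfolding delta_value_def last ..
  show ?thesis
  proof (cases "even n")
    case True
    then have n: "n = 2 * m" by (simp add: m_def)
    have "cls 2 n n = cls 2 n 0" using True by (simp add: cls_def)
    then have "(\<Prod>j\<in>cls 2 n n. pochhammer (of_nat (n - j) * r + 1 :: 'a) (lam j)) =
       (\<Prod>k=1..m. pochhammer (of_nat (n - 2 * k) * r + 1) (lam (2 * k)))"
      by (simp add: prod_cls_even m_def)
    also have "\<dots> = (\<Prod>k=1..m. pochhammer (of_nat (2 * (m - k)) * r + 1) (al k))"
      by (intro prod.cong refl) (simp add: al n diff_mult_distrib2)
    finally have Z: "(\<Prod>j\<in>cls 2 n n. pochhammer (of_nat (n - j) * r + 1) (lam j)) =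
      (\<Prod>k=1..m. pochhammer (of_nat (2 * (m - k)) * r + 1) (al k))" .
    have "delta_value 2 n lam r = delta_value 1 m al (of_nat 2 * r)"
      unfolding om1 delta_value_def[of 2 n lam r] pairs[folded n] Z ..
    then show ?thesis by (simp add: m_def al_def)
  next
    case False
    then have n: "n = Suc (2 * m)" by (simp add: m_def)
    have ln: "lam n = 0" using bal False by (simp add: balanced_def)
    have cls_n: "cls 2 n n = cls 2 n 1" using False by (auto simp: cls_def mod2_eq_if)
    have inj: "inj_on (\<lambda>k. 2 * k - 1 :: nat) {1..m}" by (auto simp: inj_on_def)
    have nin: "n \<notin> (\<lambda>k. 2 * k - 1) ` {1..m}" by (auto simp: n)
    have Z: "(\<Prod>j\<in>cls 2 n n. pochhammer (of_nat (n - j) * r + 1) (lam j)) =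
       (\<Prod>k=1..m. pochhammer (of_nat (2 * (m - k + 1)) * r + 1) (al k))"
    proof -
      have "(\<Prod>j\<in>cls 2 n n. pochhammer (of_nat (n - j) * r + 1) (lam j)) =
        (\<Prod>j\<in>(\<lambda>k. 2 * k - 1) ` {1..m}. pochhammer (of_nat (n - j) * r + 1) (lam j))"
        unfolding cls_n cls_odd m_def[symmetric] using False nin ln by simp
      also have "\<dots> = (\<Prod>k=1..m. pochhammer (of_nat (n - (2 * k - 1)) * r + 1) (lam (2 * k - 1)))"
        by (subst prod.reindex[OF inj]) simp
      also have "\<dots> = (\<Prod>k=1..m. pochhammer (of_nat (2 * (m - k + 1)) * r + 1) (al k))"
      proof (intro prod.cong refl)
        fix k assume k: "k \<in> {1..m}"
        then have "n - (2 * k - 1) = 2 * (m - k + 1)" by (auto simp: n)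
        then show "pochhammer (of_nat (n - (2 * k - 1)) * r + 1) (lam (2 * k - 1)) = pochhammer (of_nat (2 * (m - k + 1)) * r + 1) (al k)"
          using al[OF k] by simp
      qed
      finally show ?thesis .
    qed
    have E: "(\<Prod>j=1..<n. value_factor 2 r (n - j) (lam j - lam n)) =
      (\<Prod>k=1..m. value_factor 2 r (2 * (m - k + 1)) (al k) * value_factor 2 r (2 * (m - k + 1) - 1) (al k))"
    proof -
      have "{1..<n} = {1..2 * m}" using n by auto
      then have "(\<Prod>j=1..<n. value_factor 2 r (n - j) (lam j - lam n)) =
        (\<Prod>k=1..m. value_factor 2 r (n - (2 * k - 1)) (lam (2 * k - 1)) * value_factor 2 r (n - 2 * k) (lam (2 * k)))"
        by (simp only: prod_double ln diff_zero)
      also have "\<dots> = (\<Prod>k=1..m. value_factor 2 r (2 * (m - k + 1)) (al k) * value_factor 2 r (2 * (m - k + 1) - 1) (al k))"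
      proof (intro prod.cong refl)
        fix k assume k: "k \<in> {1..m}"
        then have "n - (2 * k - 1) = 2 * (m - k + 1)" "n - 2 * k = 2 * (m - k + 1) - 1" by (auto simp: n)
        then show "value_factor 2 r (n - (2 * k - 1)) (lam (2 * k - 1)) * value_factor 2 r (n - 2 * k) (lam (2 * k)) =
          value_factor 2 r (2 * (m - k + 1)) (al k) * value_factor 2 r (2 * (m - k + 1) - 1) (al k)"
          using al[OF k] by simp
      qed
      finally show ?thesis .
    qed
    have "(\<Prod>j=1..<n. value_factor 2 r (n - j) (lam j - lam n)) / (\<Prod>j\<in>cls 2 n n. pochhammer (of_nat (n - j) * r + 1) (lam j)) =
      (\<Prod>k=1..m. value_factor 2 r (2 * (m - k + 1)) (al k) * value_factor 2 r (2 * (m - k + 1) - 1) (al k) / pochhammer (of_nat (2 * (m - k + 1)) * r + 1) (al k))"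
      unfolding E Z by (simp add: prod_dividef)
    also have "\<dots> = (\<Prod>k=1..m. 1 / pochhammer (of_nat (2 * (m - k)) * r + 1) (al k))"
    proof (intro prod.cong refl)
      fix k
      have "value_factor 2 r (2 * (m - k + 1)) (al k) * value_factor 2 r (2 * (m - k + 1) - 1) (al k) / pochhammer (of_nat (2 * (m - k + 1)) * r + 1) (al k) =
        1 / pochhammer (of_nat (2 * (m - k + 1 - 1)) * r + 1) (al k)"
        by (rule value_factor_end[OF r]) simp
      then show "value_factor 2 r (2 * (m - k + 1)) (al k) * value_factor 2 r (2 * (m - k + 1) - 1) (al k) / pochhammer (of_nat (2 * (m - k + 1)) * r + 1) (al k) =
        1 / pochhammer (of_nat (2 * (m - k)) * r + 1) (al k)"
        by (simp only: add_diff_cancel_right')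
    qed
    also have "\<dots> = 1 / (\<Prod>k=1..m. pochhammer (of_nat (2 * (m - k)) * r + 1) (al k))"
      by (simp add: prod_dividef)
    finally have fin: "(\<Prod>j=1..<n. value_factor 2 r (n - j) (lam j - lam n)) / (\<Prod>j\<in>cls 2 n n. pochhammer (of_nat (n - j) * r + 1) (lam j)) =
      1 / (\<Prod>k=1..m. pochhammer (of_nat (2 * (m - k)) * r + 1) (al k))" .
    have "(\<Prod>l=1..n. \<Prod>j=1..<l. value_factor 2 r (l - j) (lam j - lam l)) =
      (\<Prod>l=1..2 * m. \<Prod>j=1..<l. value_factor 2 r (l - j) (lam j - lam l)) * (\<Prod>j=1..<n. value_factor 2 r (n - j) (lam j - lam n))"
      unfolding n by simp
    then have "delta_value 2 n lam r = (\<Prod>l=1..2 * m. \<Prod>j=1..<l. value_factor 2 r (l - j) (lam j - lam l)) *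
       ((\<Prod>j=1..<n. value_factor 2 r (n - j) (lam j - lam n)) / (\<Prod>j\<in>cls 2 n n. pochhammer (of_nat (n - j) * r + 1) (lam j)))"
      unfolding delta_value_def[of 2 n lam r] by (simp only: times_divide_eq_right)
    also have "\<dots> = delta_value 1 m al (of_nat 2 * r)"
      unfolding fin pairs om1 by (simp only: times_divide_eq_right mult_1_right)
    finally show ?thesis by (simp add: m_def al_def)
  qed
qed

lemma alt_size_zero_iff_balanced:
  assumes "lam \<in> Lam n" "alt_size 2 n lam = (0::'a::field_char_0)"
  shows "balanced n lam"
proof -
  have "(\<Sum>i\<in>cls 2 n 0. lam i) = csize 2 n lam" using assms(2) by (simp add: alt_size_def flip: of_nat_sum)
  then show ?thesis by (rule even_sum_le(2)[OF assms(1)])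
qed

lemma delta_fun_symbol_balanced:
  fixes r :: "'a::field_char_0"
  assumes r: "allowed r" "r \<noteq> 0" and lam: "lam \<in> Lam n" "balanced n lam" and f: "delta_fun 2 n r lam f v"
  shows "v = delta_value 2 n lam r"
proof -
  have r2: "allowed (of_nat 2 * r)" "of_nat 2 * r \<noteq> 0" using allowed_double[OF r(1)] r(2) by auto
  obtain g w where g: "delta_fun 1 (n div 2) (of_nat 2 * r) (even_parts n lam) g w"
    using delta_fun_exists[of 1 "of_nat 2 * r" "n div 2" "even_parts n lam"] r2(1) by auto
  have w: "w = delta_value 1 (n div 2) (even_parts n lam) (of_nat 2 * r)"
    by (rule delta_fun_symbol_1[OF r2 even_parts_Lam[OF lam(1)] g])
  let ?F = "\<lambda>x. g (\<lambda>k. x (2 * k) + (if odd n then - r else 0))"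
  have F: "delta_fun 2 n r lam ?F w" by (rule delta_fun_transfer[OF lam g])
  have c: "(2::nat) = 1 \<or> (2::nat) = 2" by simp
  have semisym: "semisym 2 n (csize 2 n lam) f v" "semisym 2 n (csize 2 n lam) ?F w" using f F by (auto simp: delta_fun_def)
  have eq: "f = ?F"
    by (rule semisym_vanish_unique[OF c r(1) semisym]) (use f F in \<open>auto simp: delta_fun_def\<close>)
  have "v = w" by (rule semisym_symbol_unique[OF semisym]) (rule fun_cong[OF eq])
  then show ?thesis using w delta_value_transfer[OF r lam(2)] by simp
qed

lemma delta_fun_symbol_2:
  fixes r :: "'a::field_char_0"
  assumes r: "allowed r" "r \<noteq> 0" and n: "n \<ge> 1" and lam: "lam \<in> Lam n" and f: "delta_fun 2 n r lam f v"
  shows "v = (if odd n \<or> alt_size 2 n lam = (0::'a) then delta_value 2 n lam r else 0)"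
proof -
  have c: "(2::nat) = 1 \<or> (2::nat) = 2" by simp
  consider "alt_size 2 n lam = (0::'a)" | "odd n" | "even n" "alt_size 2 n lam \<noteq> (0::'a)" by blast
  then show ?thesis
  proof cases
    case 1
    then show ?thesis using delta_fun_symbol_balanced[OF r lam alt_size_zero_iff_balanced[OF lam 1] f] by simp
  next
    case 2
    obtain F0 V0 where FV: "\<And>nu. delta_fun 2 n r nu (F0 nu) (V0 nu)"
      using delta_fun_exists[OF c r(1)] by metis
    define F where "F = F0(lam := f)"
    define V where "V = V0(lam := v)"
    have d: "delta_fun 2 n r nu (F nu) (V nu)" for nu using FV f by (simp add: F_def V_def)
    have "V lam = delta_value 2 n lam r"
    proof (rule delta_fun_symbol[OF c n _ r d _ lam])
      show "n mod 2 = 1 mod 2" using 2 by (simp add: mod2_eq_if)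
      fix nu assume nu: "nu \<in> Lam n" "alt_size 2 n nu = (0::'a)"
      show "V nu = delta_value 2 n nu r"
        by (rule delta_fun_symbol_balanced[OF r nu(1) alt_size_zero_iff_balanced[OF nu] d])
    qed
    then show ?thesis using 2 by (simp add: V_def)
  next
    case 3
    have semisym: "semisym 2 n (csize 2 n lam) f v" using f by (simp add: delta_fun_def)
    obtain g where g: "semisym 2 n (csize 2 n lam) g 0"
      "\<And>x. inj_on x (cls 2 n 1) \<Longrightarrow> g x = (\<Sum>i\<in>cls 2 n 1. lower_coeff 2 n r x i * (f x - f (x(i := x i - 1))))"
      using operator_even[OF n 3(1) r(2) semisym] by blast
    \<comment> \<open>The image has top value 0 by \<open>operator_even\<close>, yet it is the
      eigenvalue times \<open>f\<close>; a nonzero eigenvalue leaves only \<open>v\<close> =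
      0.\<close>
    have "0 = (\<Sum>i\<in>cls 2 n 1. lower_coeff 2 n r (node n r lam) i) * v"
      by (rule delta_fun_eigen[OF c r lam f g])
    then show ?thesis using 3 sum_lower_coeff_value[OF c n r lam] by simp
  qed
qed

section \<open>Evaluation of the top component\<close>

text \<open>The boundary products and the factors \<open>norm_factor\<close> cancel; passing from
  the interpolation function to the monomial normalisation thus leaves only
  \<open>B_factor\<close>.\<close>

lemma norm_const_mult_delta_value:
  fixes r :: "'a::field_char_0"
  assumes r: "allowed r"
  shows "norm_const c n lam r * delta_value c n lam r = (\<Prod>l=1..n. \<Prod>j=1..<l. B_factor c r (l - j) (lam j - lam l))"
proof -
  have nz: "norm_factor c r e D \<noteq> 0" for e D
    using pochhammer_allowed_nonzero[OF r] by (auto simp: norm_factor_def simp del: of_nat_diff)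
  have Z: "(\<Prod>j\<in>cls c n n. pochhammer (of_nat (n - j) * r + 1) (lam j)) \<noteq> 0"
    using pochhammer_allowed_nonzero[OF r] by (auto simp: prod_zero_iff)
  have "(\<Prod>l=1..n. \<Prod>j=1..<l. norm_factor c r (l - j) (lam j - lam l)) * (\<Prod>l=1..n. \<Prod>j=1..<l. value_factor c r (l - j) (lam j - lam l)) =
      (\<Prod>l=1..n. \<Prod>j=1..<l. B_factor c r (l - j) (lam j - lam l))"
    unfolding prod.distrib[symmetric] value_factor_def by (intro prod.cong refl) (simp add: nz)
  then show ?thesis unfolding norm_const_def delta_value_def using Z by simp
qed

lemma prod_pairs_filter:
  fixes f :: "nat \<Rightarrow> nat \<Rightarrow> 'b::comm_monoid_mult"
  shows "(\<Prod>(i, j)\<in>{(i, j)\<in>{1..n} \<times> {1..n}. i < j \<and> P (j - i)}. f i j) =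
    (\<Prod>j=1..n. \<Prod>i=1..<j. if P (j - i) then f i j else 1)"
proof -
  have "{(i, j)\<in>{1..n} \<times> {1..n}. i < j \<and> P (j - i)} = {x \<in> {1..n} \<times> {1..n}. fst x < snd x \<and> P (snd x - fst x)}"
    by auto
  then have "(\<Prod>(i, j)\<in>{(i, j)\<in>{1..n} \<times> {1..n}. i < j \<and> P (j - i)}. f i j) =
    (\<Prod>x\<in>{1..n} \<times> {1..n}. if fst x < snd x \<and> P (snd x - fst x) then f (fst x) (snd x) else 1)"
    by (simp only: prod.inter_filter[OF finite_cartesian_product[OF finite_atLeastAtMost finite_atLeastAtMost]] case_prod_unfold)
  also have "\<dots> = (\<Prod>i=1..n. \<Prod>j=1..n. if i < j \<and> P (j - i) then f i j else 1)"
    by (simp only: prod.cartesian_product case_prod_unfold)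
  also have "\<dots> = (\<Prod>j=1..n. \<Prod>i=1..n. if i < j \<and> P (j - i) then f i j else 1)"
    by (rule prod.swap)
  also have "\<dots> = (\<Prod>j=1..n. \<Prod>i=1..<j. if P (j - i) then f i j else 1)"
    by (intro prod.cong refl prod.mono_neutral_cong_right) auto
  finally show ?thesis .
qed

lemma B_expr_eq:
  fixes r :: "'a::field_char_0"
  shows "B_expr n lam r = (\<Prod>l=1..n. \<Prod>j=1..<l. B_factor 2 r (l - j) (lam j - lam l))"
proof -
  have 1: "(\<Prod>l=1..n. \<Prod>j=1..<l. if odd (l - j) then pochhammer (of_nat (l - j + 1) * r) (lam j - lam l) else 1) =
      (\<Prod>l=1..n. \<Prod>j=1..<l. if (l - j) mod 2 = 1 mod 2 then pochhammer (of_nat (l - j + 1) * r) (lam j - lam l) else 1)"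
    by (intro prod.cong refl) (simp only: odd_iff_mod_2_eq_one mod_less one_less_numeral_iff semiring_norm)
  have 2: "(\<Prod>l=1..n. \<Prod>j=1..<l. if even (l - j) then pochhammer (of_nat (l - j) * r) (lam j - lam l) else 1) =
      (\<Prod>l=1..n. \<Prod>j=1..<l. if (l - j) mod 2 = 0 then pochhammer (of_nat (l - j) * r) (lam j - lam l) else 1)"
    by (intro prod.cong refl) (simp only: even_iff_mod_2_eq_zero)
  show ?thesis
    unfolding B_expr_def prod_pairs_filter[where P = odd] prod_pairs_filter[where P = even] 1 2 B_factor_def prod_dividef ..
qed

lemma alt_size_eq_bracket: "alt_size 2 n lam = (of_int (bracket n lam 1) :: 'a::field_char_0)"
proof -
  have "bracket n lam 1 = (\<Sum>j=1..n. (if j mod 2 = 1 mod 2 then int (lam j) else 0) - (if j mod 2 = 0 mod 2 then int (lam j) else 0))"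
    unfolding bracket_def
  proof (intro sum.cong refl)
    fix j assume "j \<in> {1..n}"
    then obtain k where "j = Suc k" by (cases j) auto
    then show "(- 1) ^ (j - 1) * int (lam j) =
      (if j mod 2 = 1 mod 2 then int (lam j) else 0) - (if j mod 2 = 0 mod 2 then int (lam j) else 0)"
      by (cases "even k") (auto simp: mod2_eq_if)
  qed
  also have "\<dots> = (\<Sum>j\<in>cls 2 n 1. int (lam j)) - (\<Sum>j\<in>cls 2 n 0. int (lam j))"
    unfolding sum_subtractf cls_def by (subst (1 2) sum.inter_filter) auto
  finally show ?thesis by (simp add: alt_size_def csize_def)
qed

section \<open>Permutation of variables and identification with the semisymmetric
  polynomials\<close>

lemma lookup_map_key: "inj p \<Longrightarrow> Poly_Mapping.lookup (Poly_Mapping.map_key p m) i = Poly_Mapping.lookup m (p i)"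
  by (simp add: map_key.rep_eq)

lemma inj_map_key:
  assumes "bij p"
  shows "inj (Poly_Mapping.map_key p :: (_ \<Rightarrow>\<^sub>0 'a::zero) \<Rightarrow> _)"
proof (rule injI, rule poly_mapping_eqI)
  fix m m' :: "_ \<Rightarrow>\<^sub>0 'a" and k
  assume "Poly_Mapping.map_key p m = Poly_Mapping.map_key p m'"
  then have "Poly_Mapping.lookup m (p i) = Poly_Mapping.lookup m' (p i)" for i
    using lookup_map_key[OF bij_is_inj[OF assms]] by metis
  moreover obtain i where "k = p i" using bij_is_surj[OF assms] by (metis surjD)
  ultimately show "Poly_Mapping.lookup m k = Poly_Mapping.lookup m' k" by simp
qed

text \<open>Reindexing exponent vectors by the bijection that \<open>p\<close> induces on them
  translates invariance of formal polynomials into invariance of functions.\<close>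

lemma eval_permute_vars:
  assumes "bij p"
  shows "eval_mpoly x (permute_vars p q) = eval_mpoly (x \<circ> p) q"
proof -
  let ?f = "Poly_Mapping.map_key p :: (nat \<Rightarrow>\<^sub>0 nat) \<Rightarrow> nat \<Rightarrow>\<^sub>0 nat"
  have inj: "inj p" and surj: "surj p" using assms by (auto simp: bij_def)
  note injf = inj_map_key[OF assms, where 'a = nat]
  have surjf: "surj ?f"
  proof (rule surjI)
    fix m :: "nat \<Rightarrow>\<^sub>0 nat"
    have "inj (inv p)" using assms by (simp add: bij_imp_bij_inv bij_is_inj)
    then show "?f (Poly_Mapping.map_key (inv p) m) = m"
      using inj by (simp add: map_key_compose comp_def map_key_id)
  qed
  have mv: "mono_val x m = mono_val (x \<circ> p) (?f m)" for m
  proof -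
    have "Poly_Mapping.keys m = p ` Poly_Mapping.keys (?f m)"
      unfolding keys_map_key[OF inj] using surj by (simp add: surj_image_vimage_eq)
    then show ?thesis unfolding mono_val_def using inj
      by (simp add: prod.reindex inj_on_def inj_def lookup_map_key)
  qed
  have "eval_mpoly x (permute_vars p q) = (\<Sum>m\<in>?f -` Poly_Mapping.keys q. Poly_Mapping.lookup q (?f m) * mono_val (x \<circ> p) (?f m))"
    unfolding eval_mpoly_def mono_val_def[symmetric] permute_vars_def keys_map_key[OF injf] lookup_map_key[OF injf] mv ..
  also have "\<dots> = (\<Sum>k\<in>?f ` (?f -` Poly_Mapping.keys q). Poly_Mapping.lookup q k * mono_val (x \<circ> p) k)"
    by (subst sum.reindex) (use injf in \<open>auto simp: inj_on_def inj_def\<close>)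
  also have "?f ` (?f -` Poly_Mapping.keys q) = Poly_Mapping.keys q"
    using surjf by (rule surj_image_vimage_eq)
  finally show ?thesis by (simp add: eval_mpoly_def mono_val_def)
qed

lemma permute_vars_poly_ring:
  assumes p: "p permutes {1..n}" and q: "q \<in> poly_ring n"
  shows "permute_vars p q \<in> poly_ring n"
proof -
  have "Poly_Mapping.keys m \<subseteq> {1..n}" if "Poly_Mapping.map_key p m \<in> Poly_Mapping.keys q" for m
  proof
    fix i assume i: "i \<in> Poly_Mapping.keys m"
    have "inv p i \<in> Poly_Mapping.keys (Poly_Mapping.map_key p m)"
      using i permutes_inverses(1)[OF p, of i] by (simp add: in_keys_iff lookup_map_key[OF permutes_inj[OF p]])
    moreover have "Poly_Mapping.keys (Poly_Mapping.map_key p m) \<subseteq> {1..n}"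
      using that q unfolding poly_ring_def by blast
    ultimately have "inv p i \<in> {1..n}" by blast
    then show "i \<in> {1..n}" using permutes_in_image[OF p, of "inv p i"] permutes_inverses(1)[OF p, of i] by simp
  qed
  then show ?thesis
    unfolding poly_ring_def permute_vars_def mem_Collect_eq keys_map_key[OF inj_map_key[OF permutes_bij[OF p]]] by blast
qed

lemma W_group_bij_cls:
  assumes "p \<in> W_group n"
  shows "bij_betw p (cls 2 n q) (cls 2 n q)"
proof -
  have p: "p permutes {1..n}" "\<And>i. i \<in> {1..n} \<Longrightarrow> p i mod 2 = i mod 2" using assms by (auto simp: W_group_def)
  have "inj_on p (cls 2 n q)" using permutes_inj_on[OF p(1)] .
  moreover have "p ` cls 2 n q \<subseteq> cls 2 n q"
  proof
    fix j assume "j \<in> p ` cls 2 n q"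
    then obtain i where "i \<in> {1..n}" "i mod 2 = q mod 2" "j = p i" by (auto simp: cls_def)
    then show "j \<in> cls 2 n q" using p(2)[of i] permutes_in_image[OF p(1), of i] by (simp add: cls_def)
  qed
  ultimately have "p ` cls 2 n q = cls 2 n q" by (intro card_subset_eq) (auto simp: card_image)
  then show ?thesis using \<open>inj_on p (cls 2 n q)\<close> by (simp add: bij_betw_def)
qed

lemma semisym_W_invariants:
  fixes p :: "'a::field_char_0 mpoly"
  assumes f: "semisym 2 n d f v" and p: "p \<in> poly_ring n" "\<And>x. eval_mpoly x p = f x"
  shows "p \<in> W_invariants n"
  unfolding W_invariants_def mem_Collect_eq
proof (intro conjI ballI p(1))
  fix w assume w: "w \<in> W_group n"
  then have perm: "w permutes {1..n}" by (simp add: W_group_def)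
  show "permute_vars w p = p"
  proof (rule eval_mpoly_eqI[OF permute_vars_poly_ring[OF perm p(1)] p(1)])
    fix x
    show "eval_mpoly x (permute_vars w p) = eval_mpoly x p"
      unfolding eval_permute_vars[OF permutes_bij[OF perm]] p(2)
      by (rule semisym_permute[OF f W_group_bij_cls[OF w]])
  qed
qed

lemma W_invariants_csym:
  fixes p :: "'a::field_char_0 mpoly"
  assumes "p \<in> W_invariants n"
  shows "csym 2 n (\<lambda>x. eval_mpoly x p)"
  unfolding csym_def
proof (intro ballI impI allI)
  fix i j and x :: "nat \<Rightarrow> 'a" assume ij: "i \<in> {1..n}" "j \<in> {1..n}" "i mod 2 = j mod 2"
  let ?t = "Transposition.transpose i j"
  have perm: "?t permutes {1..n}" using ij by (simp add: permutes_swap_id)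
  have "?t k mod 2 = k mod 2" for k using ij(3) by (auto simp: Transposition.transpose_def)
  then have "?t \<in> W_group n" using perm by (simp add: W_group_def)
  then have "permute_vars ?t p = p" using assms by (auto simp: W_invariants_def)
  then show "eval_mpoly (x \<circ> ?t) p = eval_mpoly x p"
    using eval_permute_vars[OF permutes_bij[OF perm], of x p] by simp
qed

text \<open>\<open>R_poly\<close> is a definite description, so existence and uniqueness must both
  be shown. \<open>bracket_coeff\<close> exchanges the coefficient 1 of the bracket monomial for the
  value \<open>?N\<close> at the node of \<open>lam\<close>.\<close>

lemma R_poly_delta_fun:
  fixes r :: "'a::field_char_0"
  assumes r: "allowed r" and lam: "lam \<in> Lam n" and f: "delta_fun 2 n r lam f v"
  shows "eval_mpoly x (R_poly n r lam) = norm_const 2 n lam r * f x"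
proof -
  have c: "(2::nat) = 1 \<or> (2::nat) = 2" by simp
  let ?d = "odd_size n lam"
  let ?N = "norm_const 2 n lam r"
  have N: "?N \<noteq> 0" by (rule norm_const_nonzero[OF c r lam])
  have semisym: "semisym 2 n ?d (\<lambda>x. ?N * f x) (?N * v)"
    using f by (intro semisym_scale) (simp add: delta_fun_def odd_size_eq)
  obtain p where p: "p \<in> poly_ring n" "deg_le ?d p" "\<And>x. eval_mpoly x p = ?N * f x"
    using poly_fun_imp_mpoly[OF semisym_poly_fun[OF semisym]] by blast
  have van: "eval_mpoly (node n r mu) p = 0" if "mu \<in> Lam n" "odd_size n mu \<le> ?d" "mu \<noteq> lam" for mu
    using f that by (simp add: p(3) delta_fun_def odd_size_eq)
  have "eval_mpoly (node n r lam) p = ?N" using f lam by (simp add: p(3) delta_fun_def)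
  moreover have "csym 2 n (\<lambda>x. eval_mpoly x p)" unfolding p(3) by (rule semisym_csym[OF semisym])
  ultimately have lk: "Poly_Mapping.lookup p (bracket_mono n lam) = 1"
    using bracket_coeff[OF r lam p(1,2) _ van] N by simp
  \<comment> \<open>The degree cannot drop, since the bracket monomial has degree \<open>?d\<close>
    and coefficient 1.\<close>
  have deg: "total_deg p = ?d"
  proof (rule antisym)
    show "total_deg p \<le> ?d" using p(2) by (simp add: deg_le_iff)
    have "bracket_mono n lam \<in> Poly_Mapping.keys p" using lk by (simp add: in_keys_iff)
    then have "mono_deg (bracket_mono n lam) \<le> total_deg p"
      unfolding total_deg_def by (intro Max_ge) auto
    then show "?d \<le> total_deg p" using bracket_mono_props[OF lam] by simp
  qed
  have R: "is_R_poly n r lam p"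
    unfolding is_R_poly_def using semisym_W_invariants[OF semisym p(1,3)] deg lk van
    by (auto simp: node_def)
  \<comment> \<open>The normalisation forces the value \<open>?N\<close> of \<open>q\<close> at the
    node of \<open>lam\<close>, so \<open>q\<close> and \<open>?N * f\<close> agree at all nodes up
    to the degree.\<close>
  have "q = p" if q: "is_R_poly n r lam q" for q
  proof -
    have q1: "q \<in> W_invariants n" "q \<in> poly_ring n" "deg_le ?d q"
      using q by (auto simp: is_R_poly_def W_invariants_def deg_le_iff)
    have qv: "eval_mpoly (node n r mu) q = 0" if "mu \<in> Lam n" "odd_size n mu \<le> ?d" "mu \<noteq> lam" for mu
      using q that by (auto simp: is_R_poly_def node_def)
    have qlam: "eval_mpoly (node n r lam) q = ?N"
      using bracket_coeff[OF r lam q1(2,3) W_invariants_csym[OF q1(1)] qv] q by (simp add: is_R_poly_def)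
    have pf: "poly_fun n ?d (\<lambda>x. eval_mpoly x q - ?N * f x)"
      by (rule poly_fun_diff[OF mpoly_imp_poly_fun[OF q1(2,3)] semisym_poly_fun[OF semisym]])
    have cs: "csym 2 n (\<lambda>x. eval_mpoly x q - ?N * f x)"
      using W_invariants_csym[OF q1(1)] semisym_csym[OF semisym] unfolding csym_def by simp
    have "eval_mpoly x q - ?N * f x = 0" for x
    proof (rule csym_vanish_imp_zero[OF c r pf cs])
      fix mu assume mu: "mu \<in> Lam n" "csize 2 n mu \<le> ?d"
      show "eval_mpoly (node n r mu) q - ?N * f (node n r mu) = 0"
        using mu f qv[of mu] qlam by (cases "mu = lam") (auto simp: delta_fun_def odd_size_eq)
    qed
    then show "q = p" using q1(2) p by (intro eval_mpoly_eqI) auto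
  qed
  then have "R_poly n r lam = p" unfolding R_poly_def using R by (intro the_equality)
  then show ?thesis using p(3) by simp
qed

lemma R_top_delta_fun:
  fixes r :: "'a::field_char_0"
  assumes r: "allowed r" and lam: "lam \<in> Lam n" and f: "delta_fun 2 n r lam f v"
  shows "eval_mpoly (\<lambda>_. 1) (R_top n r lam) = norm_const 2 n lam r * v"
proof -
  have "semisym 2 n (odd_size n lam) (\<lambda>x. norm_const 2 n lam r * f x) (norm_const 2 n lam r * v)"
    using f by (intro semisym_scale) (simp add: delta_fun_def odd_size_eq)
  from semisym_diag[OF this] obtain P where P: "\<forall>t. poly P t = norm_const 2 n lam r * f (\<lambda>i. t)" "coeff P (odd_size n lam) = norm_const 2 n lam r * v"
    by blast
  show ?thesis unfolding R_top_def P(2)[symmetric]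
    by (rule mpoly_diag) (simp add: P(1) R_poly_delta_fun[OF assms])
qed

lemma R_top_nonzero:
  fixes r :: "'a::field_char_0"
  assumes n: "n \<ge> 1" and r: "allowed r" "r \<noteq> 0" and lam: "lam \<in> Lam n"
  shows "eval_mpoly (\<lambda>_. 1) (R_top n r lam) = (if odd n \<or> bracket n lam 1 = 0 then B_expr n lam r else 0)"
proof -
  have c: "(2::nat) = 1 \<or> (2::nat) = 2" by simp
  obtain f v where f: "delta_fun 2 n r lam f v" using delta_fun_exists[OF c r(1)] by blast
  have "v = (if odd n \<or> bracket n lam 1 = 0 then delta_value 2 n lam r else 0)"
    using delta_fun_symbol_2[OF r n lam f] by (simp add: alt_size_eq_bracket)
  then show ?thesis
    unfolding R_top_delta_fun[OF r(1) lam f] B_expr_eq norm_const_mult_delta_value[OF r(1), symmetric] by simp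
qed

section \<open>Passage to the parameter 0\<close>

lemma allowed_of_nat: "allowed (of_nat k)"
  unfolding allowed_def
proof
  assume "\<exists>q::rat. q < 0 \<and> (of_nat k :: 'a) = of_rat q"
  then obtain q :: rat where q: "q < 0" "(of_nat k :: 'a) = of_rat q" by blast
  then have "of_rat (of_nat k) = (of_rat q :: 'a)" by simp
  then have "q = of_nat k" by (simp only: of_rat_eq_iff)
  then show False using q(1) by simp
qed

lemma allowed_0: "allowed 0"
  using allowed_of_nat[of 0] by simp

text \<open>The positive integers serve as infinitely many nonzero admissible parameters, available
  in every field of characteristic 0.\<close>

lemma poly_eqI_of_nat:
  fixes P Q :: "'a::field_char_0 poly"
  assumes "\<And>k. poly P (of_nat (Suc k)) = poly Q (of_nat (Suc k))"
  shows "P = Q"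
proof (rule ccontr)
  assume "P \<noteq> Q"
  then have "finite {t. poly (P - Q) t = 0}" by (intro poly_roots_finite) simp
  moreover have "range (\<lambda>k. of_nat (Suc k)) \<subseteq> {t. poly (P - Q) t = 0}" using assms by auto
  ultimately have "finite (range (\<lambda>k. of_nat (Suc k) :: 'a))" by (rule finite_subset[rotated])
  moreover have "inj (\<lambda>k. of_nat (Suc k) :: 'a)" by (auto simp: inj_def)
  ultimately show False using finite_imageD by blast
qed

lemma regular_pochhammer: "regular f \<Longrightarrow> regular (\<lambda>r. pochhammer (f r) k)"
  by (induction k) (auto simp: pochhammer_Suc intro!: regular_const regular_mult regular_add)

lemma regular_norm_const: "regular (\<lambda>r::'a::field_char_0. norm_const c n lam r)"
proof -
  have p: "regular (\<lambda>r::'a. pochhammer (of_nat e * r + 1) D)" for e D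
    by (intro regular_pochhammer regular_add regular_mult regular_const regular_id)
  have regular_if: "regular (\<lambda>r. if C then f r else 1)" if "regular f" for C and f :: "'a \<Rightarrow> 'a"
    using that by (cases C) (simp_all add: regular_const)
  have "regular (\<lambda>r::'a. norm_factor c r e D)" for e D
    unfolding norm_factor_def
    by (rule regular_divide) (auto intro: p regular_if simp: pochhammer_allowed_nonzero simp del: of_nat_diff)
  then show ?thesis unfolding norm_const_def by (intro regular_mult regular_prod p)
qed

text \<open>Formed over a commutative ring, so that it makes sense at the indeterminate of a
  polynomial ring, where the quotient \<open>B_expr\<close> does not exist.\<close>

definition B_num :: "nat \<Rightarrow> (nat \<Rightarrow> nat) \<Rightarrow> 'b::comm_ring_1 \<Rightarrow> 'b" where
  "B_num n lam x = (\<Prod>(i, j)\<in>{(i, j)\<in>{1..n} \<times> {1..n}. i < j \<and> odd (j - i)}.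
        pochhammer (of_nat (j - i + 1) * x) (lam i - lam j))"

definition B_den :: "nat \<Rightarrow> (nat \<Rightarrow> nat) \<Rightarrow> 'b::comm_ring_1 \<Rightarrow> 'b" where
  "B_den n lam x = (\<Prod>(i, j)\<in>{(i, j)\<in>{1..n} \<times> {1..n}. i < j \<and> even (j - i)}.
        pochhammer (of_nat (j - i) * x) (lam i - lam j))"

lemma B_expr_num_den: "B_expr n lam x = B_num n lam x / B_den n lam x"
  by (simp only: B_expr_def B_num_def B_den_def)

lemma pochhammer_hom:
  fixes h :: "'a::comm_ring_1 \<Rightarrow> 'b::comm_ring_1"
  assumes "\<And>u v. h (u + v) = h u + h v" "\<And>u v. h (u * v) = h u * h v" "h 1 = 1" "\<And>k. h (of_nat k) = of_nat k"
  shows "h (pochhammer (of_nat e * x) k) = pochhammer (of_nat e * h x) k"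
  by (induction k) (simp_all only: pochhammer_0 pochhammer_Suc assms)

text \<open>Needed for two homomorphisms out of the polynomial ring: evaluation at a scalar and the
  embedding into the field of fractions.\<close>

lemma B_num_den_hom:
  fixes h :: "'a::comm_ring_1 \<Rightarrow> 'b::comm_ring_1"
  assumes h: "\<And>u v. h (u + v) = h u + h v" "\<And>u v. h (u * v) = h u * h v" "h 1 = 1" "\<And>k. h (of_nat k) = of_nat k"
  shows "h (B_num n lam x) = B_num n lam (h x)" "h (B_den n lam x) = B_den n lam (h x)"
proof -
  have p: "h (prod f A) = (\<Prod>a\<in>A. h (f a))" for f :: "nat \<times> nat \<Rightarrow> 'a" and A
    by (induction A rule: infinite_finite_induct) (simp_all add: h)
  show "h (B_num n lam x) = B_num n lam (h x)" "h (B_den n lam x) = B_den n lam (h x)"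
    unfolding B_num_def B_den_def p case_prod_unfold pochhammer_hom[OF h] by (rule refl)+
qed

lemma B_den_nonzero:
  fixes r :: "'a::field_char_0"
  assumes "allowed r" "r \<noteq> 0"
  shows "B_den n lam r \<noteq> 0"
proof -
  have "finite {(i, j)\<in>{1..n} \<times> {1..n}. i < j \<and> even (j - i)}"
    by (rule finite_subset[of _ "{1..n} \<times> {1..n}"]) auto
  then show ?thesis
    unfolding B_den_def using pochhammer_mult_nonzero[OF assms]
    by (auto simp: prod_zero_iff simp del: of_nat_diff)
qed

text \<open>
  Both sides are rational in \<open>r\<close>, the left one has no pole at 0, and they agree at all positive integers.
\<close>

lemma R_top_at_zero:
  fixes lam :: "nat \<Rightarrow> nat"
  assumes n: "n \<ge> 1" and lam: "lam \<in> Lam n"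
  shows "eval_mpoly (\<lambda>_. 1) (R_top n (0 :: 'a::field_char_0) lam) =
    (if odd n \<or> bracket n lam 1 = 0 then ratfun_value (B_expr n lam (Fract [:0, 1:] 1)) 0 else 0)"
proof -
  have c: "(2::nat) = 1 \<or> (2::nat) = 2" by simp
  have g: "regular (\<lambda>r::'a. if mu = lam then 1 else 0)" for mu by (rule regular_const)
  obtain F :: "'a \<Rightarrow> (nat \<Rightarrow> 'a) \<Rightarrow> 'a" and V where F: "semisym_fam 2 n (csize 2 n lam) F V" "\<forall>r mu. allowed r \<longrightarrow> mu \<in> Lam n \<longrightarrow>
     csize 2 n mu \<le> csize 2 n lam \<longrightarrow> F r (node n r mu) = (if mu = lam then 1 else 0)"
    using interpolation[OF c, of n "\<lambda>r mu. if mu = lam then 1 else 0" "csize 2 n lam"] g by blast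
  have d: "delta_fun 2 n r lam (F r) (V r)" if "allowed r" for r
    unfolding delta_fun_def using semisym_fam_imp_semisym[OF F(1)] F(2) that by simp
  have val: "eval_mpoly (\<lambda>_. 1) (R_top n r lam) = norm_const 2 n lam r * V r" if "allowed r" for r
    by (rule R_top_delta_fun[OF that lam d[OF that]])
  have "regular (\<lambda>r. norm_const 2 n lam r * V r)"
    by (rule regular_mult[OF regular_norm_const semisym_fam_regular_symbol[OF F(1)]])
  then obtain P Q where PQ: "\<And>r. allowed r \<Longrightarrow> poly Q r \<noteq> 0 \<and> norm_const 2 n lam r * V r = poly P r / poly Q r"
    unfolding regular_def by blast
  have val_nat: "poly P (of_nat (Suc k)) / poly Q (of_nat (Suc k)) =
    (if odd n \<or> bracket n lam 1 = 0 then B_expr n lam (of_nat (Suc k) :: 'a) else 0)" for k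
  proof -
    have nz: "of_nat (Suc k) \<noteq> (0::'a)" by (simp del: of_nat_Suc)
    show ?thesis
      using R_top_nonzero[OF n allowed_of_nat nz lam] val[OF allowed_of_nat] PQ[OF allowed_of_nat] by metis
  qed
  have Q0: "poly Q 0 \<noteq> 0" and val0: "eval_mpoly (\<lambda>_. 1) (R_top n (0 :: 'a) lam) = poly P 0 / poly Q 0"
    using val[OF allowed_0] PQ[OF allowed_0] by auto
  show ?thesis
  proof (cases "odd n \<or> bracket n lam 1 = 0")
    case False
    have "P = 0"
    proof (rule poly_eqI_of_nat)
      fix k
      have "poly P (of_nat (Suc k)) / poly Q (of_nat (Suc k)) = 0"
        using val_nat[of k] by (simp only: False if_False)
      then show "poly P (of_nat (Suc k)) = poly 0 (of_nat (Suc k))"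
        using PQ[OF allowed_of_nat[of "Suc k"]] by (simp del: of_nat_Suc)
    qed
    then show ?thesis unfolding val0 by (simp only: False if_False poly_0 div_0)
  next
    case True
    let ?x = "[:0, 1:] :: 'a poly"
    have hp: "poly (B_num n lam ?x) r = B_num n lam r" "poly (B_den n lam ?x) r = B_den n lam r" for r
      using B_num_den_hom[of "\<lambda>p. poly p r" n lam ?x] by simp_all
    have hf: "Fract (B_num n lam ?x) 1 = B_num n lam (Fract ?x 1)" "Fract (B_den n lam ?x) 1 = B_den n lam (Fract ?x 1)"
      using B_num_den_hom[of "\<lambda>p. Fract p 1" n lam ?x] by (simp_all add: One_fract_def of_nat_fract)
    have eq: "B_num n lam ?x * Q = P * B_den n lam ?x"
    proof (rule poly_eqI_of_nat)
      fix k
      have nz: "of_nat (Suc k) \<noteq> (0::'a)" by (simp del: of_nat_Suc)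
      have "B_den n lam (of_nat (Suc k) :: 'a) \<noteq> 0" by (rule B_den_nonzero[OF allowed_of_nat nz])
      moreover have "poly P (of_nat (Suc k)) / poly Q (of_nat (Suc k)) = B_num n lam (of_nat (Suc k)) / B_den n lam (of_nat (Suc k))"
        using val_nat[of k] unfolding B_expr_num_den by (simp only: True if_True)
      ultimately show "poly (B_num n lam ?x * Q) (of_nat (Suc k)) = poly (P * B_den n lam ?x) (of_nat (Suc k))"
        using PQ[OF allowed_of_nat[of "Suc k"]] unfolding poly_mult hp by (simp add: frac_eq_eq del: of_nat_Suc)
    qed
    have den: "B_den n lam ?x \<noteq> 0"
    proof
      assume "B_den n lam ?x = 0"
      then have "B_den n lam (of_nat (Suc 0) :: 'a) = 0" using hp(2)[of "of_nat (Suc 0)"] by (simp del: of_nat_Suc)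
      then show False using B_den_nonzero[OF allowed_of_nat[where 'a = 'a, of "Suc 0"], of n lam] by simp
    qed
    have "Q \<noteq> 0" using Q0 by auto
    have "B_expr n lam (Fract ?x 1) = Fract (B_num n lam ?x) (B_den n lam ?x)"
      unfolding B_expr_num_den hf[symmetric] by simp
    also have "\<dots> = Fract P Q" using eq den \<open>Q \<noteq> 0\<close> by (simp add: eq_fract)
    finally have "ratfun_value (B_expr n lam (Fract ?x 1)) 0 = poly P 0 / poly Q 0"
      using ratfun_value_Fract[OF Q0] by simp
    then show ?thesis using True val0 by simp
  qed
qed

theorem theorem8p4:
  fixes r :: "'k::field_char_0" and n :: nat and lam :: "nat \<Rightarrow> nat"
  assumes "n \<ge> 1"
    and "\<not> (\<exists>q::rat. q < 0 \<and> r = of_rat q)"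
    and "lam \<in> Lam n"
  shows "eval_mpoly (\<lambda>_. 1) (R_top n r lam) =
           (if odd n \<or> bracket n lam 1 = 0 then B_coeff n lam r else 0)"
proof (cases "r = 0")
  case True
  show ?thesis unfolding True B_coeff_def using R_top_at_zero[OF assms(1,3)] by (simp only: simp_thms if_True)
next
  case False
  then show ?thesis
    using R_top_nonzero[OF assms(1) _ False assms(3)] assms(2) by (simp add: B_coeff_def allowed_def)
qed

end
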